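(* Let $M, N$ be positive integers with $N \ge M$, let $\lambda_S, \lambda_R, \mu > 0$, and let $\rho$ be a probability density on $[-\pi,\pi]$ whose Fourier series converges absolutely and which satisfies $\int_{-\pi}^{\pi} \rho(\theta)\sin\theta\cos\theta \, \mathrm{d}\theta = 0$. Let $f_0$ be a probability density on $\mathbb{R}^M$, set $F_0(\mathbf v,\mathbf w) = f_0(\mathbf v) e^{-\pi|\mathbf w|^2}$ for $(\mathbf v,\mathbf w)\in\mathbb{R}^M\times\mathbb{R}^N$, and let $$f(\mathbf v,t) = \int_{\mathbb{R}^N} \big(e^{\mathcal L t} F_0\big)(\mathbf v,\mathbf w)\,\mathrm{d}\mathbf w,$$ where $\mathcal L$ is the operator described in the context. Then for all $t\ge 0$, $$S(f(\cdot,t)) \le \left[\frac{M}{N+M} + \frac{N}{N+M} e^{-t\mu_\rho (N+M)/N}\right] S(f_0), \qquad \mu_\rho = \mu\int_{-\pi}^{\pi}\rho(\theta)\sin^2\theta\,\mathrm{d}\theta .$$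
   Context: Coordinates of $\mathbf z=(\mathbf v,\mathbf w)\in\mathbb{R}^{M+N}$ are indexed $1,\dots,M+N$, with $\mathbf v=(z_1,\dots,z_M)$ (the "system") and $\mathbf w=(z_{M+1},\dots,z_{M+N})$ (the "reservoir"). For $1\le i<j\le M+N$ and $\theta\in[-\pi,\pi]$, $r_{ij}(\theta)$ is the rotation of $\mathbb{R}^{M+N}$ in the $(i,j)$ coordinate plane such that $r_{ij}(\theta)^{-1}\mathbf z$ has $i$-th coordinate $z_i\cos\theta - z_j\sin\theta$, $j$-th coordinate $z_i\sin\theta+z_j\cos\theta$, and all other coordinates unchanged. Define $(R_{ij}F)(\mathbf z)=\int_{-\pi}^{\pi}\rho(\theta)F(r_{ij}(\theta)^{-1}\mathbf z)\,\mathrm{d}\theta$. The generator is $$\mathcal L=\frac{\lambda_S}{M-1}\sum_{1\le i<j\le M}(R_{ij}-I)+\frac{\lambda_R}{N-1}\sum_{M<i<j\le M+N}(R_{ij}-I)+\frac{\mu}{N}\sum_{i=1}^M\sum_{j=M+1}^{M+N}(R_{ij}-I),$$ a bounded operator on $L^1(\mathbb{R}^{M+N})$ (a term whose sum is empty is absent), and $e^{\mathcal L t}$ is its exponential. The entropy relative to the thermal state is $S(g)=\int_{\mathbb{R}^M} g(\mathbf v)\log\big(g(\mathbf v)/e^{-\pi|\mathbf v|^2}\big)\,\mathrm{d}\mathbf v$. *)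

theory Defs
  imports "HOL-Analysis.Analysis"
begin

text \<open>Coordinates are 0-based: z = (z 0, ..., z (M+N-1)); system = indices < M,
  reservoir = indices M ..< M+N.  Points of R^n are elements of
  PiM {..<n} (\<lambda>_. lborel).\<close>

abbreviation Rn :: "nat \<Rightarrow> (nat \<Rightarrow> real) measure" where
  "Rn n \<equiv> PiM {..<n} (\<lambda>_. lborel)"

definition rotinv :: "nat \<Rightarrow> nat \<Rightarrow> real \<Rightarrow> (nat \<Rightarrow> real) \<Rightarrow> (nat \<Rightarrow> real)" where
  "rotinv i j \<theta> z = z(i := z i * cos \<theta> - z j * sin \<theta>, j := z i * sin \<theta> + z j * cos \<theta>)"

definition Rop :: "(real \<Rightarrow> real) \<Rightarrow> nat \<Rightarrow> nat \<Rightarrow> ((nat \<Rightarrow> real) \<Rightarrow> real) \<Rightarrow> (nat \<Rightarrow> real) \<Rightarrow> real" where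
  "Rop \<rho> i j F z = (LINT \<theta>:{-pi..pi}|lborel. \<rho> \<theta> * F (rotinv i j \<theta> z))"

text \<open>The generator L (acting pointwise on representatives).\<close>
definition gen :: "nat \<Rightarrow> nat \<Rightarrow> real \<Rightarrow> real \<Rightarrow> real \<Rightarrow> (real \<Rightarrow> real)
    \<Rightarrow> ((nat \<Rightarrow> real) \<Rightarrow> real) \<Rightarrow> (nat \<Rightarrow> real) \<Rightarrow> real" where
  "gen M N lamS lamR mu \<rho> F z =
     lamS / (real M - 1) * (\<Sum>i<M. \<Sum>j\<in>{i<..<M}. Rop \<rho> i j F z - F z)
   + lamR / (real N - 1) * (\<Sum>i\<in>{M..<M+N}. \<Sum>j\<in>{i<..<M+N}. Rop \<rho> i j F z - F z)
   + mu / real N * (\<Sum>i<M. \<Sum>j\<in>{M..<M+N}. Rop \<rho> i j F z - F z)"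

definition is_exp_gen :: "nat \<Rightarrow> nat \<Rightarrow> real \<Rightarrow> real \<Rightarrow> real \<Rightarrow> (real \<Rightarrow> real) \<Rightarrow> real
    \<Rightarrow> ((nat \<Rightarrow> real) \<Rightarrow> real) \<Rightarrow> ((nat \<Rightarrow> real) \<Rightarrow> real) \<Rightarrow> bool" where
  "is_exp_gen M N lamS lamR mu \<rho> t F G \<longleftrightarrow>
     G \<in> borel_measurable (Rn (M+N)) \<and>
     (\<lambda>n. \<integral>\<^sup>+ z. ennreal \<bar>(\<Sum>k<n. t ^ k / fact k * ((gen M N lamS lamR mu \<rho> ^^ k) F) z) - G z\<bar> \<partial>Rn (M+N))
       \<longlonglongrightarrow> 0"

definition merge_vw :: "nat \<Rightarrow> nat \<Rightarrow> (nat \<Rightarrow> real) \<Rightarrow> (nat \<Rightarrow> real) \<Rightarrow> (nat \<Rightarrow> real)" where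
  "merge_vw M N v w = (\<lambda>i. if i < M then v i else if i < M + N then w (i - M) else undefined)"

definition gauss :: "nat \<Rightarrow> (nat \<Rightarrow> real) \<Rightarrow> real" where
  "gauss n v = exp (- pi * (\<Sum>i<n. (v i)\<^sup>2))"

text \<open>Relative entropy w.r.t. the thermal state; +\<infinity> when the integrand is not integrable
  (its negative part is always integrable for a probability density).\<close>
definition rel_entropy :: "nat \<Rightarrow> ((nat \<Rightarrow> real) \<Rightarrow> real) \<Rightarrow> ereal" where
  "rel_entropy M g =
     (if integrable (Rn M) (\<lambda>v. g v * ln (g v / gauss M v))
      then ereal (\<integral>v. g v * ln (g v / gauss M v) \<partial>Rn M) else \<infinity>)"

end

theory Submission
  imports Defs "HOL-Probability.Probability"
begin

text \<open>
  Write the relative entropy as a supremum over test functions $\phi$ of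
  $\int \phi f - \log\int e^\phi\,d\gamma$. By duality $\int\phi f(t) = \int (K\phi) F_0$, where $K$
  averages over a Poisson number of random reversed rotations, so by the Gibbs variational principle it
  suffices that $C\log\int e^{K\phi/C}d\gamma \le \log\int e^{\phi}d\gamma$, with $C$ the bracket
  in the statement. This holds because $K$ commutes with the Gaussian convolutions $B_\varepsilon$, and
  because $|\nabla K\phi|^2 \le C\,K|\nabla\phi|^2$ for functions $\phi$ of the system variables: the
  constant is the largest eigenvalue of the average of $R^TP^TPR$ ($P$ the projection onto the system
  variables), and the generator acts linearly on the span of $|v|^2$ and $|w|^2$.
  With $e^\phi=\psi$, each Gaussian step gives
  $B_\varepsilon e^{K\log\psi/C} \le e^{(K \log B_\varepsilon\psi)/C + O(\varepsilon^3)}$; one composes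
  $m$ steps of size $\varepsilon=m^{-1/2}$ and evaluates at the origin, which every rotation fixes.
\<close>

section \<open>Gaussian measure and its rotation invariance\<close>

text \<open>Why one Gaussian step works: to second order, the logarithm of the average of e^h over a
  Gaussian of scale epsilon is the average of h plus epsilon^2 |grad h|^2 / (4 pi). With g = log psi
  and h = K g / C the correction is epsilon^2 |grad K g|^2 / (4 pi C^2), and the gradient bound
  lowers it to 1/C times the K-average of the correction that g itself receives. The m errors add up
  to a multiple of m epsilon^3 = m^(-1/2). The obstacle is uniformity: one error constant must serve
  all the functions met on the way. It depends only on a positive lower bound, an upper bound, and
  first- and second-order bounds along segments, and Gaussian averages keep all of these. The other
  obstacle is that the evolved state is known only as an L^1 limit. It is therefore reached only
  through pairings with bounded functions; positivity of the marginal is recovered from them, and so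
  is its entropy, as a limit over truncated and discretised logarithms.\<close>

definition gam1 :: "real measure" where
  "gam1 = density lborel (\<lambda>x. ennreal (exp (- pi * x\<^sup>2)))"

definition gam :: "nat \<Rightarrow> (nat \<Rightarrow> real) measure" where
  "gam n = PiM {..<n} (\<lambda>_. gam1)"

text \<open>The point z + s w. The restriction makes it extensional, that is, a point of
  \<open>Rn n\<close>, whatever \<open>z\<close> and \<open>w\<close> are outside the index
  range.\<close>

definition vadd :: "nat \<Rightarrow> (nat \<Rightarrow> real) \<Rightarrow> real \<Rightarrow> (nat \<Rightarrow> real) \<Rightarrow> (nat \<Rightarrow> real)" where
  "vadd n z s w = (\<lambda>i\<in>{..<n}. z i + s * w i)"

definition nsq :: "nat \<Rightarrow> (nat \<Rightarrow> real) \<Rightarrow> real" where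
  "nsq n z = (\<Sum>i<n. (z i)\<^sup>2)"

text \<open>Matching exp (- pi x^2) with the normal density gives standard deviation 1 / sqrt (2
  pi); total mass and all moments then come from the normal law. This variance is the origin of the
  later factors 2 pi and 4 pi.\<close>

lemma gam1_eq_normal: "gam1 = density lborel (normal_density 0 (1 / sqrt (2 * pi)))"
proof -
  have "exp (- pi * x\<^sup>2) = normal_density 0 (1 / sqrt (2 * pi)) x" for x
    unfolding normal_density_def
    by (simp add: power_divide real_sqrt_mult[symmetric])
  then show ?thesis unfolding gam1_def by presburger
qed

lemma sets_gam1[measurable_cong, simp]: "sets gam1 = sets borel"
  and space_gam1[simp]: "space gam1 = UNIV"
  by (simp_all add: gam1_def)

lemma prob_space_gam1: "prob_space gam1"
  unfolding gam1_eq_normal by (rule prob_space_normal_density) simp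

lemma sets_Rn[simp]: "sets (Rn n) = sets (PiM {..<n} (\<lambda>_. borel))"
  by (rule sets_PiM_cong) auto

lemma sets_gam: "sets (gam n) = sets (Rn n)"
  unfolding gam_def by (rule sets_PiM_cong) auto

lemma sets_gam'[measurable_cong]: "sets (gam n) = sets (PiM {..<n} (\<lambda>_. borel))"
  unfolding gam_def by (rule sets_PiM_cong) auto

lemma space_gam: "space (gam n) = space (Rn n)"
  using sets_gam by (rule sets_eq_imp_space_eq)

lemma space_Rn: "space (Rn n) = extensional {..<n}"
  by (auto simp: space_PiM PiE_def)

interpretation lb: product_sigma_finite "\<lambda>_::nat. lborel :: real measure" ..

interpretation g1: prob_space gam1 by (rule prob_space_gam1)
interpretation G1: product_prob_space "\<lambda>_::nat. gam1" UNIV ..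

lemma prob_space_gam: "prob_space (gam n)"
  unfolding gam_def by (intro prob_space_PiM prob_space_gam1)

interpretation gam: prob_space "gam n" for n by (rule prob_space_gam)

interpretation Rn: sigma_finite_measure "Rn n" for n
  by (intro lb.sigma_finite) simp

lemma measurable_component_Rn: "i < n \<Longrightarrow> (\<lambda>z. z i) \<in> borel_measurable (Rn n)"
  by (simp add: measurable_component_singleton measurable_cong_sets[OF sets_Rn refl])

lemma measurable_gauss[measurable]: "gauss n \<in> borel_measurable (Rn n)"
proof -
  have [measurable]: "(\<lambda>v. \<Sum>i<n. (v i)\<^sup>2 :: real) \<in> borel_measurable (Rn n)"
    by (intro borel_measurable_sum borel_measurable_power measurable_component_Rn) auto
  show ?thesis unfolding gauss_def by measurable
qed

lemma gauss_prod: "gauss n z = (\<Prod>i<n. exp (- pi * (z i)\<^sup>2))"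
  unfolding gauss_def by (simp add: exp_sum sum_distrib_left)

text \<open>Both sides are compared on boxes, where the exponential of the sum of squares
  factorises.\<close>

lemma gam_eq_density: "gam n = density (Rn n) (\<lambda>z. ennreal (gauss n z))"
proof -
  have "density (Rn n) (\<lambda>z. ennreal (gauss n z)) = PiM {..<n} (\<lambda>_. gam1)"
  proof (rule G1.PiM_eqI)
    fix A :: "nat \<Rightarrow> real set" assume "\<And>i. i \<in> {..<n} \<Longrightarrow> A i \<in> sets gam1"
    then have A[measurable]: "i < n \<Longrightarrow> A i \<in> sets borel" for i by simp
    have P[measurable]: "Pi\<^sub>E {..<n} A \<in> sets (Rn n)"
      by (intro sets_PiM_I_finite) auto
    have "emeasure (density (Rn n) (\<lambda>z. ennreal (gauss n z))) (Pi\<^sub>E {..<n} A)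
      = (\<integral>\<^sup>+ z. ennreal (gauss n z) * indicator (Pi\<^sub>E {..<n} A) z \<partial>Rn n)"
      by (subst emeasure_density) (use P in auto)
    also have "\<dots> = (\<integral>\<^sup>+ z. (\<Prod>i<n. ennreal (exp (- pi * (z i)\<^sup>2)) * indicator (A i) (z i)) \<partial>Rn n)"
    proof (rule nn_integral_cong)
      fix z assume z: "z \<in> space (Rn n)"
      show "ennreal (gauss n z) * indicator (Pi\<^sub>E {..<n} A) z
        = (\<Prod>i<n. ennreal (exp (- pi * (z i)\<^sup>2)) * indicator (A i) (z i))"
      proof (cases "z \<in> Pi\<^sub>E {..<n} A")
        case True
        have "(\<Prod>i<n. ennreal (exp (- pi * (z i)\<^sup>2)) * indicator (A i) (z i))
          = (\<Prod>i<n. ennreal (exp (- pi * (z i)\<^sup>2)))"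
          by (rule prod.cong) (use PiE_mem[OF True] in simp_all)
        then show ?thesis using True by (simp add: gauss_prod prod_ennreal)
      next
        case False
        then obtain i where "i < n" "z i \<notin> A i" using z by (auto simp: space_PiM PiE_def Pi_def)
        then have "(\<Prod>i<n. ennreal (exp (- pi * (z i)\<^sup>2)) * indicator (A i) (z i)) = 0"
          by (intro prod_zero[OF finite_lessThan] bexI[of _ i]) simp_all
        then show ?thesis using False by simp
      qed
    qed
    also have "\<dots> = (\<Prod>i<n. (\<integral>\<^sup>+ x. ennreal (exp (- pi * x\<^sup>2)) * indicator (A i) x \<partial>lborel))"
      by (rule lb.product_nn_integral_prod) auto
    also have "\<dots> = (\<Prod>i<n. emeasure gam1 (A i))"
      unfolding gam1_def by (intro prod.cong refl) (subst emeasure_density, auto)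
    finally show "emeasure (density (Rn n) (\<lambda>z. ennreal (gauss n z))) (Pi\<^sub>E {..<n} A)
      = (\<Prod>i<n. emeasure gam1 (A i))" .
  qed (simp_all add: sets_gam[unfolded gam_def, simplified])
  then show ?thesis by (simp add: gam_def)
qed

section \<open>Invariance of Lebesgue and Gaussian measure under rotations\<close>

lemma space_RnD: "z \<in> space (Rn n) \<Longrightarrow> \<not> i < n \<Longrightarrow> z i = undefined"
  by (auto simp: space_PiM PiE_def extensional_def)

lemma measurable_RnI:
  assumes "\<And>i. i < n \<Longrightarrow> (\<lambda>x. f x i) \<in> borel_measurable A"
    and "\<And>x i. x \<in> space A \<Longrightarrow> \<not> i < n \<Longrightarrow> f x i = undefined"
  shows "f \<in> measurable A (Rn n)"
  unfolding measurable_cong_sets[OF refl sets_Rn]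
  by (rule measurable_PiM_single') (use assms in \<open>auto simp: PiE_def extensional_def\<close>)

text \<open>When coordinate \<open>i\<close> is integrated first, with the others fixed, the shear
  is a translation by a constant, and one-dimensional Lebesgue measure is translation
  invariant.\<close>

lemma shear_preserves:
  assumes ij: "i < n" "j < n" "i \<noteq> j"
    and f[measurable]: "f \<in> borel_measurable (Rn n)"
  shows "(\<integral>\<^sup>+ z. f (z(i := z i + a * z j)) \<partial>Rn n) = (\<integral>\<^sup>+ z. f z \<partial>Rn n)"
proof -
  define I where "I = {..<n} - {i}"
  have I: "{..<n} = insert i I" "finite I" "i \<notin> I" using ij by (auto simp: I_def)
  have m: "(\<lambda>z. z(i := z i + a * z j)) \<in> measurable (Rn n) (Rn n)"
    by (rule measurable_RnI) (use ij in \<open>auto simp: space_RnD fun_upd_def intro!: borel_measurable_add borel_measurable_times measurable_component_Rn\<close>)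
  have mf: "(\<lambda>z. f (z(i := z i + a * z j))) \<in> borel_measurable (Rn n)"
    by (rule measurable_compose[OF m f])
  have "(\<integral>\<^sup>+ z. f (z(i := z i + a * z j)) \<partial>Rn n)
    = (\<integral>\<^sup>+ x. (\<integral>\<^sup>+ y. f ((x(i := y))(i := (x(i:=y)) i + a * (x(i:=y)) j)) \<partial>lborel) \<partial>PiM I (\<lambda>_. lborel))"
    unfolding I(1)
    by (rule lb.product_nn_integral_insert) (use mf I(2,3) in \<open>simp_all flip: I(1)\<close>)
  also have "\<dots> = (\<integral>\<^sup>+ x. (\<integral>\<^sup>+ y. f (x(i := y)) \<partial>lborel) \<partial>PiM I (\<lambda>_. lborel))"
  proof (rule nn_integral_cong)
    fix x assume x: "x \<in> space (PiM I (\<lambda>_. lborel :: real measure))"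
    have mm: "(\<lambda>y. f (x(i := y))) \<in> borel_measurable borel"
    proof (rule measurable_compose[OF _ f])
      show "(\<lambda>y. x(i := y)) \<in> measurable borel (Rn n)"
        by (rule measurable_RnI)
          (use x ij in \<open>auto simp: fun_upd_def space_PiM PiE_def extensional_def I_def\<close>)
    qed
    have "(\<integral>\<^sup>+ y. f (x(i := y)) \<partial>lborel) = (\<integral>\<^sup>+ y. f (x(i := y)) \<partial>distr lborel borel ((+) (a * x j)))"
      by (simp add: lborel_distr_plus)
    also have "\<dots> = (\<integral>\<^sup>+ y. f (x(i := y + a * x j)) \<partial>lborel)"
      using mm by (subst nn_integral_distr) (simp_all add: add.commute)
    finally show "(\<integral>\<^sup>+ y. f ((x(i := y))(i := (x(i:=y)) i + a * (x(i:=y)) j)) \<partial>lborel)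
      = (\<integral>\<^sup>+ y. f (x(i := y)) \<partial>lborel)" using ij by simp
  qed
  also have "\<dots> = (\<integral>\<^sup>+ z. f z \<partial>Rn n)"
    unfolding I(1)
    by (rule lb.product_nn_integral_insert[symmetric]) (use f I(2,3) in \<open>simp_all flip: I(1)\<close>)
  finally show ?thesis .
qed

lemma measurable_shear: "i < n \<Longrightarrow> j < n \<Longrightarrow> (\<lambda>z. z(i := z i + a * z j)) \<in> measurable (Rn n) (Rn n)"
  by (rule measurable_RnI)
    (auto simp: space_RnD fun_upd_def intro!: borel_measurable_add borel_measurable_times measurable_component_Rn)

lemma measurable_rotinv_pair:
  assumes "i < n" "j < n" and h: "h \<in> borel_measurable A" and g: "g \<in> measurable A (Rn n)"
  shows "(\<lambda>x. rotinv i j (h x) (g x)) \<in> measurable A (Rn n)"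
proof (rule measurable_RnI)
  have c: "(\<lambda>x. g x k) \<in> borel_measurable A" if "k < n" for k
    by (rule measurable_compose[OF g measurable_component_Rn[OF that]])
  note [measurable] = c[OF assms(1)] c[OF assms(2)] h
  show "(\<lambda>x. rotinv i j (h x) (g x) k) \<in> borel_measurable A" if "k < n" for k
    using c[OF that] unfolding rotinv_def fun_upd_def by (cases "k = i"; cases "k = j"; simp)
  show "rotinv i j (h x) (g x) k = undefined" if "x \<in> space A" "\<not> k < n" for x k
    using that assms measurable_space[OF g that(1)] by (auto simp: rotinv_def space_RnD)
qed

lemma measurable_rotinv: "i < n \<Longrightarrow> j < n \<Longrightarrow> rotinv i j \<theta> \<in> measurable (Rn n) (Rn n)"
  using measurable_rotinv_pair[of i n j "\<lambda>_. \<theta>" "Rn n" "\<lambda>x. x"] by simp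

lemma rotinv_add:
  "i \<noteq> j \<Longrightarrow> rotinv i j \<alpha> (rotinv i j \<beta> z) = rotinv i j (\<alpha> + \<beta>) z"
  by (auto simp: rotinv_def fun_eq_iff cos_add sin_add algebra_simps)

text \<open>The rotation is a product of three shears; this needs \<open>cos (\<theta>/2) \<noteq> 0\<close>.\<close>
lemma rotinv_preserves_aux:
  assumes ij: "i < n" "j < n" "i \<noteq> j" and c: "cos (\<theta>/2) \<noteq> 0"
    and f[measurable]: "f \<in> borel_measurable (Rn n)"
  shows "(\<integral>\<^sup>+ z. f (rotinv i j \<theta> z) \<partial>Rn n) = (\<integral>\<^sup>+ z. f z \<partial>Rn n)"
proof -
  define s c where "s = sin (\<theta>/2)" and "c = cos (\<theta>/2)"
  have cs: "c \<noteq> 0" "c\<^sup>2 = 1 - s\<^sup>2" using assms by (auto simp: c_def s_def cos_squared_eq)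
  have si: "sin \<theta> = 2 * s * c" using sin_double[of "\<theta>/2"] by (simp add: s_def c_def)
  have co: "cos \<theta> = 1 - 2 * s\<^sup>2" using cos_double_sin[of "\<theta>/2"] by (simp add: s_def)
  define T where "T = (\<lambda>(i::nat) (j::nat) (a::real) (z::nat \<Rightarrow> real). z(i := z i + a * z j))"
  \<comment> \<open>The two outer shears have slope - tan (theta/2), the middle one sin
    theta.\<close>
  have e: "rotinv i j \<theta> z = T i j (- s/c) (T j i (sin \<theta>) (T i j (- s/c) z))" for z
  proof -
    have "s * s * s = s - s*c\<^sup>2" unfolding cs(2) by (simp add: power2_eq_square algebra_simps)
    then have "2 * s * c = (2 * s - 2 * (s * s * s)) / c"
      using cs(1) by (simp add: power2_eq_square)
    moreover have "z i + (- s/c) * z j + (-s/c) * (z j + 2 * s*c*(z i + (-s/c) * z j))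
        = z i * (1 - 2 * s\<^sup>2) - z j * ((2 * s - 2 * (s * s * s)) / c)"
      using cs(1) by (simp add: field_simps power2_eq_square)
    ultimately have 1: "z i * (1 - 2 * s\<^sup>2) - z j * (2 * s * c)
        = z i + (- s/c) * z j + (-s/c) * (z j + 2 * s*c*(z i + (-s/c) * z j))"
      by simp
    have 2: "z i * (2 * s*c) + z j * (1 - 2 * s\<^sup>2) = z j + 2 * s*c*(z i + (-s/c) * z j)"
      using cs(1) by (simp add: field_simps power2_eq_square)
    show ?thesis using ij 1 2 unfolding rotinv_def T_def si co
      by (auto simp: fun_eq_iff)
  qed
  have m: "T i j a \<in> measurable (Rn n) (Rn n)" "T j i a \<in> measurable (Rn n) (Rn n)" for a
    unfolding T_def using ij by (auto intro!: measurable_shear)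
  note mc = measurable_compose[OF m(1)] measurable_compose[OF m(2)]
  have p: "(\<integral>\<^sup>+ z. g (T i j a z) \<partial>Rn n) = (\<integral>\<^sup>+ z. g z \<partial>Rn n)"
      "(\<integral>\<^sup>+ z. g (T j i a z) \<partial>Rn n) = (\<integral>\<^sup>+ z. g z \<partial>Rn n)"
    if "g \<in> borel_measurable (Rn n)" for g a
    unfolding T_def using shear_preserves[OF _ _ _ that] ij by auto
  have "(\<integral>\<^sup>+ z. f (T i j (- s/c) (T j i (sin \<theta>) (T i j (- s/c) z))) \<partial>Rn n)
    = (\<integral>\<^sup>+ z. f (T i j (- s/c) (T j i (sin \<theta>) z)) \<partial>Rn n)"
    by (rule p(1)) (rule mc(2), rule mc(1), rule f)
  also have "\<dots> = (\<integral>\<^sup>+ z. f (T i j (- s/c) z) \<partial>Rn n)"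
    by (rule p(2)) (rule mc(1), rule f)
  also have "\<dots> = (\<integral>\<^sup>+ z. f z \<partial>Rn n)"
    by (rule p(1)) (rule f)
  finally show ?thesis unfolding e .
qed

lemma rotinv_preserves:
  assumes ij: "i < n" "j < n" "i \<noteq> j"
    and f[measurable]: "f \<in> borel_measurable (Rn n)"
  shows "(\<integral>\<^sup>+ z. f (rotinv i j \<theta> z) \<partial>Rn n) = (\<integral>\<^sup>+ z. f z \<partial>Rn n)"
proof (cases "cos (\<theta>/2) = 0")
  case True
  \<comment> \<open>In the exceptional case the rotation is done in two halves. If cos (theta/4)
    vanished as well, the double angle formula would give cos (theta/2) = -1 instead of 0.\<close>
  have c: "cos ((\<theta>/2)/2) \<noteq> 0"
    using True cos_double_cos[of "\<theta>/4"] sin_cos_squared_add[of "\<theta>/2"] sin_double[of "\<theta>/4"]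
    by auto
  have e: "rotinv i j \<theta> z = rotinv i j (\<theta>/2) (rotinv i j (\<theta>/2) z)" for z
    using ij by (simp add: rotinv_add)
  have "(\<integral>\<^sup>+ z. f (rotinv i j (\<theta>/2) (rotinv i j (\<theta>/2) z)) \<partial>Rn n)
    = (\<integral>\<^sup>+ z. f (rotinv i j (\<theta>/2) z) \<partial>Rn n)"
    by (rule rotinv_preserves_aux[OF ij c]) (rule measurable_compose[OF measurable_rotinv[OF ij(1,2)] f])
  also have "\<dots> = (\<integral>\<^sup>+ z. f z \<partial>Rn n)" by (rule rotinv_preserves_aux[OF ij c f])
  finally show ?thesis unfolding e .
qed (use rotinv_preserves_aux[OF ij _ f] in auto)

lemma sum_two:
  fixes f :: "nat \<Rightarrow> real"
  assumes "finite A" "i \<in> A" "j \<in> A" "i \<noteq> j"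
  shows "sum f A = f i + f j + sum f (A - {i,j})"
proof -
  have "sum f A = f i + sum f (A - {i})" using assms by (simp add: sum.remove)
  also have "sum f (A - {i}) = f j + sum f (A - {i} - {j})" using assms by (intro sum.remove) auto
  also have "A - {i} - {j} = A - {i,j}" by auto
  finally show ?thesis by simp
qed

lemma nsq_rotinv:
  assumes "i < n" "j < n" "i \<noteq> j"
  shows "nsq n (rotinv i j \<theta> z) = nsq n z"
proof -
  have "(z i * cos \<theta> - z j * sin \<theta>)\<^sup>2 + (z i * sin \<theta> + z j * cos \<theta>)\<^sup>2
    = ((z i)\<^sup>2 + (z j)\<^sup>2) * ((sin \<theta>)\<^sup>2 + (cos \<theta>)\<^sup>2)"
    by (simp only: power2_eq_square) algebra
  then have "(z i * cos \<theta> - z j * sin \<theta>)\<^sup>2 + (z i * sin \<theta> + z j * cos \<theta>)\<^sup>2 = (z i)\<^sup>2 + (z j)\<^sup>2"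
    by simp
  moreover have "(\<Sum>k\<in>{..<n}-{i,j}. (rotinv i j \<theta> z k)\<^sup>2) = (\<Sum>k\<in>{..<n}-{i,j}. (z k)\<^sup>2)"
    by (intro sum.cong) (auto simp: rotinv_def)
  ultimately show ?thesis
    unfolding nsq_def using assms
    by (subst (1 2) sum_two[where i=i and j=j]) (auto simp: rotinv_def)
qed

lemma gauss_nsq: "gauss n z = exp (- pi * nsq n z)"
  by (simp add: gauss_def nsq_def)

lemma distr_rotinv_Rn:
  assumes ij: "i < n" "j < n" "i \<noteq> j"
  shows "distr (Rn n) (Rn n) (rotinv i j \<theta>) = Rn n"
proof (rule measure_eqI)
  fix A assume "A \<in> sets (distr (Rn n) (Rn n) (rotinv i j \<theta>))"
  then have A[measurable]: "A \<in> sets (Rn n)" by simp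
  note m = measurable_rotinv[OF ij(1,2), of \<theta>]
  have "emeasure (distr (Rn n) (Rn n) (rotinv i j \<theta>)) A
     = (\<integral>\<^sup>+ z. indicator A z \<partial>distr (Rn n) (Rn n) (rotinv i j \<theta>))"
    by (rule nn_integral_indicator[symmetric]) (use A in simp)
  also have "\<dots> = (\<integral>\<^sup>+ z. indicator A (rotinv i j \<theta> z) \<partial>Rn n)"
    by (rule nn_integral_distr) (use m A in \<open>simp_all del: sets_Rn\<close>)
  also have "\<dots> = (\<integral>\<^sup>+ z. indicator A z \<partial>Rn n)"
    by (rule rotinv_preserves[OF ij]) (use A in simp)
  also have "\<dots> = emeasure (Rn n) A" using A by (simp del: sets_Rn)
  finally show "emeasure (distr (Rn n) (Rn n) (rotinv i j \<theta>)) A = emeasure (Rn n) A" .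
qed simp

text \<open>The density of \<open>gam n\<close> depends only on \<open>nsq\<close>, which the
  rotation fixes, so the invariance descends from that of Lebesgue measure.\<close>

lemma distr_rotinv_gam:
  assumes ij: "i < n" "j < n" "i \<noteq> j"
  shows "distr (gam n) (gam n) (rotinv i j \<theta>) = gam n"
proof (rule measure_eqI)
  fix A assume "A \<in> sets (distr (gam n) (gam n) (rotinv i j \<theta>))"
  then have A[measurable]: "A \<in> sets (Rn n)" by (simp add: sets_gam)
  note m = measurable_rotinv[OF ij(1,2), of \<theta>]
  have m': "rotinv i j \<theta> \<in> measurable (gam n) (gam n)"
    using m by (simp add: measurable_cong_sets[OF sets_gam sets_gam])
  have "emeasure (distr (gam n) (gam n) (rotinv i j \<theta>)) A
     = (\<integral>\<^sup>+ z. indicator A z \<partial>distr (gam n) (gam n) (rotinv i j \<theta>))"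
    by (rule nn_integral_indicator[symmetric]) (use A in \<open>simp add: sets_gam\<close>)
  also have "\<dots> = (\<integral>\<^sup>+ z. indicator A (rotinv i j \<theta> z) \<partial>gam n)"
    by (rule nn_integral_distr) (use m' A in \<open>simp_all add: sets_gam del: sets_Rn\<close>)
  also have "\<dots> = (\<integral>\<^sup>+ z. ennreal (gauss n z) * indicator A (rotinv i j \<theta> z) \<partial>Rn n)"
    unfolding gam_eq_density
    by (rule nn_integral_density) (use measurable_compose[OF m borel_measurable_indicator[OF A]] in auto)
  also have "\<dots> = (\<integral>\<^sup>+ z. ennreal (gauss n (rotinv i j \<theta> z)) * indicator A (rotinv i j \<theta> z) \<partial>Rn n)"
    by (simp add: gauss_nsq nsq_rotinv[OF ij])
  also have "\<dots> = (\<integral>\<^sup>+ z. ennreal (gauss n z) * indicator A z \<partial>Rn n)"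
    by (rule rotinv_preserves[OF ij]) (use borel_measurable_indicator[OF A] in measurable)
  also have "\<dots> = emeasure (gam n) A"
    unfolding gam_eq_density by (rule emeasure_density[symmetric]) (use A in auto)
  finally show "emeasure (distr (gam n) (gam n) (rotinv i j \<theta>)) A = emeasure (gam n) A" .
qed simp

section \<open>Gaussian convolution\<close>

lemma measurable_gam_Rn: "measurable (gam n) N = measurable (Rn n) N"
  by (rule measurable_cong_sets[OF sets_gam refl])

lemma measurable_Rn_gam: "measurable N (gam n) = measurable N (Rn n)"
  by (rule measurable_cong_sets[OF refl sets_gam])

lemma measurable_component_gam: "i < n \<Longrightarrow> (\<lambda>z. z i) \<in> borel_measurable (gam n)"
  unfolding measurable_gam_Rn by (rule measurable_component_Rn)

text \<open>Two independent Gaussians form a Gaussian point of the plane. The combination s x + t y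
  is r times one coordinate of the rotated point, and rotating does not change the law.\<close>

lemma gauss_conv1:
  assumes f[measurable]: "f \<in> borel_measurable borel" and r: "s\<^sup>2 + t\<^sup>2 = r\<^sup>2" "0 < r"
  shows "(\<integral>\<^sup>+ x. (\<integral>\<^sup>+ y. f (s * x + t * y) \<partial>gam1) \<partial>gam1) = (\<integral>\<^sup>+ x. f (r * x) \<partial>gam1)"
proof -
  have "(s/r)\<^sup>2 + (t/r)\<^sup>2 = 1" using r by (simp add: power_divide flip: add_divide_distrib)
  \<comment> \<open>The sign of \<open>t\<close> is flipped because the first coordinate of
    \<open>rotinv\<close> carries - sin.\<close>
  then have "(s/r)\<^sup>2 + (- (t/r))\<^sup>2 = 1" by simp
  then obtain \<theta> where \<theta>: "s / r = cos \<theta>" "- (t / r) = sin \<theta>"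
    using sincos_total_2pi by metis
  then have st: "s = r * cos \<theta>" "t = - r * sin \<theta>" using r by (auto simp: field_simps)
  have two: "{..<2::nat} = {0, 1}" by auto
  have m: "rotinv 0 1 \<theta> \<in> measurable (gam 2) (gam 2)"
    using measurable_rotinv[of 0 2 1 \<theta>] by (simp add: measurable_cong_sets[OF sets_gam sets_gam])
  have c: "(\<lambda>z. f (r * z 0)) \<in> borel_measurable (gam 2)"
    by (rule measurable_compose[OF measurable_component_gam]) auto
  have eq: "f (s * z 0 + t * z 1) = f (r * rotinv 0 1 \<theta> z 0)" for z
    by (simp add: st rotinv_def algebra_simps)
  have "(\<integral>\<^sup>+ x. (\<integral>\<^sup>+ y. f (s * x + t * y) \<partial>gam1) \<partial>gam1)
    = (\<integral>\<^sup>+ p. f (s * fst p + t * snd p) \<partial>(gam1 \<Otimes>\<^sub>M gam1))"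
    by (subst g1.nn_integral_fst[symmetric]) auto
  also have "\<dots> = (\<integral>\<^sup>+ z. f (s * z 0 + t * z 1) \<partial>gam 2)"
    unfolding gam_def two by (subst G1.product_nn_integral_pair[symmetric]) auto
  also have "\<dots> = (\<integral>\<^sup>+ z. f (r * rotinv 0 1 \<theta> z 0) \<partial>gam 2)"
    unfolding eq ..
  also have "\<dots> = (\<integral>\<^sup>+ z. f (r * z 0) \<partial>distr (gam 2) (gam 2) (rotinv 0 1 \<theta>))"
    by (subst nn_integral_distr[OF m]) (use c in auto)
  also have "\<dots> = (\<integral>\<^sup>+ z. f (r * z 0) \<partial>gam 2)"
    by (subst distr_rotinv_gam) auto
  also have "\<dots> = (\<integral>\<^sup>+ p. f (r * fst p) \<partial>(gam1 \<Otimes>\<^sub>M gam1))"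
    unfolding gam_def two by (subst G1.product_nn_integral_pair[symmetric, of "\<lambda>x y. f (r * x)"]) auto
  also have "\<dots> = (\<integral>\<^sup>+ x. f (r * x) \<partial>gam1)"
    by (subst g1.nn_integral_fst[symmetric]) (auto simp: g1.emeasure_space_1[simplified])
  finally show ?thesis .
qed

lemma measurable_lin_pair:
  "(\<lambda>(x, y). \<lambda>i\<in>{..<n}. s * x i + t * y i) \<in> measurable (gam n \<Otimes>\<^sub>M gam n) (Rn n)"
  unfolding measurable_cong_sets[OF refl sets_Rn]
proof (rule measurable_PiM_single')
  fix i assume i: "i \<in> {..<n}"
  have [measurable]: "(\<lambda>z. z i) \<in> borel_measurable (gam n)" using i by (intro measurable_component_gam) simp
  show "(\<lambda>p. (case p of (x, y) \<Rightarrow> \<lambda>i\<in>{..<n}. s * x i + t * y i) i) \<in> borel_measurable (gam n \<Otimes>\<^sub>M gam n)"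
    using i by (simp add: split_beta)
qed (auto simp: PiE_def extensional_def split: if_splits)

lemma measurable_lin:
  "(\<lambda>x. \<lambda>i\<in>{..<n}. r * x i) \<in> measurable (gam n) (Rn n)"
  unfolding measurable_cong_sets[OF refl sets_Rn]
proof (rule measurable_PiM_single')
  fix i assume i: "i \<in> {..<n}"
  have [measurable]: "(\<lambda>z. z i) \<in> borel_measurable (gam n)" using i by (intro measurable_component_gam) simp
  show "(\<lambda>x. (\<lambda>i\<in>{..<n}. r * x i) i) \<in> borel_measurable (gam n)"
    using i by simp
qed (auto simp: PiE_def extensional_def split: if_splits)

lemma indicator_PiE:
  fixes z :: "nat \<Rightarrow> 'b"
  shows "z \<in> extensional {..<n} \<Longrightarrow> indicator (Pi\<^sub>E {..<n} A) z = (\<Prod>i<n. indicator (A i) (z i) :: ennreal)"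
proof (cases "z \<in> Pi\<^sub>E {..<n} A")
  case True
  have "(\<Prod>i<n. indicator (A i) (z i) :: ennreal) = (\<Prod>i<n. 1)"
    by (rule prod.cong) (use PiE_mem[OF True] in simp_all)
  then show ?thesis using True by simp
next
  case False
  assume "z \<in> extensional {..<n}"
  with False obtain i where i: "i < n" "z i \<notin> A i" by (auto simp: PiE_def Pi_def)
  have "(\<Prod>i<n. indicator (A i) (z i) :: ennreal) = 0"
    by (rule prod_zero[OF finite_lessThan], rule bexI[of _ i]) (use i in auto)
  then show ?thesis using False by simp
qed

text \<open>The coordinates decouple: on boxes both laws are the product of the law of r x under
  \<open>gam1\<close>, by \<open>gauss_conv1\<close> in each coordinate.\<close>

lemma gauss_conv:
  assumes r: "s\<^sup>2 + t\<^sup>2 = r\<^sup>2" "0 < r"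
  shows "distr (gam n \<Otimes>\<^sub>M gam n) (Rn n) (\<lambda>(x, y). \<lambda>i\<in>{..<n}. s * x i + t * y i)
    = distr (gam n) (Rn n) (\<lambda>x. \<lambda>i\<in>{..<n}. r * x i)"
proof -
  let ?N = "distr gam1 borel (\<lambda>x. r * x)"
  interpret N: prob_space ?N by (rule g1.prob_space_distr) measurable
  interpret PN: product_prob_space "\<lambda>_::nat. ?N" UNIV ..
  have A1: "distr (gam n \<Otimes>\<^sub>M gam n) (Rn n) (\<lambda>(x, y). \<lambda>i\<in>{..<n}. s * x i + t * y i) = PiM {..<n} (\<lambda>_. ?N)"
  proof (rule PN.PiM_eqI)
    fix A :: "nat \<Rightarrow> real set" assume "\<And>i. i \<in> {..<n} \<Longrightarrow> A i \<in> sets ?N"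
    then have A[measurable]: "i < n \<Longrightarrow> A i \<in> sets borel" for i by simp
    have P: "Pi\<^sub>E {..<n} A \<in> sets (Rn n)" by (intro sets_PiM_I_finite) auto
    have Pm: "(\<lambda>p. indicator (Pi\<^sub>E {..<n} A) (case p of (x, y) \<Rightarrow> \<lambda>i\<in>{..<n}. s * x i + t * y i) :: ennreal)
       \<in> borel_measurable (gam n \<Otimes>\<^sub>M gam n)"
      by (rule measurable_compose[OF measurable_lin_pair borel_measurable_indicator[OF P]])
    have "emeasure (distr (gam n \<Otimes>\<^sub>M gam n) (Rn n) (\<lambda>(x, y). \<lambda>i\<in>{..<n}. s * x i + t * y i)) (Pi\<^sub>E {..<n} A)
      = (\<integral>\<^sup>+ z. indicator (Pi\<^sub>E {..<n} A) z \<partial>distr (gam n \<Otimes>\<^sub>M gam n) (Rn n) (\<lambda>(x, y). \<lambda>i\<in>{..<n}. s * x i + t * y i))"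
      by (rule nn_integral_indicator[symmetric]) (use P in simp)
    also have "\<dots> = (\<integral>\<^sup>+ p. indicator (Pi\<^sub>E {..<n} A) (case p of (x, y) \<Rightarrow> \<lambda>i\<in>{..<n}. s * x i + t * y i) \<partial>(gam n \<Otimes>\<^sub>M gam n))"
      by (rule nn_integral_distr[OF measurable_lin_pair]) (use borel_measurable_indicator[OF P] in simp)
    also have "\<dots> = (\<integral>\<^sup>+ x. \<integral>\<^sup>+ y. (\<Prod>i<n. indicator (A i) (s * x i + t * y i)) \<partial>gam n \<partial>gam n)"
      by (subst gam.nn_integral_fst[symmetric]) (use Pm in \<open>simp_all add: indicator_PiE\<close>)
    also have "\<dots> = (\<integral>\<^sup>+ x. (\<Prod>i<n. (\<integral>\<^sup>+ y. indicator (A i) (s * x i + t * y) \<partial>gam1)) \<partial>gam n)"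
      unfolding gam_def by (intro nn_integral_cong G1.product_nn_integral_prod) auto
    also have "\<dots> = (\<Prod>i<n. (\<integral>\<^sup>+ x. (\<integral>\<^sup>+ y. indicator (A i) (s * x + t * y) \<partial>gam1) \<partial>gam1))"
      unfolding gam_def by (rule G1.product_nn_integral_prod) auto
    also have "\<dots> = (\<Prod>i<n. (\<integral>\<^sup>+ x. indicator (A i) (r * x) \<partial>gam1))"
      by (intro prod.cong refl gauss_conv1[OF _ r]) auto
    also have "\<dots> = (\<Prod>i<n. (\<integral>\<^sup>+ x. indicator (A i) x \<partial>?N))"
      by (intro prod.cong refl nn_integral_distr[symmetric]) auto
    also have "\<dots> = (\<Prod>i<n. emeasure ?N (A i))"
      by (intro prod.cong refl nn_integral_indicator) auto
    finally show "emeasure (distr (gam n \<Otimes>\<^sub>M gam n) (Rn n) (\<lambda>(x, y). \<lambda>i\<in>{..<n}. s * x i + t * y i)) (Pi\<^sub>E {..<n} A)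
      = (\<Prod>i<n. emeasure ?N (A i))" .
  qed (auto intro!: sets_PiM_cong)
  have A2: "distr (gam n) (Rn n) (\<lambda>x. \<lambda>i\<in>{..<n}. r * x i) = PiM {..<n} (\<lambda>_. ?N)"
  proof (rule PN.PiM_eqI)
    fix A :: "nat \<Rightarrow> real set" assume "\<And>i. i \<in> {..<n} \<Longrightarrow> A i \<in> sets ?N"
    then have A[measurable]: "i < n \<Longrightarrow> A i \<in> sets borel" for i by simp
    have P: "Pi\<^sub>E {..<n} A \<in> sets (Rn n)" by (intro sets_PiM_I_finite) auto
    have "emeasure (distr (gam n) (Rn n) (\<lambda>x. \<lambda>i\<in>{..<n}. r * x i)) (Pi\<^sub>E {..<n} A)
      = (\<integral>\<^sup>+ z. indicator (Pi\<^sub>E {..<n} A) z \<partial>distr (gam n) (Rn n) (\<lambda>x. \<lambda>i\<in>{..<n}. r * x i))"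
      by (rule nn_integral_indicator[symmetric]) (use P in simp)
    also have "\<dots> = (\<integral>\<^sup>+ x. indicator (Pi\<^sub>E {..<n} A) (\<lambda>i\<in>{..<n}. r * x i) \<partial>gam n)"
      by (rule nn_integral_distr[OF measurable_lin]) (use borel_measurable_indicator[OF P] in simp)
    also have "\<dots> = (\<integral>\<^sup>+ x. (\<Prod>i<n. indicator (A i) (r * x i)) \<partial>gam n)"
      by (simp add: indicator_PiE)
    also have "\<dots> = (\<Prod>i<n. (\<integral>\<^sup>+ x. indicator (A i) (r * x) \<partial>gam1))"
      unfolding gam_def by (rule G1.product_nn_integral_prod) auto
    also have "\<dots> = (\<Prod>i<n. (\<integral>\<^sup>+ x. indicator (A i) x \<partial>?N))"
      by (intro prod.cong refl nn_integral_distr[symmetric]) auto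
    also have "\<dots> = (\<Prod>i<n. emeasure ?N (A i))"
      by (intro prod.cong refl nn_integral_indicator) auto
    finally show "emeasure (distr (gam n) (Rn n) (\<lambda>x. \<lambda>i\<in>{..<n}. r * x i)) (Pi\<^sub>E {..<n} A)
      = (\<Prod>i<n. emeasure ?N (A i))" .
  qed (auto intro!: sets_PiM_cong)
  show ?thesis unfolding A1 A2 ..
qed

text \<open>Convolution with a centred Gaussian of scale \<open>s\<close>: the heat semigroup at
  time s^2 / (4 pi).\<close>

definition Bop :: "nat \<Rightarrow> real \<Rightarrow> ((nat \<Rightarrow> real) \<Rightarrow> real) \<Rightarrow> (nat \<Rightarrow> real) \<Rightarrow> real" where
  "Bop n s F z = (\<integral>w. F (vadd n z s w) \<partial>gam n)"

lemma measurable_vadd: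
  assumes g: "g \<in> measurable A (Rn n)" and h: "h \<in> measurable A (Rn n)"
  shows "(\<lambda>x. vadd n (g x) s (h x)) \<in> measurable A (Rn n)"
proof (rule measurable_RnI)
  fix i assume i: "i < n"
  note [measurable] = measurable_compose[OF g measurable_component_Rn[OF i]]
    measurable_compose[OF h measurable_component_Rn[OF i]]
  show "(\<lambda>x. vadd n (g x) s (h x) i) \<in> borel_measurable A" using i by (simp add: vadd_def)
qed (auto simp: vadd_def)

lemma measurable_vadd_gam:
  assumes F: "F \<in> borel_measurable (Rn n)" and z: "z \<in> space (Rn n)"
  shows "(\<lambda>w. F (vadd n z s w)) \<in> borel_measurable (gam n)"
  unfolding measurable_gam_Rn
  by (rule measurable_compose[OF measurable_vadd F]) (use z in simp_all)

lemma measurable_vadd_pair: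
  assumes F: "F \<in> borel_measurable (Rn n)"
  shows "(\<lambda>(z, w). F (vadd n z s w)) \<in> borel_measurable (Rn n \<Otimes>\<^sub>M gam n)"
proof -
  have "snd \<in> measurable (Rn n \<Otimes>\<^sub>M gam n) (Rn n)"
    unfolding measurable_Rn_gam[symmetric] by measurable
  then have "(\<lambda>p. F (vadd n (fst p) s (snd p))) \<in> borel_measurable (Rn n \<Otimes>\<^sub>M gam n)"
    by (intro measurable_compose[OF measurable_vadd F]) measurable
  then show ?thesis by (simp add: split_beta)
qed

lemma Bop_measurable:
  "F \<in> borel_measurable (Rn n) \<Longrightarrow> Bop n s F \<in> borel_measurable (Rn n)"
  unfolding Bop_def using measurable_vadd_pair[of F n s]
  by (intro gam.borel_measurable_lebesgue_integral) simp

lemma vadd_space: "vadd n z s w \<in> space (Rn n)"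
  by (simp add: space_Rn vadd_def)

lemma integrable_bounded_gam:
  assumes "F \<in> borel_measurable (gam n)" "\<And>z. z \<in> space (Rn n) \<Longrightarrow> \<bar>F z\<bar> \<le> (c::real)"
  shows "integrable (gam n) F"
  by (rule gam.integrable_const_bound[where B=c]) (use assms in \<open>auto simp: space_gam\<close>)

text \<open>The semigroup law of the heat flow: squares of scales add. Boundedness of
  \<open>F\<close> justifies merging the two integrals into one over the product space, where
  \<open>gauss_conv\<close> applies.\<close>

lemma Bop_Bop:
  fixes F :: "(nat \<Rightarrow> real) \<Rightarrow> real" assumes F: "F \<in> borel_measurable (Rn n)" and b: "\<And>z. z \<in> space (Rn n) \<Longrightarrow> \<bar>F z\<bar> \<le> (c::real)"
    and r: "s\<^sup>2 + t\<^sup>2 = r\<^sup>2" "0 < r" and z: "z \<in> space (Rn n)"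
  shows "Bop n s (Bop n t F) z = Bop n r F z"
proof -
  let ?h = "\<lambda>w. F (vadd n z 1 w)"
  have h: "?h \<in> borel_measurable (Rn n)"
    using measurable_vadd_gam[OF F z] by (simp add: measurable_gam_Rn)
  interpret P: pair_prob_space "gam n" "gam n" ..
  have e: "F (vadd n (vadd n z s x) t y) = ?h (\<lambda>i\<in>{..<n}. s * x i + t * y i)" for x y
    by (rule arg_cong[where f=F]) (auto simp: vadd_def fun_eq_iff)
  have m: "(\<lambda>p. ?h (case p of (x, y) \<Rightarrow> \<lambda>i\<in>{..<n}. s * x i + t * y i)) \<in> borel_measurable (gam n \<Otimes>\<^sub>M gam n)"
    by (rule measurable_compose[OF measurable_lin_pair h])
  have "Bop n s (Bop n t F) z = (\<integral>x. (\<integral>y. ?h (\<lambda>i\<in>{..<n}. s * x i + t * y i) \<partial>gam n) \<partial>gam n)"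
    by (simp add: Bop_def e)
  also have "\<dots> = (\<integral>p. ?h (case p of (x, y) \<Rightarrow> \<lambda>i\<in>{..<n}. s * x i + t * y i) \<partial>(gam n \<Otimes>\<^sub>M gam n))"
    by (subst P.integral_fst'[symmetric])
      (auto intro!: P.integrable_const_bound[where B=c] m b vadd_space)
  also have "\<dots> = (\<integral>x. ?h x \<partial>distr (gam n \<Otimes>\<^sub>M gam n) (Rn n) (\<lambda>(x, y). \<lambda>i\<in>{..<n}. s * x i + t * y i))"
    by (rule integral_distr[symmetric, OF measurable_lin_pair h])
  also have "\<dots> = (\<integral>x. ?h (\<lambda>i\<in>{..<n}. r * x i) \<partial>gam n)"
    unfolding gauss_conv[OF r] by (rule integral_distr[OF measurable_lin h])
  also have "\<dots> = Bop n r F z"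
    unfolding Bop_def by (intro Bochner_Integration.integral_cong refl arg_cong[where f=F]) (auto simp: vadd_def fun_eq_iff)
  finally show ?thesis .
qed

section \<open>Moments of the Gaussian measure\<close>

lemma gam1_moments:
  shows "integrable gam1 (\<lambda>x. x ^ k)" and "(\<integral>x. x \<partial>gam1) = 0" and "(\<integral>x. x\<^sup>2 \<partial>gam1) = 1 / (2 * pi)"
proof -
  have p: "0 < 1 / sqrt (2 * pi)" by simp
  show "integrable gam1 (\<lambda>x. x ^ k)"
    unfolding gam1_eq_normal
    by (subst integrable_density) (use integrable_normal_moment[OF p, of 0 k] in \<open>simp_all add: mult.commute\<close>)
  show "(\<integral>x. x \<partial>gam1) = 0"
    unfolding gam1_eq_normal
    by (subst integral_density) (use integral_normal_moment_nz_1[OF p, of 0] in \<open>simp_all\<close>)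
  show "(\<integral>x. x\<^sup>2 \<partial>gam1) = 1 / (2 * pi)"
    unfolding gam1_eq_normal
    by (subst integral_density) (use integral_normal_moment_even[OF p, of 0 1] in \<open>simp_all add: fact_numeral power_divide\<close>)
qed

text \<open>Bounds 1 + |w|^2 by a product of functions of one coordinate each, so that its powers
  can be integrated over the product measure factor by factor.\<close>

lemma one_plus_sum_le_prod:
  fixes f :: "'a \<Rightarrow> real"
  assumes "finite A" "\<And>i. i \<in> A \<Longrightarrow> 0 \<le> f i"
  shows "1 + sum f A \<le> (\<Prod>i\<in>A. 1 + f i)"
  using assms
proof (induct rule: finite_induct)
  case (insert i A)
  have "1 + sum f (insert i A) \<le> (1 + f i) * (1 + sum f A)"
    using insert by (simp add: algebra_simps sum_nonneg)
  also have "\<dots> \<le> (1 + f i) * (\<Prod>i\<in>A. 1 + f i)" using insert by (intro mult_left_mono) auto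
  finally show ?case using insert by simp
qed simp

lemma nsq_nonneg[simp]: "0 \<le> nsq n z" by (simp add: nsq_def sum_nonneg)

lemma nsq_measurable[measurable]: "nsq n \<in> borel_measurable (Rn n)"
  unfolding nsq_def
  by (intro borel_measurable_sum borel_measurable_power measurable_component_Rn) auto

lemma integrable_gam_poly: "integrable (gam n) (\<lambda>w. (1 + nsq n w) ^ k)"
proof (rule Bochner_Integration.integrable_bound)
  have "integrable gam1 (\<lambda>x. (1 + x\<^sup>2) ^ k)"
    unfolding binomial_ring
    by (auto simp: power_mult[symmetric] intro!: gam1_moments)
  then show "integrable (gam n) (\<lambda>w. \<Prod>i<n. (1 + (w i)\<^sup>2) ^ k)"
    unfolding gam_def by (intro G1.product_integrable_prod) auto
  show "(\<lambda>w. (1 + nsq n w) ^ k) \<in> borel_measurable (gam n)"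
    unfolding measurable_gam_Rn by measurable
  have "(1 + nsq n w) ^ k \<le> (\<Prod>i<n. (1 + (w i)\<^sup>2)) ^ k" for w
    unfolding nsq_def by (intro power_mono one_plus_sum_le_prod) (auto intro!: sum_nonneg add_nonneg_nonneg)
  moreover have "0 \<le> (\<Prod>i<n. (1 + (w i)\<^sup>2)) ^ k" for w :: "nat \<Rightarrow> real" by (rule zero_le_power) (auto intro!: prod_nonneg)
  ultimately show "AE x in gam n. norm ((1 + nsq n x) ^ k) \<le> norm (\<Prod>i<n. (1 + (x i)\<^sup>2) ^ k)"
    by (auto simp: prod_power_distrib)
qed

lemma sq_le_nsq: "i < n \<Longrightarrow> (w i)\<^sup>2 \<le> nsq n w"
  unfolding nsq_def by (rule member_le_sum) auto

lemma integrable_gam_dom: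
  assumes "f \<in> borel_measurable (gam n)" "\<And>w. \<bar>f w\<bar> \<le> c * (1 + nsq n w) ^ k"
  shows "integrable (gam n) f"
  by (rule Bochner_Integration.integrable_bound[where f="\<lambda>w. c * (1 + nsq n w) ^ k"])
    (use assms integrable_gam_poly in \<open>auto intro: order_trans[OF assms(2) abs_ge_self]\<close>)

lemma gam_first: assumes i: "i < n" shows "(\<integral>w. w i \<partial>gam n) = 0"
proof -
  \<comment> \<open>The coordinate is padded by factors 1 to a full product, so that the integral
    factorises; the factor of mean zero kills it.\<close>
  have "(\<integral>w. (\<Prod>k<n. if k = i then w k else 1) \<partial>gam n) = (\<Prod>k<n. \<integral>x. (if k = i then x else 1) \<partial>gam1)"
    unfolding gam_def
  proof (rule G1.product_integral_prod[of "{..<n}" "\<lambda>k x. if k = i then x else 1"])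
    show "integrable gam1 (\<lambda>x. if k = i then x else 1)" for k
      using gam1_moments(1)[of 1] by (cases "k = i") simp_all
  qed simp
  also have "\<dots> = 0" by (rule prod_zero, simp, rule bexI[of _ i]) (use i gam1_moments in auto)
  also have "(\<lambda>w. \<Prod>k<n. if k = i then w k else 1) = (\<lambda>w :: nat \<Rightarrow> real. w i)"
    using i by (simp add: prod.delta)
  finally show ?thesis .
qed

lemma gam_second: assumes ij: "i < n" "j < n"
  shows "(\<integral>w. w i * w j \<partial>gam n) = (if i = j then 1 / (2 * pi) else 0)"
proof -
  let ?f = "\<lambda>k x. (if k = i then x else 1) * (if k = j then x else 1) :: real"
  have "(\<integral>w. (\<Prod>k<n. ?f k (w k)) \<partial>gam n) = (\<Prod>k<n. \<integral>x. ?f k x \<partial>gam1)"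
    unfolding gam_def
  proof (rule G1.product_integral_prod)
    show "integrable gam1 (?f k)" for k
      using gam1_moments(1)[of 1] gam1_moments(1)[of 2]
      by (cases "k = i"; cases "k = j") (simp_all add: power2_eq_square)
  qed simp
  also have "(\<lambda>w. \<Prod>k<n. ?f k (w k)) = (\<lambda>w :: nat \<Rightarrow> real. w i * w j)"
    using ij by (simp add: prod.distrib prod.delta)
  also have "(\<Prod>k<n. \<integral>x. ?f k x \<partial>gam1) = (if i = j then 1 / (2 * pi) else 0)"
  proof (cases "i = j")
    case True
    have "(\<Prod>k<n. \<integral>x. ?f k x \<partial>gam1) = (\<Prod>k<n. if k = i then 1 / (2 * pi) else 1)"
      by (rule prod.cong) (use True gam1_moments(3) in \<open>auto simp: power2_eq_square g1.prob_space[simplified]\<close>)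
    then show ?thesis using True ij by (simp add: prod.delta)
  next
    case False
    have "(\<Prod>k<n. \<integral>x. ?f k x \<partial>gam1) = 0"
      by (rule prod_zero, simp, rule bexI[of _ i]) (use False ij gam1_moments in auto)
    then show ?thesis using False by simp
  qed
  finally show ?thesis .
qed

lemma integrable_gam_component: "i < n \<Longrightarrow> integrable (gam n) (\<lambda>w. w i)"
proof (rule integrable_gam_dom[where c=1 and k=1])
  assume i: "i < n"
  then show "(\<lambda>w. w i) \<in> borel_measurable (gam n)" by (rule measurable_component_gam)
  fix w :: "nat \<Rightarrow> real"
  have "2 * \<bar>w i\<bar> \<le> 1 + (w i)\<^sup>2" using sum_squares_bound[of 1 "\<bar>w i\<bar>"] by simp
  then show "\<bar>w i\<bar> \<le> 1 * (1 + nsq n w) ^ 1" using sq_le_nsq[OF i, of w] by simp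
qed

lemma integrable_gam_component2: "i < n \<Longrightarrow> j < n \<Longrightarrow> integrable (gam n) (\<lambda>w. w i * w j)"
proof (rule integrable_gam_dom[where c=1 and k=1])
  assume i: "i < n" "j < n"
  then show "(\<lambda>w. w i * w j) \<in> borel_measurable (gam n)"
    by (intro borel_measurable_times measurable_component_gam)
  fix w :: "nat \<Rightarrow> real"
  have "2 * \<bar>w i * w j\<bar> \<le> (w i)\<^sup>2 + (w j)\<^sup>2"
    using sum_squares_bound[of "\<bar>w i\<bar>" "\<bar>w j\<bar>"] by (simp add: abs_mult)
  then show "\<bar>w i * w j\<bar> \<le> 1 * (1 + nsq n w) ^ 1" using sq_le_nsq[of i n w] sq_le_nsq[of j n w] i by simp
qed

lemma gam_linear:
  shows "integrable (gam n) (\<lambda>w. \<Sum>i<n. a i * w i)" and "(\<integral>w. (\<Sum>i<n. a i * w i) \<partial>gam n) = 0"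
proof -
  show "integrable (gam n) (\<lambda>w. \<Sum>i<n. a i * w i)"
    by (auto intro!: integrable_gam_component)
  have "(\<integral>w. (\<Sum>i<n. a i * w i) \<partial>gam n) = (\<Sum>i<n. a i * (\<integral>w. w i \<partial>gam n))"
    by (subst Bochner_Integration.integral_sum) (auto intro!: integrable_gam_component)
  then show "(\<integral>w. (\<Sum>i<n. a i * w i) \<partial>gam n) = 0" by (simp add: gam_first)
qed

text \<open>Used with \<open>a\<close> a gradient: the mean square of the directional derivative in
  a Gaussian direction is the squared gradient over 2 pi.\<close>

lemma gam_quadratic:
  shows "integrable (gam n) (\<lambda>w. (\<Sum>i<n. a i * w i)\<^sup>2)"
    and "(\<integral>w. (\<Sum>i<n. a i * w i)\<^sup>2 \<partial>gam n) = nsq n a / (2 * pi)"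
proof -
  have e: "(\<Sum>i<n. a i * w i)\<^sup>2 = (\<Sum>i<n. \<Sum>j<n. a i * a j * (w i * w j))" for w
    by (simp add: power2_eq_square sum_product algebra_simps)
  show "integrable (gam n) (\<lambda>w. (\<Sum>i<n. a i * w i)\<^sup>2)"
    unfolding e
    by (intro Bochner_Integration.integrable_sum integrable_mult_right integrable_gam_component2) auto
  have "(\<integral>w. (\<Sum>i<n. a i * w i)\<^sup>2 \<partial>gam n) = (\<Sum>i<n. \<Sum>j<n. a i * a j * (\<integral>w. w i * w j \<partial>gam n))"
    unfolding e
    by (subst Bochner_Integration.integral_sum,
      intro Bochner_Integration.integrable_sum integrable_mult_right integrable_gam_component2, simp, simp)
     (intro sum.cong refl, subst Bochner_Integration.integral_sum,
       intro integrable_mult_right integrable_gam_component2, simp_all)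
  also have "\<dots> = (\<Sum>i<n. \<Sum>j<n. if j = i then a i * a j / (2 * pi) else 0)"
    by (intro sum.cong refl) (auto simp: gam_second)
  also have "\<dots> = nsq n a / (2 * pi)"
    by (simp add: nsq_def sum_divide_distrib power2_eq_square)
  finally show "(\<integral>w. (\<Sum>i<n. a i * w i)\<^sup>2 \<partial>gam n) = nsq n a / (2 * pi)" .
qed

section \<open>Functions of class $C^{1,1}$ without derivatives\<close>

text \<open>The functions \<open>p i\<close> are the partial derivatives of \<open>g\<close>, which depends on the first \<open>M\<close>
  coordinates only; the last two clauses stand in for a Lipschitz gradient, so that nothing needs to
  be differentiated.\<close>
definition tame :: "nat \<Rightarrow> nat \<Rightarrow> real \<Rightarrow> real \<Rightarrow> real \<Rightarrow> ((nat \<Rightarrow> real) \<Rightarrow> real)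
    \<Rightarrow> (nat \<Rightarrow> (nat \<Rightarrow> real) \<Rightarrow> real) \<Rightarrow> bool" where
  "tame n M a b D g p \<longleftrightarrow> M \<le> n \<and> 0 \<le> D
    \<and> g \<in> borel_measurable (Rn n) \<and> (\<forall>i<M. p i \<in> borel_measurable (Rn n))
    \<and> (\<forall>z\<in>space (Rn n). a \<le> g z \<and> g z \<le> b)
    \<and> (\<forall>z\<in>space (Rn n). \<forall>i<M. \<bar>p i z\<bar> \<le> D)
    \<and> (\<forall>z\<in>space (Rn n). \<forall>s w. \<bar>g (vadd n z s w) - g z\<bar> \<le> D * (\<bar>s\<bar> * sqrt (nsq n w)))
    \<and> (\<forall>z\<in>space (Rn n). \<forall>s w. \<bar>g (vadd n z s w) - g z - s * (\<Sum>i<M. p i z * w i)\<bar> \<le> D * (s\<^sup>2 * nsq n w))"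

lemma tameD:
  assumes "tame n M a b D g p"
  shows "M \<le> n" "0 \<le> D" "g \<in> borel_measurable (Rn n)"
    and "\<And>i. i < M \<Longrightarrow> p i \<in> borel_measurable (Rn n)"
    and "\<And>z. z \<in> space (Rn n) \<Longrightarrow> a \<le> g z" "\<And>z. z \<in> space (Rn n) \<Longrightarrow> g z \<le> b"
    and "\<And>z i. z \<in> space (Rn n) \<Longrightarrow> i < M \<Longrightarrow> \<bar>p i z\<bar> \<le> D"
    and "\<And>z s w. z \<in> space (Rn n) \<Longrightarrow> \<bar>g (vadd n z s w) - g z\<bar> \<le> D * (\<bar>s\<bar> * sqrt (nsq n w))"
    and "\<And>z s w. z \<in> space (Rn n) \<Longrightarrow>
      \<bar>g (vadd n z s w) - g z - s * (\<Sum>i<M. p i z * w i)\<bar> \<le> D * (s\<^sup>2 * nsq n w)"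
  using assms by (simp_all add: tame_def)

lemma tame_abs:
  assumes "tame n M a b D g p" "z \<in> space (Rn n)"
  shows "\<bar>g z\<bar> \<le> \<bar>a\<bar> + \<bar>b\<bar>"
  using tameD(5,6)[OF assms] by linarith

lemma vadd_swap: "vadd n (vadd n z s w) t x = vadd n (vadd n z t x) s w"
  by (auto simp: vadd_def fun_eq_iff)

lemma integrable_Bop:
  fixes F :: "(nat \<Rightarrow> real) \<Rightarrow> real"
  assumes "F \<in> borel_measurable (Rn n)" "\<And>z. z \<in> space (Rn n) \<Longrightarrow> \<bar>F z\<bar> \<le> c" "z \<in> space (Rn n)"
  shows "integrable (gam n) (\<lambda>w. F (vadd n z s w))"
  by (rule integrable_bounded_gam[OF measurable_vadd_gam, where c=c])
    (use assms vadd_space in auto)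

lemma gam_integral_le_const:
  fixes F :: "(nat \<Rightarrow> real) \<Rightarrow> real"
  assumes "integrable (gam n) F" "\<And>w. F w \<le> c"
  shows "(\<integral>w. F w \<partial>gam n) \<le> c"
  using integral_mono[OF assms(1), of "\<lambda>_. c"] assms(2) by (simp add: gam.prob_space)

lemma gam_integral_ge_const:
  fixes F :: "(nat \<Rightarrow> real) \<Rightarrow> real"
  assumes "integrable (gam n) F" "\<And>w. c \<le> F w"
  shows "c \<le> (\<integral>w. F w \<partial>gam n)"
  using integral_mono[OF _ assms(1), of "\<lambda>_. c"] assms(2) by (simp add: gam.prob_space)

lemma gam_integral_abs_le_const:
  fixes F :: "(nat \<Rightarrow> real) \<Rightarrow> real"
  assumes "integrable (gam n) F" "\<And>w. \<bar>F w\<bar> \<le> c"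
  shows "\<bar>\<integral>w. F w \<partial>gam n\<bar> \<le> c"
proof -
  have "F w \<le> c" "- c \<le> F w" for w using assms(2)[of w] by auto
  then show ?thesis
    using gam_integral_le_const[OF assms(1), of c] gam_integral_ge_const[OF assms(1), of "-c"]
    by (simp add: abs_le_iff)
qed

text \<open>Averaging translates of \<open>g\<close> preserves every clause with the same
  \<open>a\<close>, \<open>b\<close> and \<open>D\<close>, since the Gaussian shift commutes with
  the displacement by s w (\<open>vadd_swap\<close>). The unchanged constants are what permits
  arbitrarily many Gaussian steps.\<close>

lemma tame_Bop:
  assumes t: "tame n M a b D g p"
  shows "tame n M a b D (Bop n r g) (\<lambda>i. Bop n r (p i))"
proof -
  note T = tameD[OF t]
  have ig: "integrable (gam n) (\<lambda>x. g (vadd n z r x))" if "z \<in> space (Rn n)" for z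
    by (rule integrable_Bop[OF T(3) tame_abs[OF t] that])
  have ip: "integrable (gam n) (\<lambda>x. p i (vadd n z r x))" if "z \<in> space (Rn n)" "i < M" for z i
    by (rule integrable_Bop[OF T(4) T(7)]) (use that in auto)
  show ?thesis unfolding tame_def
  proof (intro conjI ballI allI impI)
    fix z assume z: "z \<in> space (Rn n)"
    show "a \<le> Bop n r g z" unfolding Bop_def
      by (rule gam_integral_ge_const[OF ig[OF z] T(5)[OF vadd_space]])
    show "Bop n r g z \<le> b" unfolding Bop_def
      by (rule gam_integral_le_const[OF ig[OF z] T(6)[OF vadd_space]])
    show "\<bar>Bop n r (p i) z\<bar> \<le> D" if "i < M" for i unfolding Bop_def
      by (rule gam_integral_abs_le_const[OF ip[OF z that] T(7)[OF vadd_space that]])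
    fix s :: real and w :: "nat \<Rightarrow> real"
    have e: "Bop n r g (vadd n z s w) - Bop n r g z
       = (\<integral>x. g (vadd n (vadd n z r x) s w) - g (vadd n z r x) \<partial>gam n)"
      unfolding Bop_def
      by (subst Bochner_Integration.integral_diff)
        (use ig[OF z] ig[OF vadd_space, of z s w] in \<open>simp_all add: vadd_swap[of n z r]\<close>)
    have i1: "integrable (gam n) (\<lambda>x. g (vadd n (vadd n z r x) s w) - g (vadd n z r x))"
      using ig[OF z] ig[OF vadd_space, of z s w] by (simp add: vadd_swap[of n z s])
    show "\<bar>Bop n r g (vadd n z s w) - Bop n r g z\<bar> \<le> D * (\<bar>s\<bar> * sqrt (nsq n w))"
      unfolding e by (rule gam_integral_abs_le_const[OF i1 T(8)[OF vadd_space]])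
    have i2: "integrable (gam n) (\<lambda>x. s * (\<Sum>i<M. p i (vadd n z r x) * w i))"
      by (intro integrable_mult_right Bochner_Integration.integrable_sum integrable_mult_left ip z) simp
    have e2: "s * (\<Sum>i<M. Bop n r (p i) z * w i) = (\<integral>x. s * (\<Sum>i<M. p i (vadd n z r x) * w i) \<partial>gam n)"
      unfolding Bop_def
      by (simp add: Bochner_Integration.integral_sum ip[OF z])
    show "\<bar>Bop n r g (vadd n z s w) - Bop n r g z - s * (\<Sum>i<M. Bop n r (p i) z * w i)\<bar>
        \<le> D * (s\<^sup>2 * nsq n w)"
      unfolding e e2 Bochner_Integration.integral_diff[OF i1 i2, symmetric]
      by (rule gam_integral_abs_le_const[OF Bochner_Integration.integrable_diff[OF i1 i2] T(9)[OF vadd_space]])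
  qed (use T in \<open>auto intro: Bop_measurable\<close>)
qed

section \<open>Logarithm and exponential of tame functions\<close>

lemma ln_diff_bound:
  fixes x y a :: real
  assumes "0 < a" "a \<le> x" "a \<le> y"
  shows "\<bar>ln y - ln x - (y - x) / x\<bar> \<le> (y - x)\<^sup>2 / a\<^sup>2" and "\<bar>ln y - ln x\<bar> \<le> \<bar>y - x\<bar> / a"
proof -
  \<comment> \<open>This is ln u <= u - 1 at u = y / x. Exchanging x and y gives a lower bound, and
    the gap between the two is (y - x)^2 / (x y).\<close>
  have up: "ln y - ln x \<le> (y - x) / x" if "a \<le> x" "a \<le> y" for x y :: real
    using ln_le_minus_one[of "y / x"] that assms by (simp add: ln_div field_simps)
  have lo: "(y - x) / y \<le> ln y - ln x" using up[of y x] assms by (simp add: field_simps)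
  have sq: "(y - x) / x - (y - x) / y = (y - x)\<^sup>2 / (x * y)"
    using assms by (simp add: field_simps power2_eq_square)
  have "(y - x)\<^sup>2 / (x * y) \<le> (y - x)\<^sup>2 / a\<^sup>2"
    using assms by (intro divide_left_mono) (auto simp: power2_eq_square intro!: mult_mono mult_pos_pos)
  then show "\<bar>ln y - ln x - (y - x) / x\<bar> \<le> (y - x)\<^sup>2 / a\<^sup>2"
    using up[OF assms(2,3)] lo sq by (simp add: abs_le_iff)
  have d: "\<bar>y - x\<bar> / x \<le> \<bar>y - x\<bar> / a" "\<bar>y - x\<bar> / y \<le> \<bar>y - x\<bar> / a"
    using assms by (auto intro!: divide_left_mono mult_pos_pos)
  have "(y - x) / x \<le> \<bar>y - x\<bar> / x" "(- \<bar>y - x\<bar>) / y \<le> (y - x) / y"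
    using assms by (intro divide_right_mono; simp)+
  then show "\<bar>ln y - ln x\<bar> \<le> \<bar>y - x\<bar> / a"
    using up[OF assms(2,3)] lo d by (simp add: abs_le_iff)
qed

text \<open>Chain rule in remainder form: D / a is the remainder of \<open>g\<close> divided by its
  value, D^2 / a^2 the curvature of ln on [a, infinity) times the squared Lipschitz bound.\<close>

lemma tame_ln:
  assumes t: "tame n M a b D g p" and a: "0 < a"
  shows "tame n M (ln a) (ln b) (D / a + D\<^sup>2 / a\<^sup>2) (\<lambda>z. ln (g z)) (\<lambda>i z. p i z / g z)"
proof -
  note T = tameD[OF t]
  let ?E = "D / a + D\<^sup>2 / a\<^sup>2"
  have E: "D / a \<le> ?E" "0 \<le> ?E" using T(2) a by auto
  show ?thesis unfolding tame_def
  proof (intro conjI ballI allI impI)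
    fix z assume z: "z \<in> space (Rn n)"
    have gz: "a \<le> g z" "0 < g z" using T(5)[OF z] a by auto
    show "ln a \<le> ln (g z)" using gz a by simp
    show "ln (g z) \<le> ln b" using gz T(6)[OF z] by simp
    show "\<bar>p i z / g z\<bar> \<le> ?E" if i: "i < M" for i
    proof -
      have "\<bar>p i z / g z\<bar> \<le> D / a"
        unfolding abs_divide using gz a T(7)[OF z i] by (intro frac_le) auto
      then show ?thesis using E by linarith
    qed
    fix s :: real and w :: "nat \<Rightarrow> real"
    let ?y = "g (vadd n z s w)"
    have gy: "a \<le> ?y" by (rule T(5)[OF vadd_space])
    have l: "\<bar>?y - g z\<bar> \<le> D * (\<bar>s\<bar> * sqrt (nsq n w))" by (rule T(8)[OF z])
    have "\<bar>ln ?y - ln (g z)\<bar> \<le> \<bar>?y - g z\<bar> / a" by (rule ln_diff_bound(2)[OF a gz(1) gy])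
    also have "\<dots> \<le> D * (\<bar>s\<bar> * sqrt (nsq n w)) / a" using l a by (intro divide_right_mono) auto
    also have "\<dots> = D / a * (\<bar>s\<bar> * sqrt (nsq n w))" by simp
    also have "\<dots> \<le> ?E * (\<bar>s\<bar> * sqrt (nsq n w))" using E by (intro mult_right_mono) auto
    finally show "\<bar>ln ?y - ln (g z)\<bar> \<le> ?E * (\<bar>s\<bar> * sqrt (nsq n w))" .
    have sq: "(?y - g z)\<^sup>2 \<le> D\<^sup>2 * (s\<^sup>2 * nsq n w)"
      using power_mono[OF l, of 2] by (simp add: power_mult_distrib)
    have e: "s * (\<Sum>i<M. p i z / g z * w i) = s * (\<Sum>i<M. p i z * w i) / g z"
      by (simp add: sum_divide_distrib[symmetric])
    have e3: "ln ?y - ln (g z) - s * (\<Sum>i<M. p i z / g z * w i)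
      = (ln ?y - ln (g z) - (?y - g z) / g z) + (?y - g z - s * (\<Sum>i<M. p i z * w i)) / g z"
      unfolding e by (simp add: diff_divide_distrib)
    have "\<bar>ln ?y - ln (g z) - s * (\<Sum>i<M. p i z / g z * w i)\<bar>
      \<le> \<bar>ln ?y - ln (g z) - (?y - g z) / g z\<bar> + \<bar>(?y - g z - s * (\<Sum>i<M. p i z * w i)) / g z\<bar>"
      unfolding e3 by (rule abs_triangle_ineq)
    also have "\<dots> \<le> (?y - g z)\<^sup>2 / a\<^sup>2 + D * (s\<^sup>2 * nsq n w) / a"
      unfolding abs_divide using gz a T(9)[OF z, of s w]
      by (intro add_mono ln_diff_bound(1)[OF a gz(1) gy] frac_le) (auto intro!: mult_nonneg_nonneg T(2))
    also have "\<dots> \<le> D\<^sup>2 * (s\<^sup>2 * nsq n w) / a\<^sup>2 + D * (s\<^sup>2 * nsq n w) / a"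
      using sq by (intro add_right_mono divide_right_mono) auto
    also have "\<dots> = ?E * (s\<^sup>2 * nsq n w)" by (simp add: distrib_right)
    finally show "\<bar>ln ?y - ln (g z) - s * (\<Sum>i<M. p i z / g z * w i)\<bar> \<le> ?E * (s\<^sup>2 * nsq n w)" .
  qed (use T E in auto)
qed

text \<open>Convexity gives a tangent bound at either end; the two tangents differ by (exp y - exp
  x) (y - x), which is of second order.\<close>

lemma exp_diff_bound:
  fixes x y c :: real
  assumes "x \<le> c" "y \<le> c"
  shows "\<bar>exp y - exp x - exp x * (y - x)\<bar> \<le> exp c * (y - x)\<^sup>2" and "\<bar>exp y - exp x\<bar> \<le> exp c * \<bar>y - x\<bar>"
proof -
  have lo: "exp x * (y - x) \<le> exp y - exp x" for x y :: real
  proof -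
    have "exp x * (1 + (y - x)) \<le> exp x * exp (y - x)" by (intro mult_left_mono exp_ge_add_one_self) auto
    also have "\<dots> = exp y" by (simp flip: exp_add)
    finally show ?thesis by (simp add: algebra_simps)
  qed
  have up: "exp y - exp x \<le> exp y * (y - x)" using lo[of y x] by (simp add: algebra_simps)
  have m: "exp x * \<bar>y - x\<bar> \<le> exp c * \<bar>y - x\<bar>" "exp y * \<bar>y - x\<bar> \<le> exp c * \<bar>y - x\<bar>"
    using assms by (auto intro!: mult_right_mono)
  have s: "- (exp x * \<bar>y - x\<bar>) \<le> exp x * (y - x)" "exp y * (y - x) \<le> exp y * \<bar>y - x\<bar>"
    using mult_left_mono[of "- \<bar>y - x\<bar>" "y - x" "exp x"] mult_left_mono[of "y - x" "\<bar>y - x\<bar>" "exp y"]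
    by (simp_all del: mult_le_cancel_left_pos)
  show 2: "\<bar>exp y - exp x\<bar> \<le> exp c * \<bar>y - x\<bar>"
    unfolding abs_le_iff minus_diff_eq using lo[of x y] up m s by linarith
  have "exp y - exp x - exp x * (y - x) \<le> (exp y - exp x) * (y - x)"
    using up by (simp add: algebra_simps)
  also have "\<dots> \<le> \<bar>exp y - exp x\<bar> * \<bar>y - x\<bar>" by (metis abs_ge_self abs_mult)
  also have "\<dots> \<le> exp c * \<bar>y - x\<bar> * \<bar>y - x\<bar>" using 2 by (intro mult_right_mono) auto
  also have "\<dots> = exp c * (y - x)\<^sup>2" by (simp add: power2_eq_square)
  finally show "\<bar>exp y - exp x - exp x * (y - x)\<bar> \<le> exp c * (y - x)\<^sup>2"
    using lo[of x y] by simp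
qed

text \<open>Chain rule with slope and curvature of exp bounded by exp b; the summand D stems from
  the remainder of \<open>g\<close>, D^2 from its squared increment.\<close>

lemma tame_exp:
  assumes t: "tame n M a b D g p"
  shows "tame n M (exp a) (exp b) (exp b * (D + D\<^sup>2)) (\<lambda>z. exp (g z)) (\<lambda>i z. exp (g z) * p i z)"
proof -
  note T = tameD[OF t]
  let ?E = "exp b * (D + D\<^sup>2)"
  have E: "exp b * D \<le> ?E" "0 \<le> ?E" using T(2) by auto
  show ?thesis unfolding tame_def
  proof (intro conjI ballI allI impI)
    fix z assume z: "z \<in> space (Rn n)"
    have gz: "g z \<le> b" "a \<le> g z" using T(5,6)[OF z] by auto
    show "exp a \<le> exp (g z)" "exp (g z) \<le> exp b" using gz by auto
    show "\<bar>exp (g z) * p i z\<bar> \<le> ?E" if i: "i < M" for i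
    proof -
      have "\<bar>exp (g z) * p i z\<bar> \<le> exp b * D"
        unfolding abs_mult using gz T(7)[OF z i] by (intro mult_mono) auto
      then show ?thesis using E by linarith
    qed
    fix s :: real and w :: "nat \<Rightarrow> real"
    let ?y = "g (vadd n z s w)"
    have gy: "?y \<le> b" by (rule T(6)[OF vadd_space])
    have l: "\<bar>?y - g z\<bar> \<le> D * (\<bar>s\<bar> * sqrt (nsq n w))" by (rule T(8)[OF z])
    have "\<bar>exp ?y - exp (g z)\<bar> \<le> exp b * \<bar>?y - g z\<bar>" by (rule exp_diff_bound(2)[OF gz(1) gy])
    also have "\<dots> \<le> exp b * (D * (\<bar>s\<bar> * sqrt (nsq n w)))" using l by (intro mult_left_mono) auto
    also have "\<dots> = exp b * D * (\<bar>s\<bar> * sqrt (nsq n w))" by simp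
    also have "\<dots> \<le> ?E * (\<bar>s\<bar> * sqrt (nsq n w))" using E by (intro mult_right_mono) auto
    finally show "\<bar>exp ?y - exp (g z)\<bar> \<le> ?E * (\<bar>s\<bar> * sqrt (nsq n w))" .
    have sq: "(?y - g z)\<^sup>2 \<le> D\<^sup>2 * (s\<^sup>2 * nsq n w)"
      using power_mono[OF l, of 2] by (simp add: power_mult_distrib)
    have e: "s * (\<Sum>i<M. exp (g z) * p i z * w i) = exp (g z) * (s * (\<Sum>i<M. p i z * w i))"
      by (simp add: sum_distrib_left algebra_simps)
    have "\<bar>exp ?y - exp (g z) - s * (\<Sum>i<M. exp (g z) * p i z * w i)\<bar>
      \<le> \<bar>exp ?y - exp (g z) - exp (g z) * (?y - g z)\<bar> + \<bar>exp (g z) * (?y - g z - s * (\<Sum>i<M. p i z * w i))\<bar>"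
      unfolding e by (simp add: right_diff_distrib)
    also have "\<dots> \<le> exp b * (?y - g z)\<^sup>2 + exp b * (D * (s\<^sup>2 * nsq n w))"
      unfolding abs_mult using gz T(9)[OF z, of s w]
      by (intro add_mono exp_diff_bound(1)[OF gz(1) gy] mult_mono) auto
    also have "\<dots> \<le> exp b * (D\<^sup>2 * (s\<^sup>2 * nsq n w)) + exp b * (D * (s\<^sup>2 * nsq n w))"
      using sq by (intro add_right_mono mult_left_mono) auto
    also have "\<dots> = ?E * (s\<^sup>2 * nsq n w)" by (simp add: algebra_simps)
    finally show "\<bar>exp ?y - exp (g z) - s * (\<Sum>i<M. exp (g z) * p i z * w i)\<bar> \<le> ?E * (s\<^sup>2 * nsq n w)" .
  qed (use T E in auto)
qed

lemma exp_taylor_bound: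
  fixes y B :: real
  assumes "\<bar>y\<bar> \<le> B"
  shows "\<bar>exp y - (1 + y + y\<^sup>2 / 2)\<bar> \<le> exp B * \<bar>y\<bar> ^ 3"
proof -
  obtain t where t: "\<bar>t\<bar> \<le> \<bar>y\<bar>" "exp y = (\<Sum>m<3. y ^ m / fact m) + exp t / fact 3 * y ^ 3"
    using Maclaurin_exp_le by blast
  have "(\<Sum>m<3. y ^ m / fact m) = 1 + y + y\<^sup>2 / 2"
    by (simp add: eval_nat_numeral)
  then have "\<bar>exp y - (1 + y + y\<^sup>2 / 2)\<bar> = exp t / fact 3 * \<bar>y\<bar> ^ 3"
    using t(2) by (simp add: abs_mult power_abs)
  also have "\<dots> \<le> exp B * \<bar>y\<bar> ^ 3"
  proof (rule mult_right_mono)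
    have "exp t / fact 3 \<le> exp t" by (simp add: fact_numeral)
    also have "\<dots> \<le> exp B" using t(1) assms by simp
    finally show "exp t / fact 3 \<le> exp B" .
  qed simp
  finally show ?thesis .
qed

text \<open>Only the absolute third moment enters the error, so for increments of order sigma the
  expansion is exact up to order sigma^3.\<close>

lemma (in prob_space) exp_moment:
  fixes Y :: "'a \<Rightarrow> real"
  assumes Y[measurable]: "Y \<in> borel_measurable M" and B: "\<And>x. x \<in> space M \<Longrightarrow> \<bar>Y x\<bar> \<le> B"
  shows "\<bar>(\<integral>x. exp (Y x) \<partial>M) - (1 + (\<integral>x. Y x \<partial>M) + (\<integral>x. (Y x)\<^sup>2 \<partial>M) / 2)\<bar> \<le> exp B * (\<integral>x. \<bar>Y x\<bar> ^ 3 \<partial>M)"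
proof -
  have i: "integrable M Y"
    by (rule integrable_const_bound[where B=B]) (use B in auto)
  have i2: "integrable M (\<lambda>x. (Y x)\<^sup>2)"
    by (rule integrable_const_bound[where B="B\<^sup>2"]) (use B in \<open>auto intro!: AE_I2 simp: abs_le_square_iff[symmetric] power2_abs intro: order_trans[OF B]\<close>)
  have i3: "integrable M (\<lambda>x. \<bar>Y x\<bar> ^ 3)"
    by (rule integrable_const_bound[where B="B ^ 3"]) (use B in \<open>auto intro!: AE_I2 power_mono simp: power_abs\<close>)
  have ie: "integrable M (\<lambda>x. exp (Y x))"
    by (rule integrable_const_bound[where B="exp B"]) (use B in \<open>auto simp: abs_le_iff\<close>)
  have id: "integrable M (\<lambda>x. exp (Y x) - (1 + Y x + (Y x)\<^sup>2 / 2))" using i i2 ie by auto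
  have "(\<integral>x. exp (Y x) \<partial>M) - (1 + (\<integral>x. Y x \<partial>M) + (\<integral>x. (Y x)\<^sup>2 \<partial>M) / 2)
    = (\<integral>x. exp (Y x) - (1 + Y x + (Y x)\<^sup>2 / 2) \<partial>M)"
    using i i2 ie by (simp add: prob_space)
  also have "\<bar>\<dots>\<bar> \<le> (\<integral>x. \<bar>exp (Y x) - (1 + Y x + (Y x)\<^sup>2 / 2)\<bar> \<partial>M)"
    by (rule integral_abs_bound)
  also have "\<dots> \<le> (\<integral>x. exp B * \<bar>Y x\<bar> ^ 3 \<partial>M)"
    by (rule integral_mono) (use id i3 exp_taylor_bound[OF B] in auto)
  finally show ?thesis by simp
qed

section \<open>Averages over random isometries\<close>

text \<open>Collects what the entropic inequality needs from the random rotations.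
  \<open>R_vadd\<close> expresses linearity in a single clause; \<open>contr\<close> says how much
  of the energy of a fixed vector sits, on average, in the first \<open>M\<close> coordinates after
  the random isometry.\<close>

locale rand_iso = prob_space \<Omega> for \<Omega> :: "'w measure" +
  fixes R :: "'w \<Rightarrow> (nat \<Rightarrow> real) \<Rightarrow> (nat \<Rightarrow> real)" and n M :: nat and C :: real
  assumes R_meas: "(\<lambda>(\<omega>, z). R \<omega> z) \<in> measurable (\<Omega> \<Otimes>\<^sub>M Rn n) (Rn n)"
    and R_vadd: "\<omega> \<in> space \<Omega> \<Longrightarrow> z \<in> space (Rn n) \<Longrightarrow> w \<in> space (Rn n) \<Longrightarrow>
      R \<omega> (vadd n z s w) = vadd n (R \<omega> z) s (R \<omega> w)"
    and R_nsq: "\<omega> \<in> space \<Omega> \<Longrightarrow> z \<in> space (Rn n) \<Longrightarrow> nsq n (R \<omega> z) = nsq n z"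
    and R_gam: "\<omega> \<in> space \<Omega> \<Longrightarrow> distr (gam n) (gam n) (R \<omega>) = gam n"
    and C_pos: "0 < C"
    and contr: "e \<in> space (Rn n) \<Longrightarrow> (\<integral>\<omega>. nsq M (R \<omega> e) \<partial>\<Omega>) \<le> C * nsq n e"
begin

definition Kop :: "((nat \<Rightarrow> real) \<Rightarrow> real) \<Rightarrow> (nat \<Rightarrow> real) \<Rightarrow> real" where
  "Kop F z = (\<integral>\<omega>. F (R \<omega> z) \<partial>\<Omega>)"

lemma R_meas_comp:
  assumes "g \<in> measurable A \<Omega>" "h \<in> measurable A (Rn n)"
  shows "(\<lambda>x. R (g x) (h x)) \<in> measurable A (Rn n)"
  using measurable_compose[OF measurable_Pair[OF assms] R_meas] by simp

lemma R_meas1: "z \<in> space (Rn n) \<Longrightarrow> (\<lambda>\<omega>. R \<omega> z) \<in> measurable \<Omega> (Rn n)"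
  by (rule R_meas_comp) auto

lemma R_meas2: "\<omega> \<in> space \<Omega> \<Longrightarrow> R \<omega> \<in> measurable (Rn n) (Rn n)"
  by (rule R_meas_comp) auto

lemma R_space: "\<omega> \<in> space \<Omega> \<Longrightarrow> z \<in> space (Rn n) \<Longrightarrow> R \<omega> z \<in> space (Rn n)"
  using measurable_space[OF R_meas2] by blast

lemma integrable_R:
  fixes F :: "(nat \<Rightarrow> real) \<Rightarrow> real"
  assumes "F \<in> borel_measurable (Rn n)" "\<And>z. z \<in> space (Rn n) \<Longrightarrow> \<bar>F z\<bar> \<le> c" "z \<in> space (Rn n)"
  shows "integrable \<Omega> (\<lambda>\<omega>. F (R \<omega> z))"
  by (rule integrable_const_bound[where B=c])
    (use assms R_space measurable_compose[OF R_meas1] in auto)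

lemma integral_le_const':
  fixes f :: "'w \<Rightarrow> real"
  assumes "integrable \<Omega> f" "\<And>\<omega>. \<omega> \<in> space \<Omega> \<Longrightarrow> f \<omega> \<le> c"
  shows "(\<integral>\<omega>. f \<omega> \<partial>\<Omega>) \<le> c"
  using integral_mono[OF assms(1), of "\<lambda>_. c"] assms(2) by (simp add: prob_space)

lemma integral_ge_const':
  fixes f :: "'w \<Rightarrow> real"
  assumes "integrable \<Omega> f" "\<And>\<omega>. \<omega> \<in> space \<Omega> \<Longrightarrow> c \<le> f \<omega>"
  shows "c \<le> (\<integral>\<omega>. f \<omega> \<partial>\<Omega>)"
  using integral_mono[OF _ assms(1), of "\<lambda>_. c"] assms(2) by (simp add: prob_space)

lemma integral_abs_le_const':
  fixes f :: "'w \<Rightarrow> real"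
  assumes "integrable \<Omega> f" "\<And>\<omega>. \<omega> \<in> space \<Omega> \<Longrightarrow> \<bar>f \<omega>\<bar> \<le> c"
  shows "\<bar>\<integral>\<omega>. f \<omega> \<partial>\<Omega>\<bar> \<le> c"
proof -
  have "f \<omega> \<le> c" "- c \<le> f \<omega>" if "\<omega> \<in> space \<Omega>" for \<omega> using assms(2)[OF that] by auto
  then show ?thesis
    using integral_le_const'[OF assms(1), of c] integral_ge_const'[OF assms(1), of "-c"]
    by (simp add: abs_le_iff)
qed

lemma Kop_measurable:
  fixes F :: "(nat \<Rightarrow> real) \<Rightarrow> real"
  assumes F: "F \<in> borel_measurable (Rn n)"
  shows "Kop F \<in> borel_measurable (Rn n)"
proof -
  have "(\<lambda>p. F (R (snd p) (fst p))) \<in> borel_measurable (Rn n \<Otimes>\<^sub>M \<Omega>)"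
    by (rule measurable_compose[OF R_meas_comp F]) measurable
  then show ?thesis unfolding Kop_def
    by (intro borel_measurable_lebesgue_integral) (simp add: split_beta)
qed

lemma Kop_abs:
  fixes F :: "(nat \<Rightarrow> real) \<Rightarrow> real"
  assumes "F \<in> borel_measurable (Rn n)" "\<And>z. z \<in> space (Rn n) \<Longrightarrow> \<bar>F z\<bar> \<le> c" "z \<in> space (Rn n)"
  shows "\<bar>Kop F z\<bar> \<le> c"
  unfolding Kop_def by (rule integral_abs_le_const'[OF integrable_R[OF assms]]) (use R_space assms in auto)

text \<open>The random isometries preserve the Gaussian measure, so averaging over them commutes with
  the heat flow.\<close>
lemma Kop_Bop:
  fixes F :: "(nat \<Rightarrow> real) \<Rightarrow> real"
  assumes F: "F \<in> borel_measurable (Rn n)" and b: "\<And>z. z \<in> space (Rn n) \<Longrightarrow> \<bar>F z\<bar> \<le> c"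
    and z: "z \<in> space (Rn n)"
  shows "Kop (Bop n s F) z = Bop n s (Kop F) z"
proof -
  interpret P: pair_prob_space \<Omega> "gam n" ..
  have m: "(\<lambda>p. F (R (fst p) (vadd n z s (snd p)))) \<in> borel_measurable (\<Omega> \<Otimes>\<^sub>M gam n)"
  proof (rule measurable_compose[OF R_meas_comp F])
    have "snd \<in> measurable (\<Omega> \<Otimes>\<^sub>M gam n) (Rn n)"
      unfolding measurable_Rn_gam[symmetric] by measurable
    then show "(\<lambda>p. vadd n z s (snd p)) \<in> measurable (\<Omega> \<Otimes>\<^sub>M gam n) (Rn n)"
      using z by (intro measurable_vadd) simp_all
  qed measurable
  have "Kop (Bop n s F) z = (\<integral>\<omega>. (\<integral>w. F (R \<omega> (vadd n z s w)) \<partial>gam n) \<partial>\<Omega>)"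
    unfolding Kop_def
  proof (rule Bochner_Integration.integral_cong[OF refl])
    fix \<omega> assume w: "\<omega> \<in> space \<Omega>"
    have Rm: "R \<omega> \<in> measurable (gam n) (gam n)"
      using R_meas2[OF w] by (simp add: measurable_gam_Rn measurable_Rn_gam)
    have "Bop n s F (R \<omega> z) = (\<integral>x. F (vadd n (R \<omega> z) s x) \<partial>distr (gam n) (gam n) (R \<omega>))"
      unfolding Bop_def R_gam[OF w] ..
    also have "\<dots> = (\<integral>x. F (vadd n (R \<omega> z) s (R \<omega> x)) \<partial>gam n)"
      by (rule integral_distr[OF Rm measurable_vadd_gam[OF F R_space[OF w z]]])
    also have "\<dots> = (\<integral>x. F (R \<omega> (vadd n z s x)) \<partial>gam n)"
      by (rule Bochner_Integration.integral_cong[OF refl]) (simp add: R_vadd[OF w z] space_gam)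
    finally show "Bop n s F (R \<omega> z) = (\<integral>x. F (R \<omega> (vadd n z s x)) \<partial>gam n)" .
  qed
  also have "\<dots> = (\<integral>w. (\<integral>\<omega>. F (R \<omega> (vadd n z s w)) \<partial>\<Omega>) \<partial>gam n)"
    by (rule P.Fubini_integral[symmetric])
      (use m b R_space vadd_space in \<open>auto intro!: P.integrable_const_bound[where B=c] simp: split_beta space_pair_measure\<close>)
  finally show ?thesis by (simp add: Bop_def Kop_def)
qed

definition unit_vec :: "nat \<Rightarrow> nat \<Rightarrow> real" where
  "unit_vec j = (\<lambda>i\<in>{..<n}. if i = j then 1 else 0)"

lemma unit_vec_space: "unit_vec j \<in> space (Rn n)" by (simp add: unit_vec_def space_Rn)

lemma zero_space: "(\<lambda>i\<in>{..<n}. 0) \<in> space (Rn n)" by (simp add: space_Rn)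

lemma R_zero: assumes w: "\<omega> \<in> space \<Omega>" shows "R \<omega> (\<lambda>i\<in>{..<n}. 0) = (\<lambda>i\<in>{..<n}. 0)"
proof -
  have "nsq n (R \<omega> (\<lambda>i\<in>{..<n}. 0)) = 0" unfolding R_nsq[OF w zero_space] by (simp add: nsq_def)
  then have "\<forall>i<n. R \<omega> (\<lambda>i\<in>{..<n}. 0) i = 0"
    by (simp add: nsq_def sum_nonneg_eq_0_iff)
  then show ?thesis using R_space[OF w zero_space] by (auto simp: space_Rn extensional_def fun_eq_iff)
qed

text \<open>\<open>vadd\<close> adds one multiple of one vector, so linearity is unrolled by
  induction over the truncations of \<open>x\<close> to its first \<open>k\<close>
  coordinates.\<close>

lemma R_expand:
  assumes w: "\<omega> \<in> space \<Omega>" and i: "i < n"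
  shows "R \<omega> (restrict x {..<n}) i = (\<Sum>j<n. x j * R \<omega> (unit_vec j) i)"
proof -
  let ?t = "\<lambda>k. (\<lambda>i\<in>{..<n}. if i < k then x i else 0)"
  have sp: "?t k \<in> space (Rn n)" for k by (simp add: space_Rn)
  have "k \<le> n \<Longrightarrow> R \<omega> (?t k) i = (\<Sum>j<k. x j * R \<omega> (unit_vec j) i)" for k
  proof (induct k)
    case 0
    have "?t 0 = (\<lambda>i\<in>{..<n}. 0)" by auto
    then have e: "R \<omega> (?t 0) = (\<lambda>i\<in>{..<n}. 0)" using R_zero[OF w] by (simp only:)
    show ?case unfolding e using i by simp
  next
    case (Suc k)
    have "?t (Suc k) = vadd n (?t k) (x k) (unit_vec k)"
      by (auto simp: vadd_def unit_vec_def fun_eq_iff less_Suc_eq)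
    then have e: "R \<omega> (?t (Suc k)) = vadd n (R \<omega> (?t k)) (x k) (R \<omega> (unit_vec k))"
      using R_vadd[OF w sp unit_vec_space] by (simp only:)
    have va: "vadd n u s v i = u i + s * v i" for u s v using i by (simp add: vadd_def)
    show ?case unfolding e va Suc(1)[OF Suc_leD[OF Suc(2)]] by simp
  qed
  from this[of n] have *: "R \<omega> (?t n) i = (\<Sum>j<n. x j * R \<omega> (unit_vec j) i)" by simp
  have e: "?t n = restrict x {..<n}" by auto
  show ?thesis using * unfolding e .
qed

end

section \<open>Elementary inequalities for the remainder terms\<close>

lemma gam_integral_mono:
  fixes F :: "(nat \<Rightarrow> real) \<Rightarrow> real"
  assumes "integrable (gam n) F" "integrable (gam n) H" "\<And>w. w \<in> space (Rn n) \<Longrightarrow> F w \<le> H w"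
  shows "(\<integral>w. F w \<partial>gam n) \<le> (\<integral>w. H w \<partial>gam n)"
  by (rule integral_mono) (use assms in \<open>auto simp: space_gam\<close>)

text \<open>Young's inequality, from the square of C a - b. The weight is the one for which the
  second sum can be absorbed in \<open>gradient_bound\<close>.\<close>

lemma sum_mult_bound:
  fixes a b :: "'i \<Rightarrow> real"
  assumes C: "0 < C"
  shows "(\<Sum>i\<in>I. a i * b i) \<le> (C * (\<Sum>i\<in>I. (a i)\<^sup>2) + (\<Sum>i\<in>I. (b i)\<^sup>2) / C) / 2"
proof -
  have "a i * b i \<le> (C * (a i)\<^sup>2 + (b i)\<^sup>2 / C) / 2" for i
  proof -
    have "0 \<le> (C * a i - b i)\<^sup>2 / C" using C by simp
    also have "\<dots> = C * (a i)\<^sup>2 + (b i)\<^sup>2 / C - 2 * (a i * b i)"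
      using C by (simp add: power2_eq_square field_simps)
    finally show ?thesis by simp
  qed
  then have "(\<Sum>i\<in>I. a i * b i) \<le> (\<Sum>i\<in>I. (C * (a i)\<^sup>2 + (b i)\<^sup>2 / C) / 2)" by (intro sum_mono)
  also have "\<dots> = (C * (\<Sum>i\<in>I. (a i)\<^sup>2) + (\<Sum>i\<in>I. (b i)\<^sup>2) / C) / 2"
    by (simp add: sum.distrib sum_distrib_left flip: sum_divide_distrib)
  finally show ?thesis .
qed

lemma sqrt_le_one_plus: "0 \<le> x \<Longrightarrow> sqrt x \<le> 1 + x"
  by (rule real_le_lsqrt) (auto simp: power2_eq_square algebra_simps)

lemma sq_perturb:
  fixes y a r :: real
  assumes r: "\<bar>y - a\<bar> \<le> r"
  shows "y\<^sup>2 \<le> a\<^sup>2 + 2 * \<bar>a\<bar> * r + r\<^sup>2" "a\<^sup>2 - 2 * \<bar>a\<bar> * r \<le> y\<^sup>2"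
proof -
  have y: "y\<^sup>2 = a\<^sup>2 + 2 * a * (y - a) + (y - a)\<^sup>2" by (simp add: power2_eq_square algebra_simps)
  have "\<bar>a * (y - a)\<bar> \<le> \<bar>a\<bar> * r" unfolding abs_mult using r by (intro mult_left_mono) auto
  moreover have "(y - a)\<^sup>2 \<le> r\<^sup>2" using power_mono[OF r, of 2] by simp
  moreover have "0 \<le> (y - a)\<^sup>2" by simp
  ultimately show "y\<^sup>2 \<le> a\<^sup>2 + 2 * \<bar>a\<bar> * r + r\<^sup>2" "a\<^sup>2 - 2 * \<bar>a\<bar> * r \<le> y\<^sup>2"
    unfolding y abs_le_iff by linarith+
qed

text \<open>One moment for all remainders: each is dominated by a multiple of (1 + |w|^2)^k with k
  at most 3, the cube of an increment being estimated crudely by the third power.\<close>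

definition mom3 :: "nat \<Rightarrow> real" where "mom3 n = (\<integral>w. (1 + nsq n w) ^ 3 \<partial>gam n)"

lemma mom3_dom:
  assumes "f \<in> borel_measurable (gam n)" "\<And>w. w \<in> space (Rn n) \<Longrightarrow> \<bar>f w\<bar> \<le> c * (1 + nsq n w) ^ k" "k \<le> 3"
    and c: "0 \<le> c"
  shows "integrable (gam n) f" "\<bar>\<integral>w. f w \<partial>gam n\<bar> \<le> c * mom3 n"
proof -
  have b: "\<bar>f w\<bar> \<le> c * (1 + nsq n w) ^ 3" if "w \<in> space (Rn n)" for w
  proof -
    have "(1 + nsq n w) ^ k \<le> (1 + nsq n w) ^ 3" by (rule power_increasing) (use assms in auto)
    then show ?thesis using assms(2)[OF that] c by (meson mult_left_mono order_trans)
  qed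
  have ip: "integrable (gam n) (\<lambda>w. c * (1 + nsq n w) ^ 3)" using integrable_gam_poly by simp
  show i: "integrable (gam n) f"
    by (rule Bochner_Integration.integrable_bound[OF ip assms(1)])
      (use b in \<open>auto intro!: AE_I2 simp: space_gam intro: order_trans[OF _ abs_ge_self]\<close>)
  have "\<bar>\<integral>w. f w \<partial>gam n\<bar> \<le> (\<integral>w. \<bar>f w\<bar> \<partial>gam n)" by (rule integral_abs_bound)
  also have "\<dots> \<le> (\<integral>w. c * (1 + nsq n w) ^ 3 \<partial>gam n)"
    by (rule gam_integral_mono) (use i ip b in auto)
  also have "\<dots> = c * mom3 n" by (simp add: mom3_def)
  finally show "\<bar>\<integral>w. f w \<partial>gam n\<bar> \<le> c * mom3 n" .
qed

lemma mom3_pos: "1 \<le> mom3 n"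
proof -
  have "(1::real) = (\<integral>w. 1 \<partial>gam n)" by (simp add: gam.prob_space)
  also have "\<dots> \<le> mom3 n" unfolding mom3_def
    by (rule gam_integral_mono) (auto intro: integrable_gam_poly)
  finally show ?thesis .
qed

lemma sqrt_cubed_le: assumes "0 \<le> (x::real)" shows "sqrt x ^ 3 \<le> (1 + x) ^ 3"
  by (rule power_mono[OF sqrt_le_one_plus[OF assms]]) (use assms in auto)

lemma sigma_pow:
  assumes "0 < (\<sigma>::real)" "\<sigma> \<le> 1"
  shows "\<sigma> ^ 3 \<le> \<sigma>\<^sup>2" "\<sigma> ^ 4 \<le> \<sigma> ^ 3"
  using assms by (auto intro!: power_decreasing)

section \<open>The gradient of an average over isometries\<close>

context rand_iso begin

context
  fixes \<alpha> \<beta> E g q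
  assumes t: "tame n M \<alpha> \<beta> E g q"
begin

lemmas T = tameD[OF t]

definition L0 :: real where "L0 = \<bar>\<alpha>\<bar> + \<bar>\<beta>\<bar>"

lemma g_abs: "z \<in> space (Rn n) \<Longrightarrow> \<bar>g z\<bar> \<le> L0"
  unfolding L0_def by (rule tame_abs[OF t])

text \<open>The derivative of \<open>Kop g\<close> at \<open>z\<close> in the direction
  \<open>w\<close>, by the chain rule for the linear maps \<open>R\<close>; \<open>Q\<close> below
  is the squared gradient length of \<open>g\<close>.\<close>

definition A :: "(nat \<Rightarrow> real) \<Rightarrow> (nat \<Rightarrow> real) \<Rightarrow> real" where
  "A z w = (\<integral>\<omega>. (\<Sum>i<M. q i (R \<omega> z) * R \<omega> w i) \<partial>\<Omega>)"

definition Q :: "(nat \<Rightarrow> real) \<Rightarrow> real" where "Q z = (\<Sum>i<M. (q i z)\<^sup>2)"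

lemma Q_meas: "Q \<in> borel_measurable (Rn n)"
  unfolding Q_def using T(4) by (intro borel_measurable_sum borel_measurable_power) auto

lemma Q_abs: "z \<in> space (Rn n) \<Longrightarrow> \<bar>Q z\<bar> \<le> real M * E\<^sup>2"
proof -
  assume z: "z \<in> space (Rn n)"
  have "(q i z)\<^sup>2 \<le> E\<^sup>2" if "i < M" for i using power_mono[OF T(7)[OF z that], of 2] by simp
  then have "(\<Sum>i<M. (q i z)\<^sup>2) \<le> (\<Sum>i<M. E\<^sup>2)" by (intro sum_mono) auto
  then show ?thesis by (simp add: Q_def sum_nonneg)
qed

lemma abs_comp_le: assumes "i < n" shows "\<bar>w i\<bar> \<le> sqrt (nsq n w)"
  using sq_le_nsq[OF assms, of w] by (simp add: real_le_rsqrt)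

lemma qR_meas:
  assumes "z \<in> space (Rn n)" "w \<in> space (Rn n)" "i < M"
  shows "(\<lambda>\<omega>. q i (R \<omega> z) * R \<omega> w i) \<in> borel_measurable \<Omega>"
proof (rule borel_measurable_times)
  show "(\<lambda>\<omega>. q i (R \<omega> z)) \<in> borel_measurable \<Omega>"
    using assms by (intro measurable_compose[OF R_meas1 T(4)]) auto
  show "(\<lambda>\<omega>. R \<omega> w i) \<in> borel_measurable \<Omega>"
    using assms T(1) by (intro measurable_compose[OF R_meas1 measurable_component_Rn]) auto
qed

lemma qR_int:
  assumes z: "z \<in> space (Rn n)" and w: "w \<in> space (Rn n)" and i: "i < M"
  shows "integrable \<Omega> (\<lambda>\<omega>. q i (R \<omega> z) * R \<omega> w i)"
proof (rule integrable_const_bound[where B="E * sqrt (nsq n w)"])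
  show "AE \<omega> in \<Omega>. norm (q i (R \<omega> z) * R \<omega> w i) \<le> E * sqrt (nsq n w)"
  proof (rule AE_I2)
    fix \<omega> assume o: "\<omega> \<in> space \<Omega>"
    have "\<bar>R \<omega> w i\<bar> \<le> sqrt (nsq n w)"
      using abs_comp_le[of i "R \<omega> w"] R_nsq[OF o w] i T(1) by simp
    then show "norm (q i (R \<omega> z) * R \<omega> w i) \<le> E * sqrt (nsq n w)"
      using T(7)[OF R_space[OF o z] i] T(2) by (auto simp: abs_mult intro!: mult_mono)
  qed
qed (rule qR_meas[OF assms])

lemma qR_sum_int:
  assumes "z \<in> space (Rn n)" "w \<in> space (Rn n)"
  shows "integrable \<Omega> (\<lambda>\<omega>. \<Sum>i<M. q i (R \<omega> z) * R \<omega> w i)"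
  using qR_int[OF assms] by (intro Bochner_Integration.integrable_sum) auto

lemma gR_int: "z \<in> space (Rn n) \<Longrightarrow> integrable \<Omega> (\<lambda>\<omega>. g (R \<omega> z))"
  by (rule integrable_R[OF T(3) g_abs])

text \<open>As \<open>R\<close> is linear and keeps lengths, the segment from z to z + s w is mapped
  to a segment of the same length, and the bounds on \<open>g\<close> pass through the average with
  the same constant.\<close>

lemma Kop_diff:
  assumes z: "z \<in> space (Rn n)" and w: "w \<in> space (Rn n)"
  shows "\<bar>Kop g (vadd n z s w) - Kop g z\<bar> \<le> E * (\<bar>s\<bar> * sqrt (nsq n w))"
    and "\<bar>Kop g (vadd n z s w) - Kop g z - s * A z w\<bar> \<le> E * (s\<^sup>2 * nsq n w)"
proof -
  have i1: "integrable \<Omega> (\<lambda>\<omega>. g (R \<omega> (vadd n z s w)) - g (R \<omega> z))"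
    by (intro Bochner_Integration.integrable_diff gR_int vadd_space z)
  have e: "Kop g (vadd n z s w) - Kop g z = (\<integral>\<omega>. g (R \<omega> (vadd n z s w)) - g (R \<omega> z) \<partial>\<Omega>)"
    unfolding Kop_def by (rule Bochner_Integration.integral_diff[symmetric]) (intro gR_int vadd_space z)+
  show "\<bar>Kop g (vadd n z s w) - Kop g z\<bar> \<le> E * (\<bar>s\<bar> * sqrt (nsq n w))"
    unfolding e
  proof (rule integral_abs_le_const'[OF i1])
    fix \<omega> assume o: "\<omega> \<in> space \<Omega>"
    show "\<bar>g (R \<omega> (vadd n z s w)) - g (R \<omega> z)\<bar> \<le> E * (\<bar>s\<bar> * sqrt (nsq n w))"
      using T(8)[OF R_space[OF o z], of s "R \<omega> w"] by (simp add: R_vadd[OF o z w] R_nsq[OF o w])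
  qed
  have i2: "integrable \<Omega> (\<lambda>\<omega>. s * (\<Sum>i<M. q i (R \<omega> z) * R \<omega> w i))"
    using qR_sum_int[OF z w] by simp
  have e2: "s * A z w = (\<integral>\<omega>. s * (\<Sum>i<M. q i (R \<omega> z) * R \<omega> w i) \<partial>\<Omega>)"
    unfolding A_def by simp
  show "\<bar>Kop g (vadd n z s w) - Kop g z - s * A z w\<bar> \<le> E * (s\<^sup>2 * nsq n w)"
    unfolding e e2 Bochner_Integration.integral_diff[OF i1 i2, symmetric]
  proof (rule integral_abs_le_const'[OF Bochner_Integration.integrable_diff[OF i1 i2]])
    fix \<omega> assume o: "\<omega> \<in> space \<Omega>"
    show "\<bar>g (R \<omega> (vadd n z s w)) - g (R \<omega> z) - s * (\<Sum>i<M. q i (R \<omega> z) * R \<omega> w i)\<bar> \<le> E * (s\<^sup>2 * nsq n w)"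
      using T(9)[OF R_space[OF o z], of s "R \<omega> w"] by (simp add: R_vadd[OF o z w] R_nsq[OF o w])
  qed
qed

lemma A_linear:
  assumes z: "z \<in> space (Rn n)"
  shows "A z (restrict x {..<n}) = (\<Sum>j<n. A z (unit_vec j) * x j)"
proof -
  have "A z (restrict x {..<n}) = (\<integral>\<omega>. (\<Sum>j<n. x j * (\<Sum>i<M. q i (R \<omega> z) * R \<omega> (unit_vec j) i)) \<partial>\<Omega>)"
    unfolding A_def
  proof (rule Bochner_Integration.integral_cong[OF refl])
    fix \<omega> assume o: "\<omega> \<in> space \<Omega>"
    have "(\<Sum>i<M. q i (R \<omega> z) * R \<omega> (restrict x {..<n}) i)
      = (\<Sum>i<M. \<Sum>j<n. x j * (q i (R \<omega> z) * R \<omega> (unit_vec j) i))"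
      using T(1) by (intro sum.cong refl) (simp add: R_expand[OF o] sum_distrib_left algebra_simps)
    also have "\<dots> = (\<Sum>j<n. \<Sum>i<M. x j * (q i (R \<omega> z) * R \<omega> (unit_vec j) i))"
      by (rule sum.swap)
    finally show "(\<Sum>i<M. q i (R \<omega> z) * R \<omega> (restrict x {..<n}) i)
      = (\<Sum>j<n. x j * (\<Sum>i<M. q i (R \<omega> z) * R \<omega> (unit_vec j) i))"
      by (simp add: sum_distrib_left)
  qed
  also have "\<dots> = (\<Sum>j<n. x j * A z (unit_vec j))"
    unfolding A_def
    by (subst Bochner_Integration.integral_sum)
      (auto intro!: integrable_mult_right qR_sum_int[OF z unit_vec_space])
  finally show ?thesis by (simp add: mult.commute)
qed

text \<open>The gradient bound: the vector with components \<open>A z (unit_vec j)\<close> is the gradient of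
  \<open>Kop g\<close>.\<close>
lemma gradient_bound:
  assumes z: "z \<in> space (Rn n)"
  shows "nsq n (\<lambda>j. A z (unit_vec j)) \<le> C * Kop Q z"
proof -
  define v where "v = restrict (\<lambda>j. A z (unit_vec j)) {..<n}"
  have v: "v \<in> space (Rn n)" by (simp add: v_def space_Rn)
  let ?S = "nsq n (\<lambda>j. A z (unit_vec j))"
  have nv: "nsq n v = ?S" by (simp add: nsq_def v_def)
  have "(\<lambda>\<omega>. nsq M (R \<omega> v)) \<in> borel_measurable \<Omega>" unfolding nsq_def
    by (intro borel_measurable_sum borel_measurable_power measurable_compose[OF R_meas1[OF v] measurable_component_Rn])
      (use T(1) in auto)
  moreover have "nsq M (R \<omega> v) \<le> nsq n v" if "\<omega> \<in> space \<Omega>" for \<omega>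
    unfolding R_nsq[OF that v, symmetric] unfolding nsq_def
    using T(1) by (intro sum_mono2) auto
  ultimately have iv: "integrable \<Omega> (\<lambda>\<omega>. nsq M (R \<omega> v))"
    by (intro integrable_const_bound[where B="nsq n v"]) auto
  note iQ = integrable_R[OF Q_meas Q_abs z]
  \<comment> \<open>The linear form is tested on its own gradient, where its value is the squared
    length.\<close>
  have "?S = A z v" unfolding v_def A_linear[OF z] by (simp add: nsq_def power2_eq_square)
  also have "\<dots> \<le> (\<integral>\<omega>. (C * Q (R \<omega> z) + nsq M (R \<omega> v) / C) / 2 \<partial>\<Omega>)"
    unfolding A_def
  proof (rule integral_mono[OF qR_sum_int[OF z v]])
    show "integrable \<Omega> (\<lambda>\<omega>. (C * Q (R \<omega> z) + nsq M (R \<omega> v) / C) / 2)"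
      using iv iQ by auto
    show "(\<Sum>i<M. q i (R \<omega> z) * R \<omega> v i) \<le> (C * Q (R \<omega> z) + nsq M (R \<omega> v) / C) / 2" for \<omega>
      unfolding Q_def nsq_def by (rule sum_mult_bound[OF C_pos])
  qed
  also have "\<dots> = (C * Kop Q z + (\<integral>\<omega>. nsq M (R \<omega> v) \<partial>\<Omega>) / C) / 2"
    using iv iQ by (simp add: Kop_def)
  \<comment> \<open>\<open>contr\<close> returns \<open>?S\<close> itself with weight one half; it
    is absorbed into the left side.\<close>
  also have "\<dots> \<le> (C * Kop Q z + ?S) / 2"
    using contr[OF v] C_pos by (intro divide_right_mono add_left_mono) (simp_all add: nv field_simps)
  finally show ?thesis by simp
qed

end

end

section \<open>Second-order expansion over one Gaussian step\<close>

context rand_iso begin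

context
  fixes \<alpha> \<beta> E g q
  assumes t: "tame n M \<alpha> \<beta> E g q"
begin

lemmas T' = tameD[OF t]

lemma A_abs:
  assumes z: "z \<in> space (Rn n)" and w: "w \<in> space (Rn n)"
  shows "\<bar>A q z w\<bar> \<le> 2 * E * (1 + nsq n w)"
proof -
  \<comment> \<open>The derivative is bounded by comparing the two estimates of
    \<open>Kop_diff\<close> at s = 1.\<close>
  have "\<bar>A q z w\<bar> \<le> E * sqrt (nsq n w) + E * nsq n w"
    using Kop_diff[OF t z w, of 1] by simp
  also have "\<dots> \<le> E * (1 + nsq n w) + E * (1 + nsq n w)"
    using T'(2) sqrt_le_one_plus[of "nsq n w"] by (intro add_mono mult_left_mono) auto
  finally show ?thesis by simp
qed

text \<open>The exponential of the increment of \<open>Kop g\<close> over \<open>C\<close> is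
  expanded to second order. The square contributes sigma^2 / (4 pi C^2) times the squared gradient
  of \<open>Kop g\<close>, and \<open>gradient_bound\<close> cancels one factor \<open>C\<close>;
  all the rest is of order sigma^3.\<close>

lemma upper_step:
  assumes z: "z \<in> space (Rn n)" and s: "0 < \<sigma>" "\<sigma> \<le> 1"
  shows "ln (Bop n \<sigma> (\<lambda>z. exp (Kop g z / C)) z)
    \<le> Bop n \<sigma> (Kop g) z / C + \<sigma>\<^sup>2 / (4 * pi * C) * Kop (Q q) z
      + (5 * E\<^sup>2 / (2 * C\<^sup>2) + exp (2 * L0 \<alpha> \<beta> / C) * (E / C) ^ 3) * mom3 n * \<sigma> ^ 3"
proof -
  let ?G = "Kop g"
  have Gm: "?G \<in> borel_measurable (Rn n)" by (rule Kop_measurable[OF T'(3)])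
  have Gb: "\<bar>?G z\<bar> \<le> L0 \<alpha> \<beta>" if "z \<in> space (Rn n)" for z
    by (rule Kop_abs[OF T'(3) g_abs[OF t] that])
  define X where "X = (\<lambda>w. ?G (vadd n z \<sigma> w) - ?G z)"
  define Y where "Y = (\<lambda>w. X w / C)"
  have Gvm: "(\<lambda>w. ?G (vadd n z \<sigma> w)) \<in> borel_measurable (gam n)"
    by (rule measurable_vadd_gam[OF Gm z])
  have Xm: "X \<in> borel_measurable (gam n)" unfolding X_def using Gvm by simp
  have Ym: "Y \<in> borel_measurable (gam n)" unfolding Y_def using Xm by simp
  have Xb: "\<bar>X w\<bar> \<le> 2 * L0 \<alpha> \<beta>" for w
    using Gb[OF z] Gb[OF vadd_space, of z \<sigma> w] unfolding X_def by linarith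
  then have Yb: "\<bar>Y w\<bar> \<le> 2 * L0 \<alpha> \<beta> / C" for w
    using C_pos by (simp add: Y_def abs_divide divide_right_mono)
  have X3: "\<bar>\<bar>X w\<bar> ^ 3\<bar> \<le> E ^ 3 * \<sigma> ^ 3 * (1 + nsq n w) ^ 3" if w: "w \<in> space (Rn n)" for w
  proof -
    have "\<bar>X w\<bar> ^ 3 \<le> (E * (\<bar>\<sigma>\<bar> * sqrt (nsq n w))) ^ 3"
      unfolding X_def by (rule power_mono[OF Kop_diff(1)[OF t z w]]) simp
    also have "\<dots> = E ^ 3 * \<sigma> ^ 3 * sqrt (nsq n w) ^ 3" using s by (simp add: power_mult_distrib)
    also have "\<dots> \<le> E ^ 3 * \<sigma> ^ 3 * (1 + nsq n w) ^ 3"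
      using s T'(2) by (intro mult_left_mono sqrt_cubed_le) auto
    finally show ?thesis by simp
  qed
  \<comment> \<open>The factor 5 is 4 from the cross term, where the derivative is at most 2 E (1 +
    |w|^2), and 1 from the square of the remainder; sigma^4 <= sigma^3 brings the latter to the same
    order.\<close>
  have X2: "(X w)\<^sup>2 \<le> \<sigma>\<^sup>2 * (A q z w)\<^sup>2 + 5 * E\<^sup>2 * \<sigma> ^ 3 * (1 + nsq n w)\<^sup>2" if w: "w \<in> space (Rn n)" for w
  proof -
    let ?r = "E * (\<sigma>\<^sup>2 * nsq n w)" and ?l = "1 + nsq n w"
    have "(X w)\<^sup>2 \<le> (\<sigma> * A q z w)\<^sup>2 + 2 * \<bar>\<sigma> * A q z w\<bar> * ?r + ?r\<^sup>2"
      unfolding X_def by (rule sq_perturb(1)[OF Kop_diff(2)[OF t z w]])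
    moreover have "2 * \<bar>\<sigma> * A q z w\<bar> * ?r \<le> 2 * (\<sigma> * (2 * E * ?l)) * (E * (\<sigma>\<^sup>2 * ?l))"
      using s T'(2) A_abs[OF z w]
      by (intro mult_mono) (auto simp: abs_mult intro!: mult_left_mono mult_nonneg_nonneg)
    moreover have "2 * (\<sigma> * (2 * E * ?l)) * (E * (\<sigma>\<^sup>2 * ?l)) = 4 * E\<^sup>2 * \<sigma> ^ 3 * ?l\<^sup>2"
      by (simp add: power2_eq_square power3_eq_cube)
    moreover have "?r\<^sup>2 \<le> E\<^sup>2 * \<sigma> ^ 3 * ?l\<^sup>2"
    proof -
      have "?r\<^sup>2 = E\<^sup>2 * \<sigma> ^ 4 * (nsq n w)\<^sup>2"
        by (simp add: power_mult_distrib flip: power_mult)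
      also have "\<dots> \<le> E\<^sup>2 * \<sigma> ^ 3 * ?l\<^sup>2"
        using sigma_pow[OF s] s T'(2) by (intro mult_mono power_mono) auto
      finally show ?thesis .
    qed
    ultimately have "(X w)\<^sup>2 \<le> (\<sigma> * A q z w)\<^sup>2 + 4 * E\<^sup>2 * \<sigma> ^ 3 * ?l\<^sup>2 + E\<^sup>2 * \<sigma> ^ 3 * ?l\<^sup>2"
      by linarith
    then show ?thesis by (simp add: power_mult_distrib)
  qed
  have Alin: "A q z w = (\<Sum>j<n. A q z (unit_vec j) * w j)" if "w \<in> space (Rn n)" for w
    using A_linear[OF t z, of w] that by (simp add: space_Rn extensional_restrict)
  have iA: "integrable (gam n) (\<lambda>w. (A q z w)\<^sup>2)"
    and eA: "(\<integral>w. (A q z w)\<^sup>2 \<partial>gam n) = nsq n (\<lambda>j. A q z (unit_vec j)) / (2 * pi)"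
  proof -
    show "integrable (gam n) (\<lambda>w. (A q z w)\<^sup>2)"
      using gam_quadratic(1)[of n "\<lambda>j. A q z (unit_vec j)"]
      by (rule Bochner_Integration.integrable_cong[THEN iffD1, rotated 2]) (auto simp: Alin space_gam)
    show "(\<integral>w. (A q z w)\<^sup>2 \<partial>gam n) = nsq n (\<lambda>j. A q z (unit_vec j)) / (2 * pi)"
      unfolding gam_quadratic(2)[of n "\<lambda>j. A q z (unit_vec j)", symmetric]
      by (rule Bochner_Integration.integral_cong) (auto simp: Alin space_gam)
  qed
  have X2b: "(X w)\<^sup>2 \<le> (2 * L0 \<alpha> \<beta>)\<^sup>2" for w using power_mono[OF Xb[of w], of 2] by simp
  have iX2: "integrable (gam n) (\<lambda>w. (X w)\<^sup>2)"
    by (rule gam.integrable_const_bound[where B="(2 * L0 \<alpha> \<beta>)\<^sup>2"])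
      (use Xm X2b in auto)
  have m2: "integrable (gam n) (\<lambda>w. (1 + nsq n w)\<^sup>2)" "\<bar>\<integral>w. (1 + nsq n w)\<^sup>2 \<partial>gam n\<bar> \<le> 1 * mom3 n"
    by (rule mom3_dom[where k=2 and c=1]; (simp add: measurable_gam_Rn)?)+
  have EX2: "(\<integral>w. (X w)\<^sup>2 \<partial>gam n) \<le> \<sigma>\<^sup>2 * (C * Kop (Q q) z / (2 * pi)) + 5 * E\<^sup>2 * \<sigma> ^ 3 * mom3 n"
  proof -
    have "(\<integral>w. (X w)\<^sup>2 \<partial>gam n) \<le> (\<integral>w. \<sigma>\<^sup>2 * (A q z w)\<^sup>2 + 5 * E\<^sup>2 * \<sigma> ^ 3 * (1 + nsq n w)\<^sup>2 \<partial>gam n)"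
      by (rule gam_integral_mono[OF iX2 _ X2]) (use iA m2(1) in auto)
    also have "\<dots> = \<sigma>\<^sup>2 * (nsq n (\<lambda>j. A q z (unit_vec j)) / (2 * pi))
        + 5 * E\<^sup>2 * \<sigma> ^ 3 * (\<integral>w. (1 + nsq n w)\<^sup>2 \<partial>gam n)"
      using iA m2(1) by (simp add: eA)
    also have "\<dots> \<le> \<sigma>\<^sup>2 * (C * Kop (Q q) z / (2 * pi)) + 5 * E\<^sup>2 * \<sigma> ^ 3 * mom3 n"
      using gradient_bound[OF t z] m2(2) s
      by (intro add_mono mult_left_mono divide_right_mono) auto
    finally show ?thesis .
  qed
  have EX3: "(\<integral>w. \<bar>X w\<bar> ^ 3 \<partial>gam n) \<le> E ^ 3 * \<sigma> ^ 3 * mom3 n"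
    using mom3_dom(2)[of "\<lambda>w. \<bar>X w\<bar> ^ 3" n "E ^ 3 * \<sigma> ^ 3" 3] X3 Xm s T'(2)
    by (auto simp: abs_le_iff)
  have em: "(\<integral>w. exp (Y w) \<partial>gam n) \<le> 1 + (\<integral>w. Y w \<partial>gam n) + (\<integral>w. (Y w)\<^sup>2 \<partial>gam n) / 2
      + exp (2 * L0 \<alpha> \<beta> / C) * (\<integral>w. \<bar>Y w\<bar> ^ 3 \<partial>gam n)"
    using gam.exp_moment[OF Ym, of "2 * L0 \<alpha> \<beta> / C"] Yb by (simp add: abs_le_iff)
  have eY: "(\<integral>w. Y w \<partial>gam n) = (Bop n \<sigma> ?G z - ?G z) / C"
  proof -
    have "integrable (gam n) (\<lambda>w. ?G (vadd n z \<sigma> w))" by (rule integrable_Bop[OF Gm Gb z])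
    then show ?thesis unfolding Y_def X_def Bop_def by (simp add: gam.prob_space)
  qed
  have eY2: "(\<integral>w. (Y w)\<^sup>2 \<partial>gam n) = (\<integral>w. (X w)\<^sup>2 \<partial>gam n) / C\<^sup>2"
    unfolding Y_def by (simp add: power_divide)
  have eY3: "(\<integral>w. \<bar>Y w\<bar> ^ 3 \<partial>gam n) = (\<integral>w. \<bar>X w\<bar> ^ 3 \<partial>gam n) / C ^ 3"
    unfolding Y_def using C_pos by (simp add: power_divide)
  have posY: "0 < (\<integral>w. exp (Y w) \<partial>gam n)"
  proof -
    have "exp (- (2 * L0 \<alpha> \<beta> / C)) \<le> (\<integral>w. exp (Y w) \<partial>gam n)"
    proof (rule gam_integral_ge_const)
      show "integrable (gam n) (\<lambda>w. exp (Y w))"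
        by (rule gam.integrable_const_bound[where B="exp (2 * L0 \<alpha> \<beta> / C)"]) (use Yb Ym in \<open>auto simp: abs_le_iff\<close>)
      show "exp (- (2 * L0 \<alpha> \<beta> / C)) \<le> exp (Y w)" for w
        using Yb[of w] unfolding exp_le_cancel_iff by linarith
    qed
    then show ?thesis by (rule less_le_trans[OF exp_gt_zero])
  qed
  have "exp (?G (vadd n z \<sigma> w) / C) = exp (?G z / C) * exp (Y w)" for w
    by (simp add: Y_def X_def diff_divide_distrib flip: exp_add)
  then have "Bop n \<sigma> (\<lambda>z. exp (?G z / C)) z = exp (?G z / C) * (\<integral>w. exp (Y w) \<partial>gam n)"
    unfolding Bop_def by simp
  then have "ln (Bop n \<sigma> (\<lambda>z. exp (?G z / C)) z) = ?G z / C + ln (\<integral>w. exp (Y w) \<partial>gam n)"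
    using posY by (simp add: ln_mult)
  \<comment> \<open>For an upper bound ln x <= x - 1 is precise enough, since the integral differs
    from 1 only by order sigma^2.\<close>
  also have "\<dots> \<le> ?G z / C + ((\<integral>w. exp (Y w) \<partial>gam n) - 1)"
    using ln_le_minus_one[OF posY] by simp
  also have "\<dots> \<le> ?G z / C + ((Bop n \<sigma> ?G z - ?G z) / C + (\<integral>w. (X w)\<^sup>2 \<partial>gam n) / C\<^sup>2 / 2
      + exp (2 * L0 \<alpha> \<beta> / C) * ((\<integral>w. \<bar>X w\<bar> ^ 3 \<partial>gam n) / C ^ 3))"
    using em unfolding eY eY2 eY3 by linarith
  also have "\<dots> \<le> ?G z / C + ((Bop n \<sigma> ?G z - ?G z) / C
      + (\<sigma>\<^sup>2 * (C * Kop (Q q) z / (2 * pi)) + 5 * E\<^sup>2 * \<sigma> ^ 3 * mom3 n) / C\<^sup>2 / 2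
      + exp (2 * L0 \<alpha> \<beta> / C) * ((E ^ 3 * \<sigma> ^ 3 * mom3 n) / C ^ 3))"
    using EX2 EX3 C_pos by (intro add_left_mono add_mono mult_left_mono divide_right_mono order_refl) auto
  also have "\<dots> = Bop n \<sigma> ?G z / C + \<sigma>\<^sup>2 / (4 * pi * C) * Kop (Q q) z
      + (5 * E\<^sup>2 / (2 * C\<^sup>2) + exp (2 * L0 \<alpha> \<beta> / C) * (E / C) ^ 3) * mom3 n * \<sigma> ^ 3"
  proof -
    have 1: "\<sigma>\<^sup>2 * (C * Kop (Q q) z / (2 * pi)) / C\<^sup>2 / 2 = \<sigma>\<^sup>2 / (4 * pi * C) * Kop (Q q) z"
      using C_pos by (simp add: power2_eq_square)
    show ?thesis
      unfolding add_divide_distrib 1 diff_divide_distrib power_divide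
      by (simp add: algebra_simps)
  qed
  finally show ?thesis .
qed

text \<open>The same expansion from below, for \<open>g\<close> itself and without division by
  \<open>C\<close>. A lower bound on ln (1 + u) needs \<open>u\<close> small, which is what
  \<open>sm\<close> provides; the terms of \<open>u\<close> are of order sigma^2, so the loss 2 u^2
  is of order sigma^4 and joins the error.\<close>

lemma lower_step:
  assumes z: "z \<in> space (Rn n)" and s: "0 < \<sigma>" "\<sigma> \<le> 1"
    and sm: "(E + E\<^sup>2 + exp (2 * L0 \<alpha> \<beta>) * E ^ 3) * mom3 n * \<sigma>\<^sup>2 \<le> 1 / 2"
  shows "Bop n \<sigma> g z + \<sigma>\<^sup>2 / (4 * pi) * Q q z
    - (2 * E\<^sup>2 * mom3 n + exp (2 * L0 \<alpha> \<beta>) * E ^ 3 * mom3 n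
       + 2 * ((E + E\<^sup>2 + exp (2 * L0 \<alpha> \<beta>) * E ^ 3) * mom3 n)\<^sup>2) * \<sigma> ^ 3
    \<le> ln (Bop n \<sigma> (\<lambda>z. exp (g z)) z)"
proof -
  define c2 where "c2 = (E + E\<^sup>2 + exp (2 * L0 \<alpha> \<beta>) * E ^ 3) * mom3 n"
  have gb: "\<bar>g z\<bar> \<le> L0 \<alpha> \<beta>" if "z \<in> space (Rn n)" for z by (rule g_abs[OF t that])
  define Y where "Y = (\<lambda>w. g (vadd n z \<sigma> w) - g z)"
  \<comment> \<open>The gradient is padded by zeros to all \<open>n\<close> coordinates, where the
    Gaussian moment formulas are stated.\<close>
  define a where "a = (\<lambda>i. if i < M then q i z else 0)"
  have aw: "(\<Sum>i<M. q i z * w i) = (\<Sum>i<n. a i * w i)" for w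
  proof -
    have "(\<Sum>i<n. a i * w i) = (\<Sum>i<M. a i * w i)"
      by (rule sum.mono_neutral_right) (use T'(1) in \<open>auto simp: a_def\<close>)
    then show ?thesis by (simp add: a_def)
  qed
  have na: "nsq n a = Q q z"
  proof -
    have "(\<Sum>i<n. (a i)\<^sup>2) = (\<Sum>i<M. (a i)\<^sup>2)"
      by (rule sum.mono_neutral_right) (use T'(1) in \<open>auto simp: a_def\<close>)
    then show ?thesis by (simp add: a_def nsq_def Q_def[OF t])
  qed

  define l where "l = (\<lambda>w. \<Sum>i<n. a i * w i)"
  have l1: "integrable (gam n) l" "(\<integral>w. l w \<partial>gam n) = 0" using gam_linear[of n a] by (auto simp: l_def)
  have l2: "integrable (gam n) (\<lambda>w. (l w)\<^sup>2)" "(\<integral>w. (l w)\<^sup>2 \<partial>gam n) = Q q z / (2 * pi)"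
    using gam_quadratic[of n a] by (auto simp: l_def na)
  have Ym: "Y \<in> borel_measurable (gam n)" unfolding Y_def using measurable_vadd_gam[OF T'(3) z] by simp
  have Yb: "\<bar>Y w\<bar> \<le> 2 * L0 \<alpha> \<beta>" for w
    using gb[OF z] gb[OF vadd_space, of z \<sigma> w] unfolding Y_def by linarith
  have Yl: "\<bar>Y w\<bar> \<le> E * (\<sigma> * sqrt (nsq n w))" for w
    using T'(8)[OF z, of \<sigma> w] s by (simp add: Y_def)
  have Yq: "\<bar>Y w - \<sigma> * l w\<bar> \<le> E * (\<sigma>\<^sup>2 * nsq n w)" for w
    using T'(9)[OF z, of \<sigma> w] by (simp add: Y_def l_def aw)
  have lb: "\<bar>l w\<bar> \<le> 2 * E * (1 + nsq n w)" for w
  proof -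
    have "\<bar>l w\<bar> \<le> E * sqrt (nsq n w) + E * nsq n w"
      using T'(8,9)[OF z, of 1 w] by (simp add: l_def aw)
    also have "\<dots> \<le> E * (1 + nsq n w) + E * (1 + nsq n w)"
      using T'(2) sqrt_le_one_plus[of "nsq n w"] by (intro add_mono mult_left_mono) auto
    finally show ?thesis by simp
  qed
  have Y2b: "(Y w)\<^sup>2 \<le> (2 * L0 \<alpha> \<beta>)\<^sup>2" for w using power_mono[OF Yb[of w], of 2] by simp
  have iY: "integrable (gam n) Y"
    by (rule gam.integrable_const_bound[where B="2 * L0 \<alpha> \<beta>"]) (use Yb Ym in auto)
  have iY2: "integrable (gam n) (\<lambda>w. (Y w)\<^sup>2)"
    by (rule gam.integrable_const_bound[where B="(2 * L0 \<alpha> \<beta>)\<^sup>2"])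
      (use Ym Y2b in auto)
  have m2: "integrable (gam n) (\<lambda>w. (1 + nsq n w)\<^sup>2)" "\<bar>\<integral>w. (1 + nsq n w)\<^sup>2 \<partial>gam n\<bar> \<le> 1 * mom3 n"
    by (rule mom3_dom[where k=2 and c=1]; (simp add: measurable_gam_Rn)?)+
  have E1: "\<bar>\<integral>w. Y w \<partial>gam n\<bar> \<le> E * \<sigma>\<^sup>2 * mom3 n"
  proof -
    \<comment> \<open>Subtracting the linear part, which has mean zero, improves the bound on the
      mean from order sigma to order sigma^2.\<close>
    have "(\<integral>w. Y w \<partial>gam n) = (\<integral>w. Y w - \<sigma> * l w \<partial>gam n)" using iY l1 by simp
    also have "\<bar>\<dots>\<bar> \<le> E * \<sigma>\<^sup>2 * mom3 n"
    proof (rule mom3_dom(2)[where k=1])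
      show "(\<lambda>w. Y w - \<sigma> * l w) \<in> borel_measurable (gam n)" using Ym l1 by auto
      show "\<bar>Y w - \<sigma> * l w\<bar> \<le> E * \<sigma>\<^sup>2 * (1 + nsq n w) ^ 1" for w
      proof -
        have "E * (\<sigma>\<^sup>2 * nsq n w) \<le> E * (\<sigma>\<^sup>2 * (1 + nsq n w))" using T'(2) by (intro mult_left_mono) auto
        then show ?thesis using Yq[of w] by simp
      qed
    qed (use T'(2) in auto)
    finally show ?thesis .
  qed
  have E2: "\<bar>\<integral>w. (Y w)\<^sup>2 \<partial>gam n\<bar> \<le> E\<^sup>2 * \<sigma>\<^sup>2 * mom3 n"
  proof (rule mom3_dom(2)[where k=1])
    show "\<bar>(Y w)\<^sup>2\<bar> \<le> E\<^sup>2 * \<sigma>\<^sup>2 * (1 + nsq n w) ^ 1" for w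
    proof -
      have "(Y w)\<^sup>2 \<le> (E * (\<sigma> * sqrt (nsq n w)))\<^sup>2" using power_mono[OF Yl[of w], of 2] by simp
      also have "\<dots> = E\<^sup>2 * \<sigma>\<^sup>2 * nsq n w" by (simp add: power_mult_distrib)
      also have "\<dots> \<le> E\<^sup>2 * \<sigma>\<^sup>2 * (1 + nsq n w)" by (intro mult_left_mono) auto
      finally show ?thesis by simp
    qed
  qed (use Ym in auto)
  have E2': "\<sigma>\<^sup>2 * (Q q z / (2 * pi)) - 4 * E\<^sup>2 * \<sigma> ^ 3 * mom3 n \<le> (\<integral>w. (Y w)\<^sup>2 \<partial>gam n)"
  proof -
    have "\<sigma>\<^sup>2 * (Q q z / (2 * pi)) - 4 * E\<^sup>2 * \<sigma> ^ 3 * mom3 n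
      \<le> \<sigma>\<^sup>2 * (Q q z / (2 * pi)) - 4 * E\<^sup>2 * \<sigma> ^ 3 * (\<integral>w. (1 + nsq n w)\<^sup>2 \<partial>gam n)"
      using m2(2) s by (intro diff_left_mono mult_left_mono) auto
    also have "\<dots> = (\<integral>w. \<sigma>\<^sup>2 * (l w)\<^sup>2 - 4 * E\<^sup>2 * \<sigma> ^ 3 * (1 + nsq n w)\<^sup>2 \<partial>gam n)"
      using l2 m2(1) by simp
    also have "\<dots> \<le> (\<integral>w. (Y w)\<^sup>2 \<partial>gam n)"
    proof (rule gam_integral_mono[OF _ iY2])
      show "integrable (gam n) (\<lambda>w. \<sigma>\<^sup>2 * (l w)\<^sup>2 - 4 * E\<^sup>2 * \<sigma> ^ 3 * (1 + nsq n w)\<^sup>2)"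
        using l2 m2(1) by auto
      fix w
      let ?r = "E * (\<sigma>\<^sup>2 * nsq n w)" and ?l = "1 + nsq n w"
      have "2 * \<bar>\<sigma> * l w\<bar> * ?r \<le> 2 * (\<sigma> * (2 * E * ?l)) * (E * (\<sigma>\<^sup>2 * ?l))"
        using s T'(2) lb[of w]
        by (intro mult_mono) (auto simp: abs_mult intro!: mult_left_mono mult_nonneg_nonneg)
      also have "\<dots> = 4 * E\<^sup>2 * \<sigma> ^ 3 * ?l\<^sup>2"
        by (simp add: power2_eq_square power3_eq_cube)
      finally have "(\<sigma> * l w)\<^sup>2 - 4 * E\<^sup>2 * \<sigma> ^ 3 * ?l\<^sup>2 \<le> (Y w)\<^sup>2"
        using sq_perturb(2)[OF Yq[of w]] by linarith
      then show "\<sigma>\<^sup>2 * (l w)\<^sup>2 - 4 * E\<^sup>2 * \<sigma> ^ 3 * (1 + nsq n w)\<^sup>2 \<le> (Y w)\<^sup>2"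
        by (simp add: power_mult_distrib)
    qed
    finally show ?thesis .
  qed
  have E3: "\<bar>\<integral>w. \<bar>Y w\<bar> ^ 3 \<partial>gam n\<bar> \<le> E ^ 3 * \<sigma> ^ 3 * mom3 n"
  proof (rule mom3_dom(2)[where k=3])
    show "\<bar>\<bar>Y w\<bar> ^ 3\<bar> \<le> E ^ 3 * \<sigma> ^ 3 * (1 + nsq n w) ^ 3" for w
    proof -
      have "\<bar>Y w\<bar> ^ 3 \<le> (E * (\<sigma> * sqrt (nsq n w))) ^ 3" by (rule power_mono[OF Yl]) simp
      also have "\<dots> = E ^ 3 * \<sigma> ^ 3 * sqrt (nsq n w) ^ 3" by (simp add: power_mult_distrib)
      also have "\<dots> \<le> E ^ 3 * \<sigma> ^ 3 * (1 + nsq n w) ^ 3"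
        using s T'(2) by (intro mult_left_mono sqrt_cubed_le) auto
      finally show ?thesis by simp
    qed
  qed (use Ym T'(2) s in auto)
  define B where "B = exp (2 * L0 \<alpha> \<beta>)"
  have B0: "0 \<le> B" by (simp add: B_def)
  define u where "u = (\<integral>w. Y w \<partial>gam n) + (\<integral>w. (Y w)\<^sup>2 \<partial>gam n) / 2 - B * (\<integral>w. \<bar>Y w\<bar> ^ 3 \<partial>gam n)"
  have u_le: "\<bar>u\<bar> \<le> c2 * \<sigma>\<^sup>2"
  proof -
    have B3: "\<bar>B * (\<integral>w. \<bar>Y w\<bar> ^ 3 \<partial>gam n)\<bar> \<le> B * E ^ 3 * mom3 n * \<sigma>\<^sup>2"
    proof -
      have "\<bar>B * (\<integral>w. \<bar>Y w\<bar> ^ 3 \<partial>gam n)\<bar> \<le> B * (E ^ 3 * \<sigma> ^ 3 * mom3 n)"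
        unfolding abs_mult using E3 B0 by (simp add: mult_left_mono)
      also have "\<dots> \<le> B * (E ^ 3 * \<sigma>\<^sup>2 * mom3 n)"
        using sigma_pow[OF s] B0 T'(2) mom3_pos[of n] by (intro mult_left_mono mult_right_mono) auto
      finally show ?thesis by (simp add: algebra_simps)
    qed
    have "0 \<le> E\<^sup>2 * \<sigma>\<^sup>2 * mom3 n" using mom3_pos[of n] by simp
    then have "\<bar>u\<bar> \<le> E * \<sigma>\<^sup>2 * mom3 n + E\<^sup>2 * \<sigma>\<^sup>2 * mom3 n + B * E ^ 3 * mom3 n * \<sigma>\<^sup>2"
      using E1 E2 B3 unfolding u_def by linarith
    also have "\<dots> = c2 * \<sigma>\<^sup>2" by (simp add: c2_def B_def algebra_simps)
    finally show ?thesis .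
  qed
  have em: "1 + u \<le> (\<integral>w. exp (Y w) \<partial>gam n)"
    using gam.exp_moment[OF Ym, of "2 * L0 \<alpha> \<beta>"] Yb unfolding u_def B_def abs_le_iff by auto
  have u_half: "\<bar>u\<bar> \<le> 1 / 2" using u_le sm unfolding c2_def by linarith
  have lnu: "u - 2 * u\<^sup>2 \<le> ln (1 + u)"
    using abs_ln_one_plus_x_minus_x_bound[OF u_half] unfolding abs_le_iff by auto
  have u2: "u\<^sup>2 \<le> c2\<^sup>2 * \<sigma> ^ 3"
  proof -
    have "u\<^sup>2 \<le> (c2 * \<sigma>\<^sup>2)\<^sup>2" using power_mono[OF u_le, of 2] by simp
    also have "\<dots> = c2\<^sup>2 * \<sigma> ^ 4" by (simp add: power_mult_distrib flip: power_mult)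
    also have "\<dots> \<le> c2\<^sup>2 * \<sigma> ^ 3" using sigma_pow[OF s] by (intro mult_left_mono) auto
    finally show ?thesis .
  qed
  have pos: "0 < 1 + u" using u_half by (simp add: abs_le_iff)
  have eY: "(\<integral>w. Y w \<partial>gam n) = Bop n \<sigma> g z - g z"
    unfolding Y_def Bop_def using integrable_Bop[OF T'(3) gb z] by (simp add: gam.prob_space)
  have B3': "B * (\<integral>w. \<bar>Y w\<bar> ^ 3 \<partial>gam n) \<le> B * (E ^ 3 * \<sigma> ^ 3 * mom3 n)"
    using E3 B0 by (intro mult_left_mono) auto
  have "exp (g (vadd n z \<sigma> w)) = exp (g z) * exp (Y w)" for w
    by (simp add: Y_def flip: exp_add)
  then have "Bop n \<sigma> (\<lambda>z. exp (g z)) z = exp (g z) * (\<integral>w. exp (Y w) \<partial>gam n)"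
    unfolding Bop_def by simp
  then have "ln (Bop n \<sigma> (\<lambda>z. exp (g z)) z) = g z + ln (\<integral>w. exp (Y w) \<partial>gam n)"
    using em pos by (simp add: ln_mult)
  moreover have "ln (1 + u) \<le> ln (\<integral>w. exp (Y w) \<partial>gam n)" using em pos by simp
  ultimately have "g z + (u - 2 * u\<^sup>2) \<le> ln (Bop n \<sigma> (\<lambda>z. exp (g z)) z)" using lnu by linarith
  moreover have "Bop n \<sigma> g z - g z + (\<sigma>\<^sup>2 * (Q q z / (2 * pi)) - 4 * E\<^sup>2 * \<sigma> ^ 3 * mom3 n) / 2
      - B * (E ^ 3 * \<sigma> ^ 3 * mom3 n) - 2 * (c2\<^sup>2 * \<sigma> ^ 3) \<le> u - 2 * u\<^sup>2"
  proof -
    have "u = Bop n \<sigma> g z - g z + (\<integral>w. (Y w)\<^sup>2 \<partial>gam n) / 2 - B * (\<integral>w. \<bar>Y w\<bar> ^ 3 \<partial>gam n)"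
      by (simp add: u_def eY)
    moreover have "(\<sigma>\<^sup>2 * (Q q z / (2 * pi)) - 4 * E\<^sup>2 * \<sigma> ^ 3 * mom3 n) / 2 \<le> (\<integral>w. (Y w)\<^sup>2 \<partial>gam n) / 2"
      using E2' by (rule divide_right_mono) simp
    moreover have "2 * u\<^sup>2 \<le> 2 * (c2\<^sup>2 * \<sigma> ^ 3)" using u2 by simp
    ultimately show ?thesis using B3' by (auto intro!: diff_mono add_mono)
  qed
  moreover have "(\<sigma>\<^sup>2 * (Q q z / (2 * pi)) - 4 * E\<^sup>2 * \<sigma> ^ 3 * mom3 n) / 2
      = \<sigma>\<^sup>2 / (4 * pi) * Q q z - 2 * E\<^sup>2 * mom3 n * \<sigma> ^ 3"
    by (simp add: diff_divide_distrib)
  ultimately have "Bop n \<sigma> g z + \<sigma>\<^sup>2 / (4 * pi) * Q q z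
    - (2 * E\<^sup>2 * mom3 n + B * E ^ 3 * mom3 n + 2 * c2\<^sup>2) * \<sigma> ^ 3 \<le> ln (Bop n \<sigma> (\<lambda>z. exp (g z)) z)"
    by (simp add: algebra_simps)
  then show ?thesis unfolding B_def c2_def .
qed

end

end

section \<open>The entropic inequality\<close>

lemma Bop_pow_measurable:
  assumes "F \<in> borel_measurable (Rn n)"
  shows "(Bop n \<sigma> ^^ k) F \<in> borel_measurable (Rn n)"
  by (induct k) (use assms Bop_measurable in auto)

lemma Bop_abs:
  fixes F :: "(nat \<Rightarrow> real) \<Rightarrow> real"
  assumes "F \<in> borel_measurable (Rn n)" "\<And>z. z \<in> space (Rn n) \<Longrightarrow> \<bar>F z\<bar> \<le> c" "z \<in> space (Rn n)"
  shows "\<bar>Bop n s F z\<bar> \<le> c"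
  unfolding Bop_def
  by (rule gam_integral_abs_le_const[OF integrable_Bop[OF assms]]) (use assms(2) vadd_space in auto)

lemma Bop_pow_abs:
  fixes F :: "(nat \<Rightarrow> real) \<Rightarrow> real"
  assumes "F \<in> borel_measurable (Rn n)" "\<And>z. z \<in> space (Rn n) \<Longrightarrow> \<bar>F z\<bar> \<le> c"
  shows "z \<in> space (Rn n) \<Longrightarrow> \<bar>(Bop n \<sigma> ^^ k) F z\<bar> \<le> c"
proof (induct k arbitrary: z)
  case (Suc k)
  show ?case using Bop_abs[OF Bop_pow_measurable[OF assms(1)] Suc(1) Suc(2)] by simp
qed (use assms in auto)

lemma Bop_mono:
  fixes F H :: "(nat \<Rightarrow> real) \<Rightarrow> real"
  assumes "F \<in> borel_measurable (Rn n)" "\<And>z. z \<in> space (Rn n) \<Longrightarrow> \<bar>F z\<bar> \<le> c"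
    and "H \<in> borel_measurable (Rn n)" "\<And>z. z \<in> space (Rn n) \<Longrightarrow> \<bar>H z\<bar> \<le> d"
    and "\<And>z. z \<in> space (Rn n) \<Longrightarrow> F z \<le> H z" and z: "z \<in> space (Rn n)"
  shows "Bop n s F z \<le> Bop n s H z"
  unfolding Bop_def
  by (rule integral_mono[OF integrable_Bop[OF assms(1,2) z] integrable_Bop[OF assms(3,4) z]])
    (use assms(5) vadd_space in auto)

lemma Bop_pow_mono:
  fixes F H :: "(nat \<Rightarrow> real) \<Rightarrow> real"
  assumes "F \<in> borel_measurable (Rn n)" "\<And>z. z \<in> space (Rn n) \<Longrightarrow> \<bar>F z\<bar> \<le> c"
    and "H \<in> borel_measurable (Rn n)" "\<And>z. z \<in> space (Rn n) \<Longrightarrow> \<bar>H z\<bar> \<le> d"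
    and "\<And>z. z \<in> space (Rn n) \<Longrightarrow> F z \<le> H z"
  shows "z \<in> space (Rn n) \<Longrightarrow> (Bop n s ^^ k) F z \<le> (Bop n s ^^ k) H z"
proof (induct k arbitrary: z)
  case (Suc k)
  show ?case
    using Bop_mono[OF Bop_pow_measurable[OF assms(1)] Bop_pow_abs[OF assms(1,2)]
      Bop_pow_measurable[OF assms(3)] Bop_pow_abs[OF assms(3,4)] Suc(1) Suc(2)] by simp
qed (use assms in auto)

lemma Bop_pow_cmult: "(Bop n s ^^ k) (\<lambda>z. r * F z) = (\<lambda>z. r * (Bop n s ^^ k) F z)"
proof (induct k)
  case (Suc k)
  show ?case unfolding funpow.simps o_def Suc by (simp add: Bop_def)
qed simp

lemma Bop_cong:
  assumes "\<And>z. z \<in> space (Rn n) \<Longrightarrow> F z = H z"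
  shows "Bop n s F z = Bop n s H z"
  unfolding Bop_def by (intro Bochner_Integration.integral_cong refl assms vadd_space)

text \<open>By \<open>Bop_Bop\<close> the squared scales of equal steps add up. The count starts at
  one so that every scale is positive.\<close>

lemma Bop_pow_eq:
  fixes F :: "(nat \<Rightarrow> real) \<Rightarrow> real"
  assumes F: "F \<in> borel_measurable (Rn n)" "\<And>z. z \<in> space (Rn n) \<Longrightarrow> \<bar>F z\<bar> \<le> c" and s: "0 < s"
  shows "z \<in> space (Rn n) \<Longrightarrow> (Bop n s ^^ Suc k) F z = Bop n (sqrt (Suc k) * s) F z"
proof (induct k arbitrary: z)
  case (Suc k)
  have "(Bop n s ^^ Suc (Suc k)) F z = Bop n s ((Bop n s ^^ Suc k) F) z" by simp
  also have "\<dots> = Bop n s (Bop n (sqrt (Suc k) * s) F) z"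
    by (rule Bop_cong) (rule Suc(1))
  also have "\<dots> = Bop n (sqrt (Suc (Suc k)) * s) F z"
    by (rule Bop_Bop[OF F]) (use s Suc in \<open>auto simp: power_mult_distrib algebra_simps\<close>)
  finally show ?case .
qed simp

text \<open>\<open>c\<close> and \<open>\<sigma>0\<close> are chosen before the function: they
  depend on it only through \<open>a\<close>, \<open>b\<close> and \<open>D\<close>, which its
  Gaussian averages share. The second-order term of \<open>upper_step\<close> is paid for by the one
  that \<open>lower_step\<close> yields inside \<open>Kop\<close>.\<close>

lemma (in rand_iso) one_step:
  assumes a: "0 < a" and D: "0 \<le> D"
  obtains c \<sigma>0 where "0 \<le> c" "0 < \<sigma>0"
    "\<And>\<psi> p \<sigma> z. tame n M a b D \<psi> p \<Longrightarrow> 0 < \<sigma> \<Longrightarrow> \<sigma> \<le> \<sigma>0 \<Longrightarrow> z \<in> space (Rn n) \<Longrightarrow>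
      Bop n \<sigma> (\<lambda>z. exp (Kop (\<lambda>z. ln (\<psi> z)) z / C)) z
        \<le> exp (c * \<sigma> ^ 3) * exp (Kop (\<lambda>z. ln (Bop n \<sigma> \<psi> z)) z / C)"
proof -
  define E where "E = D / a + D\<^sup>2 / a\<^sup>2"
  have E0: "0 \<le> E" using a D by (simp add: E_def)
  have m0: "0 \<le> mom3 n" using mom3_pos[of n] by simp
  define L where "L = \<bar>ln a\<bar> + \<bar>ln b\<bar>"
  define c1 where "c1 = (5 * E\<^sup>2 / (2 * C\<^sup>2) + exp (2 * L / C) * (E / C) ^ 3) * mom3 n"
  define c2 where "c2 = (E + E\<^sup>2 + exp (2 * L) * E ^ 3) * mom3 n"
  define c3 where "c3 = 2 * E\<^sup>2 * mom3 n + exp (2 * L) * E ^ 3 * mom3 n + 2 * c2\<^sup>2"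
  have c: "0 \<le> c1" "0 \<le> c2" "0 \<le> c3"
    using E0 m0 C_pos by (auto simp: c1_def c2_def c3_def intro!: add_nonneg_nonneg mult_nonneg_nonneg)
  \<comment> \<open>Chosen so that c2 sigma0 <= 1/2 and sigma0 <= 1; then c2 sigma^2 <= 1/2, the
    smallness that \<open>lower_step\<close> asks for.\<close>
  define \<sigma>0 where "\<sigma>0 = 1 / (1 + 2 * c2)"
  have s0: "0 < \<sigma>0" "\<sigma>0 \<le> 1" "c2 * \<sigma>0 \<le> 1 / 2" using c by (auto simp: \<sigma>0_def field_simps)
  show thesis
  proof (rule that[of "c1 + c3 / C" \<sigma>0])
    show "0 \<le> c1 + c3 / C" using c C_pos by simp
    show "0 < \<sigma>0" by (rule s0)
    fix \<psi> p \<sigma> z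
    assume t: "tame n M a b D \<psi> p" and s: "0 < \<sigma>" "\<sigma> \<le> \<sigma>0" and z: "z \<in> space (Rn n)"
    let ?g = "\<lambda>z. ln (\<psi> z)" and ?q = "\<lambda>i z. p i z / \<psi> z" and ?h = "\<lambda>z. ln (Bop n \<sigma> \<psi> z)"
    have tg: "tame n M (ln a) (ln b) E ?g ?q" unfolding E_def by (rule tame_ln[OF t a])
    have tB: "tame n M a b D (Bop n \<sigma> \<psi>) (\<lambda>i. Bop n \<sigma> (p i))" by (rule tame_Bop[OF t])
    have th: "tame n M (ln a) (ln b) E ?h (\<lambda>i z. Bop n \<sigma> (p i) z / Bop n \<sigma> \<psi> z)"
      unfolding E_def by (rule tame_ln[OF tB a])
    have s1: "\<sigma> \<le> 1" using s s0 by simp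
    have sm: "c2 * \<sigma>\<^sup>2 \<le> 1 / 2"
    proof -
      have "\<sigma>\<^sup>2 \<le> \<sigma>0" using s s1 by (auto simp: power2_eq_square intro: order_trans[OF mult_left_le])
      then have "c2 * \<sigma>\<^sup>2 \<le> c2 * \<sigma>0" using c by (intro mult_left_mono) auto
      then show ?thesis using s0 by simp
    qed
    note L = L0_def[OF tg, folded L_def]
    have up: "ln (Bop n \<sigma> (\<lambda>z. exp (Kop ?g z / C)) z)
      \<le> Bop n \<sigma> (Kop ?g) z / C + \<sigma>\<^sup>2 / (4 * pi * C) * Kop (Q ?q) z + c1 * \<sigma> ^ 3"
      using upper_step[OF tg z s(1) s1] unfolding L c1_def .
    have lo: "Bop n \<sigma> ?g z + \<sigma>\<^sup>2 / (4 * pi) * Q ?q z - c3 * \<sigma> ^ 3 \<le> ?h z" if z: "z \<in> space (Rn n)" for z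
    proof -
      have "Bop n \<sigma> (\<lambda>z. exp (?g z)) z = Bop n \<sigma> \<psi> z"
        unfolding Bop_def using tameD(5)[OF t vadd_space, of z \<sigma>] a
        by (intro Bochner_Integration.integral_cong refl) (simp add: exp_ln less_le_trans)
      then show ?thesis
        using lower_step[OF tg z s(1) s1] sm unfolding L c2_def[symmetric] c3_def[symmetric] by simp
    qed
    have gm: "?g \<in> borel_measurable (Rn n)" by (rule tameD(3)[OF tg])
    have gb: "\<bar>?g z\<bar> \<le> L" if "z \<in> space (Rn n)" for z unfolding L_def by (rule tame_abs[OF tg that])
    have Bm: "Bop n \<sigma> ?g \<in> borel_measurable (Rn n)" by (rule Bop_measurable[OF gm])
    have Bb: "\<bar>Bop n \<sigma> ?g z\<bar> \<le> L" if "z \<in> space (Rn n)" for z by (rule Bop_abs[OF gm gb that])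
    note iB = integrable_R[OF Bm Bb z] and iQ = integrable_R[OF Q_meas[OF tg] Q_abs[OF tg] z]
      and ih = integrable_R[OF tameD(3)[OF th] tame_abs[OF th] z]
    \<comment> \<open>\<open>lower_step\<close> is applied at the random point
      \<open>R \<omega> z\<close> and then averaged.\<close>
    have "Kop (Bop n \<sigma> ?g) z + \<sigma>\<^sup>2 / (4 * pi) * Kop (Q ?q) z - c3 * \<sigma> ^ 3
      = (\<integral>\<omega>. Bop n \<sigma> ?g (R \<omega> z) + \<sigma>\<^sup>2 / (4 * pi) * Q ?q (R \<omega> z) - c3 * \<sigma> ^ 3 \<partial>\<Omega>)"
      unfolding Kop_def using iB iQ by (simp add: prob_space)
    also have "\<dots> \<le> Kop ?h z"
      unfolding Kop_def
      by (rule integral_mono) (use iB iQ ih lo R_space z in auto)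
    finally have K: "Kop (Bop n \<sigma> ?g) z + \<sigma>\<^sup>2 / (4 * pi) * Kop (Q ?q) z - c3 * \<sigma> ^ 3 \<le> Kop ?h z" .
    have "(Kop (Bop n \<sigma> ?g) z + \<sigma>\<^sup>2 / (4 * pi) * Kop (Q ?q) z) / C \<le> (Kop ?h z + c3 * \<sigma> ^ 3) / C"
      using K C_pos by (intro divide_right_mono) auto
    \<comment> \<open>Commutation of \<open>Kop\<close> with the Gaussian average makes the leading
      terms of the two expansions agree.\<close>
    then have K2: "Bop n \<sigma> (Kop ?g) z / C + \<sigma>\<^sup>2 / (4 * pi * C) * Kop (Q ?q) z \<le> Kop ?h z / C + c3 / C * \<sigma> ^ 3"
      using Kop_Bop[OF gm gb z, of \<sigma>] by (simp add: add_divide_distrib)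
    have Fm: "(\<lambda>z. exp (Kop ?g z / C)) \<in> borel_measurable (Rn n)"
      using Kop_measurable[OF gm] by measurable
    have Kb: "\<bar>Kop ?g z\<bar> \<le> L" if "z \<in> space (Rn n)" for z by (rule Kop_abs[OF gm gb that])
    have pos: "0 < Bop n \<sigma> (\<lambda>z. exp (Kop ?g z / C)) z"
    proof -
      have "exp (- L / C) \<le> Bop n \<sigma> (\<lambda>z. exp (Kop ?g z / C)) z"
        unfolding Bop_def
      proof (rule gam_integral_ge_const)
        show "integrable (gam n) (\<lambda>w. exp (Kop ?g (vadd n z \<sigma> w) / C))"
        proof (rule integrable_Bop[OF Fm _ z])
          show "\<bar>exp (Kop ?g z / C)\<bar> \<le> exp (L / C)" if "z \<in> space (Rn n)" for z
            using Kb[OF that] C_pos by (auto intro!: divide_right_mono)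
        qed
        show "exp (- L / C) \<le> exp (Kop ?g (vadd n z \<sigma> w) / C)" for w
          unfolding exp_le_cancel_iff using Kb[OF vadd_space, of z \<sigma> w] C_pos
          by (intro divide_right_mono) (auto simp: abs_le_iff)
      qed
      then show ?thesis by (rule less_le_trans[OF exp_gt_zero])
    qed
    have "ln (Bop n \<sigma> (\<lambda>z. exp (Kop ?g z / C)) z) \<le> (c1 + c3 / C) * \<sigma> ^ 3 + Kop ?h z / C"
      using up K2 by (simp add: distrib_right)
    then have "exp (ln (Bop n \<sigma> (\<lambda>z. exp (Kop ?g z / C)) z)) \<le> exp ((c1 + c3 / C) * \<sigma> ^ 3 + Kop ?h z / C)"
      unfolding exp_le_cancel_iff .
    then show "Bop n \<sigma> (\<lambda>z. exp (Kop ?g z / C)) z \<le> exp ((c1 + c3 / C) * \<sigma> ^ 3) * exp (Kop ?h z / C)"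
      using pos by (simp add: exp_add)
  qed
qed

section \<open>Iterating Gaussian steps\<close>

context rand_iso begin

text \<open>The innermost step is taken first: it replaces \<open>\<psi>\<close> by its Gaussian
  average, which is tame with the same constants, so the induction hypothesis applies to it.
  Monotonicity of the remaining steps carries the bound outwards.\<close>

lemma iterated_step:
  assumes a: "0 < a"
    and step: "\<And>\<psi> p z. tame n M a b D \<psi> p \<Longrightarrow> z \<in> space (Rn n) \<Longrightarrow>
      Bop n \<sigma> (\<lambda>z. exp (Kop (\<lambda>z. ln (\<psi> z)) z / C)) z
        \<le> r * exp (Kop (\<lambda>z. ln (Bop n \<sigma> \<psi> z)) z / C)"
    and r: "0 \<le> r"
  shows "tame n M a b D \<psi> p \<Longrightarrow> z \<in> space (Rn n) \<Longrightarrow>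
    (Bop n \<sigma> ^^ k) (\<lambda>z. exp (Kop (\<lambda>z. ln (\<psi> z)) z / C)) z
      \<le> r ^ k * exp (Kop (\<lambda>z. ln ((Bop n \<sigma> ^^ k) \<psi> z)) z / C)"
proof (induct k arbitrary: \<psi> p z)
  case (Suc k)
  let ?F = "\<lambda>\<psi> z. exp (Kop (\<lambda>z. ln (\<psi> z)) z / C)"
  have bm: "?F \<psi> \<in> borel_measurable (Rn n)"
      "\<And>z. z \<in> space (Rn n) \<Longrightarrow> \<bar>?F \<psi> z\<bar> \<le> exp ((\<bar>ln a\<bar> + \<bar>ln b\<bar>) / C)"
    if t: "tame n M a b D \<psi> p" for \<psi> p
  proof -
    note tg = tame_ln[OF t a]
    show "?F \<psi> \<in> borel_measurable (Rn n)" using Kop_measurable[OF tameD(3)[OF tg]] by measurable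
    show "\<bar>?F \<psi> z\<bar> \<le> exp ((\<bar>ln a\<bar> + \<bar>ln b\<bar>) / C)" if "z \<in> space (Rn n)" for z
      using Kop_abs[OF tameD(3)[OF tg] tame_abs[OF tg] that] C_pos by (auto intro!: divide_right_mono)
  qed
  have tB: "tame n M a b D (Bop n \<sigma> \<psi>) (\<lambda>i. Bop n \<sigma> (p i))" by (rule tame_Bop[OF Suc(2)])
  have "(Bop n \<sigma> ^^ Suc k) (?F \<psi>) z = (Bop n \<sigma> ^^ k) (Bop n \<sigma> (?F \<psi>)) z"
    by (simp add: funpow_swap1)
  also have "\<dots> \<le> (Bop n \<sigma> ^^ k) (\<lambda>z. r * ?F (Bop n \<sigma> \<psi>) z) z"
  proof (rule Bop_pow_mono[OF Bop_measurable[OF bm(1)[OF Suc(2)]] Bop_abs[OF bm[OF Suc(2)]] _ _ step[OF Suc(2)] Suc(3)])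
    show "(\<lambda>z. r * ?F (Bop n \<sigma> \<psi>) z) \<in> borel_measurable (Rn n)"
      using bm(1)[OF tB] by (intro borel_measurable_times) auto
    show "\<bar>r * ?F (Bop n \<sigma> \<psi>) z\<bar> \<le> r * exp ((\<bar>ln a\<bar> + \<bar>ln b\<bar>) / C)" if "z \<in> space (Rn n)" for z
      unfolding abs_mult using bm(2)[OF tB that] r by (intro mult_mono) auto
  qed
  also have "\<dots> = r * (Bop n \<sigma> ^^ k) (?F (Bop n \<sigma> \<psi>)) z" by (simp add: Bop_pow_cmult)
  also have "\<dots> \<le> r * (r ^ k * ?F ((Bop n \<sigma> ^^ k) (Bop n \<sigma> \<psi>)) z)"
    by (intro mult_left_mono Suc(1)[OF tB Suc(3)] r)
  also have "(Bop n \<sigma> ^^ k) (Bop n \<sigma> \<psi>) = (Bop n \<sigma> ^^ Suc k) \<psi>" by (simp add: funpow_swap1)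
  finally show ?case by (simp add: algebra_simps)
qed simp

lemma Bop_at_zero: "Bop n 1 F (\<lambda>i\<in>{..<n}. 0) = (\<integral>w. F w \<partial>gam n)"
  unfolding Bop_def
proof (rule Bochner_Integration.integral_cong[OF refl])
  fix w assume "w \<in> space (gam n)"
  then have "vadd n (\<lambda>i\<in>{..<n}. 0) 1 w = w"
    by (auto simp: vadd_def space_gam space_Rn extensional_def fun_eq_iff)
  then show "F (vadd n (\<lambda>i\<in>{..<n}. 0) 1 w) = F w" by simp
qed

theorem entropic_ineq:
  assumes t: "tame n M a b D \<psi> p" and a: "0 < a"
  shows "(\<integral>z. exp (Kop (\<lambda>z. ln (\<psi> z)) z / C) \<partial>gam n) \<le> exp (ln (\<integral>z. \<psi> z \<partial>gam n) / C)"
proof -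
  let ?o = "(\<lambda>i\<in>{..<n}. 0) :: nat \<Rightarrow> real"
  let ?F = "\<lambda>z. exp (Kop (\<lambda>z. ln (\<psi> z)) z / C)"
  obtain c \<sigma>0 where c: "0 \<le> c" "0 < \<sigma>0" and
    step: "\<And>\<psi> p \<sigma> z. tame n M a b D \<psi> p \<Longrightarrow> 0 < \<sigma> \<Longrightarrow> \<sigma> \<le> \<sigma>0 \<Longrightarrow> z \<in> space (Rn n) \<Longrightarrow>
      Bop n \<sigma> (\<lambda>z. exp (Kop (\<lambda>z. ln (\<psi> z)) z / C)) z
        \<le> exp (c * \<sigma> ^ 3) * exp (Kop (\<lambda>z. ln (Bop n \<sigma> \<psi> z)) z / C)"
    using one_step[OF a tameD(2)[OF t]] by blast
  note tg = tame_ln[OF t a]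
  have Fm: "?F \<in> borel_measurable (Rn n)" using Kop_measurable[OF tameD(3)[OF tg]] by measurable
  have Fb: "\<bar>?F z\<bar> \<le> exp ((\<bar>ln a\<bar> + \<bar>ln b\<bar>) / C)" if "z \<in> space (Rn n)" for z
    using Kop_abs[OF tameD(3)[OF tg] tame_abs[OF tg] that] C_pos by (auto intro!: divide_right_mono)
  have bound: "(\<integral>z. ?F z \<partial>gam n) \<le> exp (c * \<sigma>) * exp (ln (\<integral>z. \<psi> z \<partial>gam n) / C)"
    if s: "\<sigma> = 1 / sqrt (Suc k)" "\<sigma> \<le> \<sigma>0" for \<sigma> k
  proof -
    have s0: "0 < \<sigma>" using s by simp
    have s1: "sqrt (Suc k) * \<sigma> = 1" using s(1) by simp
    \<comment> \<open>The k + 1 errors c sigma^3 add up to c sigma, which tends to 0.\<close>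
    have s2: "real (Suc k) * \<sigma> ^ 3 = \<sigma>"
    proof -
      have "real (Suc k) * \<sigma> ^ 3 = (sqrt (Suc k) * \<sigma>)\<^sup>2 * \<sigma>"
        by (simp add: power_mult_distrib power2_eq_square power3_eq_cube)
      then show ?thesis unfolding s1 by simp
    qed
    have "(Bop n \<sigma> ^^ Suc k) ?F ?o = Bop n (sqrt (Suc k) * \<sigma>) ?F ?o"
      by (rule Bop_pow_eq[OF Fm Fb s0 zero_space])
    then have "(\<integral>z. ?F z \<partial>gam n) = (Bop n \<sigma> ^^ Suc k) ?F ?o"
      unfolding s1 Bop_at_zero by (rule sym)
    also have "\<dots> \<le> exp (c * \<sigma> ^ 3) ^ Suc k * exp (Kop (\<lambda>z. ln ((Bop n \<sigma> ^^ Suc k) \<psi> z)) ?o / C)"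
      by (rule iterated_step[OF a step[OF _ s0 s(2)] _ t zero_space]) auto
    also have "exp (c * \<sigma> ^ 3) ^ Suc k = exp (c * \<sigma>)"
    proof -
      have "exp (c * \<sigma> ^ 3) ^ Suc k = exp (c * (real (Suc k) * \<sigma> ^ 3))"
        by (subst exp_of_nat_mult[symmetric]) (simp add: algebra_simps)
      then show ?thesis unfolding s2 .
    qed
    \<comment> \<open>At the fixed point the integrand does not depend on the random isometry, so
      the average disappears and the logarithm of a full Gaussian integral is left.\<close>
    also have "Kop (\<lambda>z. ln ((Bop n \<sigma> ^^ Suc k) \<psi> z)) ?o = ln ((Bop n \<sigma> ^^ Suc k) \<psi> ?o)"
      unfolding Kop_def
      by (subst Bochner_Integration.integral_cong[OF refl, of _ _ "\<lambda>_. ln ((Bop n \<sigma> ^^ Suc k) \<psi> ?o)"])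
         (simp_all only: R_zero, simp add: prob_space)
    also have "(Bop n \<sigma> ^^ Suc k) \<psi> ?o = (\<integral>z. \<psi> z \<partial>gam n)"
      using Bop_pow_eq[OF tameD(3)[OF t] tame_abs[OF t] s0 zero_space, of k]
      unfolding s1 Bop_at_zero .
    finally show ?thesis .
  qed
  have lim0: "(\<lambda>k. 1 / sqrt (Suc k)) \<longlonglongrightarrow> 0"
    by real_asymp
  have "(\<lambda>k. exp (c * (1 / sqrt (Suc k))) * exp (ln (\<integral>z. \<psi> z \<partial>gam n) / C))
    \<longlonglongrightarrow> exp (c * 0) * exp (ln (\<integral>z. \<psi> z \<partial>gam n) / C)"
    by (intro tendsto_intros lim0)
  moreover have "\<forall>\<^sub>F k in sequentially. (\<integral>z. ?F z \<partial>gam n)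
     \<le> exp (c * (1 / sqrt (Suc k))) * exp (ln (\<integral>z. \<psi> z \<partial>gam n) / C)"
    using order_tendstoD(2)[OF lim0 c(2)] by eventually_elim (use bound in auto)
  ultimately show ?thesis
    using tendsto_lowerbound by force
qed

end

section \<open>Random words of rotations\<close>

locale kac =
  fixes M N :: nat and lamS lamR mu :: real and \<rho> :: "real \<Rightarrow> real"
  assumes M_pos: "0 < M" and N_pos: "0 < N"
    and lam_pos: "0 < lamS" "0 < lamR" "0 < mu"
    and rho_meas: "\<rho> \<in> borel_measurable lborel"
    and rho_nonneg: "\<forall>\<theta>\<in>{-pi..pi}. 0 \<le> \<rho> \<theta>"
    and rho_int: "set_integrable lborel {-pi..pi} \<rho>"
    and rho_one: "(LINT \<theta>:{-pi..pi}|lborel. \<rho> \<theta>) = 1"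
    and rho_sc: "(LINT \<theta>:{-pi..pi}|lborel. \<rho> \<theta> * sin \<theta> * cos \<theta>) = 0"
begin

abbreviation "n \<equiv> M + N"

definition idx :: "(nat \<times> nat) set" where "idx = {(i, j). i < j \<and> j < n}"

text \<open>As i < j, the tests separate pairs inside the system, pairs inside the reservoir and
  mixed ones. If M = 1 or N = 1, the vanishing denominator belongs to a class without pairs.\<close>

definition wt :: "nat \<times> nat \<Rightarrow> real" where
  "wt = (\<lambda>(i, j). if j < M then lamS / (real M - 1)
     else if M \<le> i then lamR / (real N - 1) else mu / real N)"

text \<open>The total jump rate: the generator is this number times (an average over rotations minus
  the identity), which makes its exponential a Poisson mixture.\<close>

definition rate :: real where "rate = (\<Sum>p\<in>idx. wt p)"

definition rhom :: "real measure" where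
  "rhom = density lborel (\<lambda>\<theta>. ennreal (indicator {-pi..pi} \<theta> * \<rho> \<theta>))"

definition muS :: real where "muS = (LINT \<theta>:{-pi..pi}|lborel. \<rho> \<theta> * (sin \<theta>)\<^sup>2)"

lemma finite_idx: "finite idx"
  by (rule finite_subset[of _ "{..<n} \<times> {..<n}"]) (auto simp: idx_def)

lemma idxD: "p \<in> idx \<Longrightarrow> fst p < n \<and> snd p < n \<and> fst p \<noteq> snd p"
  by (auto simp: idx_def)

lemma wt_nonneg: "p \<in> idx \<Longrightarrow> 0 \<le> wt p"
  using lam_pos by (auto simp: idx_def wt_def)

lemma rate_pos: "0 < rate"
proof -
  \<comment> \<open>A mixed pair always exists, whereas each of the other two classes may be
    empty.\<close>
  have "(0, M) \<in> idx" using M_pos N_pos by (auto simp: idx_def)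
  moreover have "0 < wt (0, M)" using M_pos N_pos lam_pos by (simp add: wt_def)
  ultimately show ?thesis unfolding rate_def
    using finite_idx wt_nonneg by (intro sum_pos2[of idx "(0, M)"]) auto
qed

lemma sets_rhom[measurable_cong, simp]: "sets rhom = sets borel"
  and space_rhom[simp]: "space rhom = UNIV"
  by (simp_all add: rhom_def)

lemma rho_ind_meas: "(\<lambda>\<theta>. indicator {-pi..pi} \<theta> * \<rho> \<theta>) \<in> borel_measurable lborel"
  using rho_meas by measurable

lemma integral_rhom:
  assumes "f \<in> borel_measurable borel"
  shows "(\<integral>\<theta>. f \<theta> \<partial>rhom) = (LINT \<theta>:{-pi..pi}|lborel. \<rho> \<theta> * (f \<theta> :: real))"
  unfolding rhom_def set_lebesgue_integral_def
  by (subst integral_density)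
    (use assms rho_ind_meas rho_nonneg in \<open>auto simp: mult.assoc indicator_def intro!: AE_I2\<close>)

lemma prob_space_rhom: "prob_space rhom"
proof
  have "emeasure rhom (space rhom) = (\<integral>\<^sup>+ \<theta>. ennreal (indicator {-pi..pi} \<theta> * \<rho> \<theta>) \<partial>lborel)"
    unfolding rhom_def using rho_ind_meas by (subst emeasure_density) auto
  also have "\<dots> = ennreal (\<integral>\<theta>. indicator {-pi..pi} \<theta> * \<rho> \<theta> \<partial>lborel)"
    using rho_int rho_nonneg unfolding set_integrable_def
    by (intro nn_integral_eq_integral) (auto simp: indicator_def)
  also have "\<dots> = 1" using rho_one by (simp add: set_lebesgue_integral_def)
  finally show "emeasure rhom (space rhom) = 1" .
qed

sublocale rh: prob_space rhom by (rule prob_space_rhom)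

lemma rhom_bounded:
  fixes f :: "real \<Rightarrow> real"
  assumes "f \<in> borel_measurable borel" "\<And>\<theta>. \<bar>f \<theta>\<bar> \<le> c"
  shows "integrable rhom f"
  by (rule rh.integrable_const_bound[where B=c]) (use assms in \<open>auto simp: measurable_cong_sets[OF sets_rhom refl]\<close>)

lemma rhom_trig:
  "(\<integral>\<theta>. (sin \<theta>)\<^sup>2 \<partial>rhom) = muS" "(\<integral>\<theta>. sin \<theta> * cos \<theta> \<partial>rhom) = 0"
  "(\<integral>\<theta>. (cos \<theta>)\<^sup>2 \<partial>rhom) = 1 - muS"
  "integrable rhom (\<lambda>\<theta>. (sin \<theta>)\<^sup>2)" "integrable rhom (\<lambda>\<theta>. sin \<theta> * cos \<theta>)" "integrable rhom (\<lambda>\<theta>. (cos \<theta>)\<^sup>2)"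
proof -
  show i1: "integrable rhom (\<lambda>\<theta>. (sin \<theta>)\<^sup>2)"
    by (rule rhom_bounded[where c=1]) (auto simp: abs_square_le_1)
  show "integrable rhom (\<lambda>\<theta>. (cos \<theta>)\<^sup>2)"
    by (rule rhom_bounded[where c=1]) (auto simp: abs_square_le_1)
  show "integrable rhom (\<lambda>\<theta>. sin \<theta> * cos \<theta>)"
    by (rule rhom_bounded[where c=1]) (auto simp: abs_mult intro!: mult_le_one)
  show s: "(\<integral>\<theta>. (sin \<theta>)\<^sup>2 \<partial>rhom) = muS" unfolding muS_def by (rule integral_rhom) auto
  show "(\<integral>\<theta>. sin \<theta> * cos \<theta> \<partial>rhom) = 0"
    using rho_sc by (subst integral_rhom) (auto simp: mult.assoc)
  have "(\<integral>\<theta>. (cos \<theta>)\<^sup>2 \<partial>rhom) = (\<integral>\<theta>. 1 - (sin \<theta>)\<^sup>2 \<partial>rhom)" by (simp add: cos_squared_eq)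
  then show "(\<integral>\<theta>. (cos \<theta>)\<^sup>2 \<partial>rhom) = 1 - muS" using i1 s rh.prob_space by simp
qed

text \<open>The angle is reversed because words of steps represent the adjoint of the semigroup.\<close>
definition step :: "(nat \<times> nat) \<times> real \<Rightarrow> (nat \<Rightarrow> real) \<Rightarrow> (nat \<Rightarrow> real)" where
  "step s z = rotinv (fst (fst s)) (snd (fst s)) (- snd s) z"

definition pairm :: "(nat \<times> nat) measure" where
  "pairm = point_measure idx (\<lambda>p. ennreal (wt p / rate))"

definition stepm :: "((nat \<times> nat) \<times> real) measure" where "stepm = pairm \<Otimes>\<^sub>M rhom"

lemma space_pairm[simp]: "space pairm = idx" and sets_pairm[measurable_cong]: "sets pairm = sets (count_space idx)"
  by (simp_all add: pairm_def space_point_measure sets_point_measure)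

lemma space_stepm: "space stepm = idx \<times> UNIV"
  by (simp add: stepm_def space_pair_measure)

lemma wt_rate_nonneg: "p \<in> idx \<Longrightarrow> 0 \<le> wt p / rate"
  using wt_nonneg rate_pos by simp

lemma sum_wt_rate: "(\<Sum>p\<in>idx. wt p / rate) = 1"
  using rate_pos by (simp add: rate_def flip: sum_divide_distrib)

lemma prob_space_pairm: "prob_space pairm"
proof
  have "emeasure pairm (space pairm) = (\<Sum>p\<in>idx. ennreal (wt p / rate))"
    unfolding space_pairm unfolding pairm_def by (rule emeasure_point_measure_finite[OF finite_idx]) simp
  also have "\<dots> = ennreal (\<Sum>p\<in>idx. wt p / rate)" by (rule sum_ennreal) (rule wt_rate_nonneg)
  finally show "emeasure pairm (space pairm) = 1" unfolding sum_wt_rate by simp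
qed

sublocale pm: prob_space pairm by (rule prob_space_pairm)
sublocale pr: pair_prob_space pairm rhom ..

lemma integral_pairm: "(\<integral>p. f p \<partial>pairm) = (\<Sum>p\<in>idx. wt p / rate * (f p :: real))"
  unfolding pairm_def
  by (subst lebesgue_integral_point_measure_finite) (use finite_idx wt_rate_nonneg in auto)

lemma prob_space_stepm: "prob_space stepm"
  unfolding stepm_def by (rule pr.prob_space_axioms)

sublocale sm: prob_space stepm by (rule prob_space_stepm)
sublocale sq: sequence_space stepm ..

abbreviation "seqm \<equiv> PiM (UNIV :: nat set) (\<lambda>_. stepm)"


lemma measurable_step:
  assumes g: "g \<in> measurable A stepm" and h: "h \<in> measurable A (Rn n)"
  shows "(\<lambda>x. step (g x) (h x)) \<in> measurable A (Rn n)"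
proof -
  have g1: "(\<lambda>x. fst (g x)) \<in> measurable A (count_space idx)"
    using measurable_compose[OF g[unfolded stepm_def] measurable_fst]
    by (simp add: measurable_cong_sets[OF refl sets_pairm])
  have g2: "(\<lambda>x. - snd (g x)) \<in> borel_measurable A"
    using measurable_compose[OF g[unfolded stepm_def] measurable_snd]
    by (simp add: measurable_cong_sets[OF refl sets_rhom])
  have "(\<lambda>x. (\<lambda>p x. rotinv (fst p) (snd p) (- snd (g x)) (h x)) (fst (g x)) x) \<in> measurable A (Rn n)"
  proof (rule measurable_compose_countable'[OF _ g1])
    show "(\<lambda>x. rotinv (fst p) (snd p) (- snd (g x)) (h x)) \<in> measurable A (Rn n)" if "p \<in> idx" for p
      by (rule measurable_rotinv_pair) (use idxD[OF that] g2 h in auto)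
    show "countable idx" using finite_idx by (rule countable_finite)
  qed
  then show ?thesis by (simp add: step_def)
qed

text \<open>The first letter acts first and the rest is the word of the shifted sequence, so that
  conditioning an i.i.d. sequence on its first letter reproduces the recursion.\<close>

primrec word :: "nat \<Rightarrow> (nat \<Rightarrow> (nat \<times> nat) \<times> real) \<Rightarrow> (nat \<Rightarrow> real) \<Rightarrow> (nat \<Rightarrow> real)" where
  "word 0 \<omega> z = z"
| "word (Suc k) \<omega> z = word k (\<lambda>i. \<omega> (Suc i)) (step (\<omega> 0) z)"

lemma measurable_word:
  "g \<in> measurable A seqm \<Longrightarrow> h \<in> measurable A (Rn n) \<Longrightarrow> (\<lambda>x. word k (g x) (h x)) \<in> measurable A (Rn n)"
proof (induct k arbitrary: g h)
  case (Suc k)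
  have c: "(\<lambda>x. g x i) \<in> measurable A stepm" for i
    by (rule measurable_compose[OF Suc(2) measurable_component_singleton]) simp
  have s: "(\<lambda>x i. g x (Suc i)) \<in> measurable A seqm"
    by (rule measurable_PiM_single') (use c measurable_space[OF c] in auto)
  show ?case using Suc(1)[OF s measurable_step[OF c Suc(3)]] by simp
qed simp

lemma seqm_space: "\<omega> \<in> space seqm \<Longrightarrow> \<omega> i \<in> idx \<times> UNIV"
  by (auto simp: space_PiM PiE_iff space_stepm)

lemma seqm_shift: "\<omega> \<in> space seqm \<Longrightarrow> (\<lambda>i. \<omega> (Suc i)) \<in> space seqm"
  by (auto simp: space_PiM PiE_iff)

lemma rotinv_vadd:
  assumes "i < n'" "j < n'"
  shows "rotinv i j \<theta> (vadd n' z s w) = vadd n' (rotinv i j \<theta> z) s (rotinv i j \<theta> w)"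
  using assms by (auto simp: rotinv_def vadd_def fun_eq_iff algebra_simps)

lemma rotinv_space: "i < n' \<Longrightarrow> j < n' \<Longrightarrow> z \<in> space (Rn n') \<Longrightarrow> rotinv i j \<theta> z \<in> space (Rn n')"
  using measurable_space[OF measurable_rotinv] by blast

lemma step_props:
  assumes "s \<in> idx \<times> UNIV"
  shows "step s (vadd n z r w) = vadd n (step s z) r (step s w)"
    and "nsq n (step s z) = nsq n z"
    and "distr (gam n) (gam n) (step s) = gam n"
    and "z \<in> space (Rn n) \<Longrightarrow> step s z \<in> space (Rn n)"
    and "step s \<in> measurable (Rn n) (Rn n)"
proof -
  obtain i j \<theta> where s: "s = ((i, j), \<theta>)" "i < n" "j < n" "i \<noteq> j"
    using assms by (auto simp: idx_def)
  have e: "step s = rotinv i j (- \<theta>)" by (auto simp: step_def s fun_eq_iff)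
  show "step s (vadd n z r w) = vadd n (step s z) r (step s w)" unfolding e using s by (intro rotinv_vadd)
  show "nsq n (step s z) = nsq n z" unfolding e using s by (intro nsq_rotinv)
  show "distr (gam n) (gam n) (step s) = gam n" unfolding e using s by (intro distr_rotinv_gam)
  show "z \<in> space (Rn n) \<Longrightarrow> step s z \<in> space (Rn n)" unfolding e using s by (intro rotinv_space)
  show "step s \<in> measurable (Rn n) (Rn n)" unfolding e using s by (intro measurable_rotinv)
qed

lemma word_vadd: "\<omega> \<in> space seqm \<Longrightarrow> word k \<omega> (vadd n z r w) = vadd n (word k \<omega> z) r (word k \<omega> w)"
  by (induct k arbitrary: \<omega> z w) (simp_all add: step_props(1)[OF seqm_space] seqm_shift)

lemma word_nsq: "\<omega> \<in> space seqm \<Longrightarrow> nsq n (word k \<omega> z) = nsq n z"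
  by (induct k arbitrary: \<omega> z) (simp_all add: step_props(2)[OF seqm_space] seqm_shift)

lemma word_space: "\<omega> \<in> space seqm \<Longrightarrow> z \<in> space (Rn n) \<Longrightarrow> word k \<omega> z \<in> space (Rn n)"
  by (induct k arbitrary: \<omega> z) (simp_all add: step_props(4)[OF seqm_space] seqm_shift)

lemma word_meas: "\<omega> \<in> space seqm \<Longrightarrow> word k \<omega> \<in> measurable (Rn n) (Rn n)"
  by (rule measurable_word[where g="\<lambda>_. \<omega>" and h="\<lambda>x. x"]) auto

lemma word_gam: "\<omega> \<in> space seqm \<Longrightarrow> distr (gam n) (gam n) (word k \<omega>) = gam n"
proof (induct k arbitrary: \<omega>)
  case 0
  then show ?case by (simp add: distr_id2)
next
  case (Suc k)
  have w: "word (Suc k) \<omega> = word k (\<lambda>i. \<omega> (Suc i)) \<circ> step (\<omega> 0)" by auto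
  have m1: "word k (\<lambda>i. \<omega> (Suc i)) \<in> measurable (gam n) (gam n)"
    using word_meas[OF seqm_shift[OF Suc(2)]] by (simp add: measurable_gam_Rn measurable_Rn_gam)
  have m2: "step (\<omega> 0) \<in> measurable (gam n) (gam n)"
    using step_props(5)[OF seqm_space[OF Suc(2)]] by (simp add: measurable_gam_Rn measurable_Rn_gam)
  show ?case
    unfolding w distr_distr[OF m1 m2, symmetric] step_props(3)[OF seqm_space[OF Suc(2)]]
    by (rule Suc(1)[OF seqm_shift[OF Suc(2)]])
qed

section \<open>The one-step average and its powers\<close>

definition avg :: "((nat \<Rightarrow> real) \<Rightarrow> real) \<Rightarrow> (nat \<Rightarrow> real) \<Rightarrow> real" where
  "avg F z = (\<integral>s. F (step s z) \<partial>stepm)"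

lemma avg_meas:
  assumes "F \<in> borel_measurable (Rn n)"
  shows "avg F \<in> borel_measurable (Rn n)"
proof -
  have "(\<lambda>x. F (step (snd x) (fst x))) \<in> borel_measurable (Rn n \<Otimes>\<^sub>M stepm)"
    by (rule measurable_compose[OF measurable_step assms]) measurable
  then show ?thesis unfolding avg_def
    by (intro sm.borel_measurable_lebesgue_integral) (simp add: split_beta)
qed

text \<open>The bound may depend on \<open>nsq n z\<close> because steps stay on spheres. This
  admits the unbounded function \<open>nsq M\<close> along with bounded test functions.\<close>

lemma step_int:
  fixes F :: "(nat \<Rightarrow> real) \<Rightarrow> real"
  assumes F: "F \<in> borel_measurable (Rn n)" and b: "\<And>z. z \<in> space (Rn n) \<Longrightarrow> \<bar>F z\<bar> \<le> b (nsq n z)"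
    and z: "z \<in> space (Rn n)"
  shows "integrable stepm (\<lambda>s. F (step s z))"
proof (rule sm.integrable_const_bound[where B="b (nsq n z)"])
  show "(\<lambda>s. F (step s z)) \<in> borel_measurable stepm"
    by (rule measurable_compose[OF measurable_step F]) (use z in auto)
  show "AE s in stepm. norm (F (step s z)) \<le> b (nsq n z)"
    using b step_props(2,4) z by (intro AE_I2) (metis real_norm_def space_stepm)
qed

lemma avg_abs:
  fixes F :: "(nat \<Rightarrow> real) \<Rightarrow> real"
  assumes F: "F \<in> borel_measurable (Rn n)" and b: "\<And>z. z \<in> space (Rn n) \<Longrightarrow> \<bar>F z\<bar> \<le> b (nsq n z)"
    and z: "z \<in> space (Rn n)"
  shows "\<bar>avg F z\<bar> \<le> b (nsq n z)"
proof -
  have "\<bar>avg F z\<bar> \<le> (\<integral>s. \<bar>F (step s z)\<bar> \<partial>stepm)"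
    unfolding avg_def by (rule integral_abs_bound)
  also have "\<dots> \<le> (\<integral>s. b (nsq n z) \<partial>stepm)"
  proof (rule integral_mono)
    show "integrable stepm (\<lambda>s. \<bar>F (step s z)\<bar>)" using step_int[OF assms] by simp
    show "\<bar>F (step s z)\<bar> \<le> b (nsq n z)" if "s \<in> space stepm" for s
      using b step_props(2,4) z that by (metis space_stepm)
  qed simp
  finally show ?thesis by (simp add: sm.prob_space)
qed

lemma avg_pow_meas: "F \<in> borel_measurable (Rn n) \<Longrightarrow> (avg ^^ k) F \<in> borel_measurable (Rn n)"
  by (induct k) (auto intro: avg_meas)

lemma avg_pow_abs:
  fixes F :: "(nat \<Rightarrow> real) \<Rightarrow> real"
  assumes F: "F \<in> borel_measurable (Rn n)" and b: "\<And>z. z \<in> space (Rn n) \<Longrightarrow> \<bar>F z\<bar> \<le> b (nsq n z)"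
  shows "z \<in> space (Rn n) \<Longrightarrow> \<bar>(avg ^^ k) F z\<bar> \<le> b (nsq n z)"
proof (induct k arbitrary: z)
  case (Suc k)
  show ?case using avg_abs[OF avg_pow_meas[OF F] Suc] by simp
qed (use b in auto)

text \<open>The Markov property: the sequence splits into a first letter and an independent tail
  with the law of the whole sequence.\<close>

lemma word_avg:
  fixes F :: "(nat \<Rightarrow> real) \<Rightarrow> real"
  assumes F: "F \<in> borel_measurable (Rn n)" and b: "\<And>z. z \<in> space (Rn n) \<Longrightarrow> \<bar>F z\<bar> \<le> b (nsq n z)"
  shows "z \<in> space (Rn n) \<Longrightarrow> (\<integral>\<omega>. F (word k \<omega> z) \<partial>seqm) = (avg ^^ k) F z"
proof (induct k arbitrary: z)
  case 0
  then show ?case by (simp add: sq.P.prob_space)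
next
  case (Suc k)
  interpret P: pair_prob_space stepm seqm ..
  have cm: "(\<lambda>(s, \<omega>). case_nat s \<omega>) \<in> measurable (stepm \<Otimes>\<^sub>M seqm) seqm" by measurable
  have wm: "(\<lambda>\<omega>. F (word (Suc k) \<omega> z)) \<in> borel_measurable seqm"
    by (rule measurable_compose[OF measurable_word F]) (use Suc in auto)
  have pm: "(\<lambda>p. F (word k (snd p) (step (fst p) z))) \<in> borel_measurable (stepm \<Otimes>\<^sub>M seqm)"
    by (rule measurable_compose[OF measurable_word[OF _ measurable_step] F]) (use Suc in auto)
  have ip: "integrable (stepm \<Otimes>\<^sub>M seqm) (\<lambda>p. F (word k (snd p) (step (fst p) z)))"
  proof (rule P.integrable_const_bound[where B="b (nsq n z)", OF _ pm], rule AE_I2)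
    fix p assume "p \<in> space (stepm \<Otimes>\<^sub>M seqm)"
    then have p: "fst p \<in> idx \<times> UNIV" "snd p \<in> space seqm" by (auto simp: space_pair_measure space_stepm)
    have "nsq n (word k (snd p) (step (fst p) z)) = nsq n z"
      by (simp add: word_nsq[OF p(2)] step_props(2)[OF p(1)])
    then show "norm (F (word k (snd p) (step (fst p) z))) \<le> b (nsq n z)"
      using b[OF word_space[OF p(2) step_props(4)[OF p(1) Suc(2)], of k]] by simp
  qed
  have "(\<integral>\<omega>. F (word (Suc k) \<omega> z) \<partial>seqm)
    = (\<integral>\<omega>. F (word (Suc k) \<omega> z) \<partial>distr (stepm \<Otimes>\<^sub>M seqm) seqm (\<lambda>(s, \<omega>). case_nat s \<omega>))"
    by (subst sq.PiM_iter) simp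
  also have "\<dots> = (\<integral>p. F (word (Suc k) (case p of (s, \<omega>) \<Rightarrow> case_nat s \<omega>) z) \<partial>(stepm \<Otimes>\<^sub>M seqm))"
    by (rule integral_distr[OF cm wm])
  also have "\<dots> = (\<integral>p. F (word k (snd p) (step (fst p) z)) \<partial>(stepm \<Otimes>\<^sub>M seqm))"
    by (intro Bochner_Integration.integral_cong refl) (simp add: split_beta)
  also have "\<dots> = (\<integral>s. (\<integral>\<omega>. F (word k \<omega> (step s z)) \<partial>seqm) \<partial>stepm)"
    by (subst P.integral_fst'[OF ip, symmetric]) simp
  also have "\<dots> = (\<integral>s. (avg ^^ k) F (step s z) \<partial>stepm)"
    by (intro Bochner_Integration.integral_cong refl Suc(1) step_props(4)[OF _ Suc(2)]) (simp add: space_stepm)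
  also have "\<dots> = (avg ^^ Suc k) F z" by (simp add: avg_def)
  finally show ?case .
qed

lemma avg_sum:
  fixes F :: "(nat \<Rightarrow> real) \<Rightarrow> real"
  assumes F: "F \<in> borel_measurable (Rn n)" and b: "\<And>z. z \<in> space (Rn n) \<Longrightarrow> \<bar>F z\<bar> \<le> b (nsq n z)"
    and z: "z \<in> space (Rn n)"
  shows "avg F z = (\<Sum>p\<in>idx. wt p / rate * (\<integral>\<theta>. F (rotinv (fst p) (snd p) (- \<theta>) z) \<partial>rhom))"
proof -
  have i: "integrable (pairm \<Otimes>\<^sub>M rhom) (\<lambda>s. F (step s z))"
    using step_int[OF assms] by (simp add: stepm_def)
  have "avg F z = (\<integral>p. (\<integral>\<theta>. F (step (p, \<theta>) z) \<partial>rhom) \<partial>pairm)"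
    unfolding avg_def stepm_def by (rule pr.integral_fst'[OF i, symmetric])
  then show ?thesis by (simp add: integral_pairm step_def)
qed

end

section \<open>Energy exchange between system and reservoir\<close>

context kac begin

text \<open>This is \<open>N |v|\<^sup>2 - M |w|\<^sup>2\<close>, an eigenfunction of one averaged step.\<close>
definition Yf :: "(nat \<Rightarrow> real) \<Rightarrow> real" where
  "Yf z = (real N + real M) * nsq M z - real M * nsq n z"

lemma nsq_M_le: "nsq M z \<le> nsq n z"
  unfolding nsq_def by (intro sum_mono2) auto

lemma nsq_split: "nsq n z = nsq M z + (\<Sum>j\<in>{M..<n}. (z j)\<^sup>2)"
proof -
  have "{..<n} = {..<M} \<union> {M..<n}" by auto
  then show ?thesis unfolding nsq_def by (simp add: sum.union_disjoint ivl_disj_int_one(2))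
qed

lemma nsq_M_meas: "nsq M \<in> borel_measurable (Rn n)"
  unfolding nsq_def by (intro borel_measurable_sum borel_measurable_power measurable_component_Rn) auto

text \<open>A rotation inside the system or inside the reservoir leaves the system energy alone. A
  mixed one turns z_i^2 into cos^2 z_i^2 + sin^2 z_j^2 plus a cross term, which averages to zero
  because \<open>\<rho>\<close> is orthogonal to sin cos.\<close>

lemma nsq_M_rot:
  assumes p: "(i, j) \<in> idx"
  shows "(\<integral>\<theta>. nsq M (rotinv i j (- \<theta>) z) \<partial>rhom)
    = nsq M z + (if i < M \<and> M \<le> j then muS * ((z j)\<^sup>2 - (z i)\<^sup>2) else 0)"
proof -
  have ij: "i < j" "j < n" using p by (auto simp: idx_def)
  consider "j < M" | "M \<le> i" | "i < M" "M \<le> j" by linarith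
  then show ?thesis
  proof cases
    case 1
    then have "nsq M (rotinv i j (- \<theta>) z) = nsq M z" for \<theta> using ij by (intro nsq_rotinv) auto
    then show ?thesis using 1 by (simp add: rh.prob_space[simplified])
  next
    case 2
    have "nsq M (rotinv i j (- \<theta>) z) = nsq M z" for \<theta>
      unfolding nsq_def by (intro sum.cong refl) (use 2 ij in \<open>auto simp: rotinv_def\<close>)
    then show ?thesis using 2 by (simp add: rh.prob_space[simplified])
  next
    case 3
    have e: "nsq M (rotinv i j (- \<theta>) z)
      = nsq M z - (z i)\<^sup>2 + ((z i)\<^sup>2 * (cos \<theta>)\<^sup>2 + (z j)\<^sup>2 * (sin \<theta>)\<^sup>2 + 2 * (z i * z j) * (sin \<theta> * cos \<theta>))" for \<theta>
    proof -
      have "nsq M (rotinv i j (- \<theta>) z) = (z i * cos \<theta> + z j * sin \<theta>)\<^sup>2 + (\<Sum>k\<in>{..<M}-{i}. (z k)\<^sup>2)"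
        unfolding nsq_def using 3
        by (subst sum.remove[of _ i]) (auto simp: rotinv_def intro!: sum.cong)
      moreover have "nsq M z = (z i)\<^sup>2 + (\<Sum>k\<in>{..<M}-{i}. (z k)\<^sup>2)"
        unfolding nsq_def using 3 by (subst sum.remove[of _ i]) auto
      ultimately show ?thesis by (simp add: power2_eq_square algebra_simps)
    qed
    have "(\<integral>\<theta>. nsq M (rotinv i j (- \<theta>) z) \<partial>rhom)
      = nsq M z - (z i)\<^sup>2 + ((z i)\<^sup>2 * (1 - muS) + (z j)\<^sup>2 * muS + 2 * (z i * z j) * 0)"
      unfolding e using rhom_trig by (simp add: rh.prob_space[simplified])
    then show ?thesis using 3 by (simp add: algebra_simps)
  qed
qed

text \<open>Only mixed pairs contribute; summing z_j^2 - z_i^2 over all of them gives M |w|^2 - N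
  |v|^2, which is minus \<open>Yf\<close>.\<close>

lemma avg_nsq_M:
  assumes z: "z \<in> space (Rn n)"
  shows "avg (nsq M) z = nsq M z - mu * muS / (real N * rate) * Yf z"
proof -
  let ?d = "\<lambda>p. if fst p < M \<and> M \<le> snd p then muS * ((z (snd p))\<^sup>2 - (z (fst p))\<^sup>2) else 0"
  have "avg (nsq M) z = (\<Sum>p\<in>idx. wt p / rate * (\<integral>\<theta>. nsq M (rotinv (fst p) (snd p) (- \<theta>) z) \<partial>rhom))"
    by (rule avg_sum[OF nsq_M_meas _ z, of "\<lambda>x. x"]) (simp add: nsq_M_le)
  also have "\<dots> = (\<Sum>p\<in>idx. wt p / rate * nsq M z + wt p / rate * ?d p)"
    by (intro sum.cong refl) (auto simp: nsq_M_rot distrib_left)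
  also have "\<dots> = nsq M z + (\<Sum>p\<in>idx. wt p / rate * ?d p)"
    unfolding sum.distrib sum_distrib_right[symmetric] sum_wt_rate by simp
  also have "(\<Sum>p\<in>idx. wt p / rate * ?d p)
    = (\<Sum>p\<in>{..<M} \<times> {M..<n}. mu / real N / rate * (muS * ((z (snd p))\<^sup>2 - (z (fst p))\<^sup>2)))"
    by (rule sum.mono_neutral_cong_right[OF finite_idx]) (auto simp: idx_def wt_def)
  also have "\<dots> = (\<Sum>i<M. \<Sum>j\<in>{M..<n}. mu / real N / rate * (muS * ((z j)\<^sup>2 - (z i)\<^sup>2)))"
    by (simp add: sum.cartesian_product split_beta)
  also have "\<dots> = mu / real N / rate * muS * (\<Sum>i<M. \<Sum>j\<in>{M..<n}. ((z j)\<^sup>2 - (z i)\<^sup>2))"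
    by (simp add: sum_distrib_left mult.assoc)
  also have "(\<Sum>i<M. \<Sum>j\<in>{M..<n}. ((z j)\<^sup>2 - (z i)\<^sup>2)) = real M * (nsq n z - nsq M z) - real N * nsq M z"
    unfolding nsq_split unfolding nsq_def[of M]
    by (simp add: sum_subtractf sum_distrib_left[symmetric])
  also have "\<dots> = - Yf z" by (simp add: Yf_def algebra_simps)
  finally show ?thesis by simp
qed

text \<open>The eigenvalue of \<open>avg\<close> on \<open>Yf\<close>. Since \<open>nsq n\<close> is
  invariant and (N + M) \<open>nsq M\<close> = M \<open>nsq n\<close> + \<open>Yf\<close>, the
  powers of \<open>avg\<close> on \<open>nsq M\<close> become explicit.\<close>

definition contr_factor :: real where
  "contr_factor = 1 - (real N + real M) * mu * muS / (real N * rate)"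

lemma avg_pow_nsq_M:
  "z \<in> space (Rn n) \<Longrightarrow> (avg ^^ k) (nsq M) z = (real M * nsq n z + contr_factor ^ k * Yf z) / (real N + real M)"
proof (induct k arbitrary: z)
  case 0
  have "real N + real M \<noteq> 0" using M_pos by simp
  then show ?case by (simp add: Yf_def field_simps)
next
  case (Suc k)
  let ?c = "real N + real M"
  have c: "?c \<noteq> 0" using M_pos by simp
  have i: "integrable stepm (\<lambda>s. nsq M (step s z))"
    by (rule step_int[OF nsq_M_meas _ Suc(2), of "\<lambda>x. x"]) (simp add: nsq_M_le)
  have "(avg ^^ Suc k) (nsq M) z = (\<integral>s. (avg ^^ k) (nsq M) (step s z) \<partial>stepm)" by (simp add: avg_def)
  also have "\<dots> = (\<integral>s. (real M * nsq n z + contr_factor ^ k * (?c * nsq M (step s z) - real M * nsq n z)) / ?c \<partial>stepm)"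
    by (intro Bochner_Integration.integral_cong refl)
      (simp add: Suc(1)[OF step_props(4)[OF _ Suc(2)]] space_stepm Yf_def step_props(2))
  also have "\<dots> = (real M * nsq n z + contr_factor ^ k * (?c * avg (nsq M) z - real M * nsq n z)) / ?c"
    unfolding avg_def using i by (simp add: sm.prob_space)
  also have "?c * avg (nsq M) z - real M * nsq n z = contr_factor * Yf z"
  proof -
    define \<kappa> where "\<kappa> = mu * muS / (real N * rate)"
    have "contr_factor = 1 - ?c * \<kappa>" by (simp add: contr_factor_def \<kappa>_def)
    moreover have "?c * nsq M z - real M * nsq n z = Yf z" by (simp add: Yf_def)
    ultimately show ?thesis unfolding avg_nsq_M[OF Suc(2)] \<kappa>_def[symmetric]
      by (simp add: right_diff_distrib left_diff_distrib)
  qed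
  finally show ?case by simp
qed

section \<open>Poisson number of rotations\<close>

definition pois :: "real \<Rightarrow> nat measure" where
  "pois r = density (count_space UNIV) (\<lambda>k. ennreal (exp (- r) * (r ^ k / fact k)))"

text \<open>The generating function of the Poisson law: x = 1 gives the total mass, x =
  \<open>contr_factor\<close> the exponential decay in \<open>CC\<close>.\<close>

lemma pois_sums: "(\<lambda>k. exp (- r) * (r ^ k / fact k) * x ^ k) sums exp (r * x - r)"
  for r x :: real
proof -
  have "(\<lambda>k. (r * x) ^ k /\<^sub>R fact k) sums exp (r * x)" by (rule exp_converges)
  then have "(\<lambda>k. exp (- r) * ((r * x) ^ k /\<^sub>R fact k)) sums (exp (- r) * exp (r * x))" by (rule sums_mult)
  then show ?thesis by (simp add: power_mult_distrib divide_inverse mult_ac exp_diff exp_minus)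
qed

lemma prob_space_pois: assumes "0 \<le> r" shows "prob_space (pois r)"
proof
  have "emeasure (pois r) (space (pois r)) = (\<integral>\<^sup>+ k. ennreal (exp (- r) * (r ^ k / fact k)) \<partial>count_space UNIV)"
    unfolding pois_def by (subst emeasure_density) auto
  also have "\<dots> = (\<Sum>k. ennreal (exp (- r) * (r ^ k / fact k)))" by (rule nn_integral_count_space_nat)
  also have "\<dots> = ennreal 1"
    by (rule suminf_ennreal_eq) (use assms pois_sums[of r 1] in auto)
  finally show "emeasure (pois r) (space (pois r)) = 1" by simp
qed

lemma pois_integral:
  assumes r: "0 \<le> r" and a: "\<And>k. \<bar>a k\<bar> \<le> c"
  shows "(\<lambda>k. exp (- r) * (r ^ k / fact k) * a k) sums (\<integral>k. a k \<partial>pois r)"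
proof -
  have "summable (\<lambda>k. norm (exp (- r) * (r ^ k / fact k) * a k))"
  proof (rule summable_comparison_test')
    show "summable (\<lambda>k. exp (- r) * (r ^ k / fact k) * c)"
      using summable_mult2[OF sums_summable[OF pois_sums[of r 1]]] by simp
    show "norm (norm (exp (- r) * (r ^ k / fact k) * a k)) \<le> exp (- r) * (r ^ k / fact k) * c" if "0 \<le> k" for k
      using a[of k] r by (auto simp: abs_mult intro!: mult_left_mono divide_right_mono)
  qed
  then have "integrable (count_space UNIV) (\<lambda>k. exp (- r) * (r ^ k / fact k) * a k)"
    by (simp add: integrable_count_space_nat_iff)
  then have "(\<lambda>k. exp (- r) * (r ^ k / fact k) * a k) sums
    (\<integral>k. exp (- r) * (r ^ k / fact k) * a k \<partial>count_space UNIV)"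
    by (rule sums_integral_count_space_nat)
  also have "(\<integral>k. exp (- r) * (r ^ k / fact k) * a k \<partial>count_space UNIV) = (\<integral>k. a k \<partial>pois r)"
    unfolding pois_def using r by (subst integral_density) auto
  finally show ?thesis .
qed

text \<open>A number of letters together with an infinite sequence of them, of which
  \<open>RR\<close> applies only the first ones; thus one product space serves words of all
  lengths.\<close>

definition Om :: "real \<Rightarrow> (nat \<times> (nat \<Rightarrow> (nat \<times> nat) \<times> real)) measure" where
  "Om t = pois (rate * t) \<Otimes>\<^sub>M seqm"

definition RR :: "nat \<times> (nat \<Rightarrow> (nat \<times> nat) \<times> real) \<Rightarrow> (nat \<Rightarrow> real) \<Rightarrow> (nat \<Rightarrow> real)" where
  "RR \<omega> = word (fst \<omega>) (snd \<omega>)"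

definition CC :: "real \<Rightarrow> real" where
  "CC t = real M / real (N + M) + real N / real (N + M) * exp (- t * (mu * muS) * real (N + M) / real N)"

lemma space_Om: "space (Om t) = UNIV \<times> space seqm"
  by (simp add: Om_def space_pair_measure pois_def)

lemma sets_pois[measurable_cong]: "sets (pois r) = sets (count_space UNIV)"
  by (simp add: pois_def)

lemma measurable_RR:
  assumes g: "g \<in> measurable A (Om t)" and h: "h \<in> measurable A (Rn n)"
  shows "(\<lambda>x. RR (g x) (h x)) \<in> measurable A (Rn n)"
proof -
  have g1: "(\<lambda>x. fst (g x)) \<in> measurable A (count_space UNIV)"
    using measurable_compose[OF g[unfolded Om_def] measurable_fst]
    by (simp add: measurable_cong_sets[OF refl sets_pois])
  have g2: "(\<lambda>x. snd (g x)) \<in> measurable A seqm"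
    using measurable_compose[OF g[unfolded Om_def] measurable_snd] .
  have "(\<lambda>x. (\<lambda>k x. word k (snd (g x)) (h x)) (fst (g x)) x) \<in> measurable A (Rn n)"
    by (rule measurable_compose_countable'[OF _ g1]) (auto intro: measurable_word[OF g2 h])
  then show ?thesis by (simp add: RR_def)
qed

lemma prob_space_Om: assumes "0 \<le> t" shows "prob_space (Om t)"
proof -
  interpret p: prob_space "pois (rate * t)" by (rule prob_space_pois) (use assms rate_pos in simp)
  interpret P: pair_prob_space "pois (rate * t)" seqm ..
  show ?thesis unfolding Om_def by (rule P.prob_space_axioms)
qed

text \<open>Conditioning on the number of letters: the inner mean over words is a power of
  \<open>avg\<close>, the outer one a Poisson sum.\<close>

lemma Om_integral:
  fixes F :: "(nat \<Rightarrow> real) \<Rightarrow> real"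
  assumes t: "0 \<le> t"
    and F: "F \<in> borel_measurable (Rn n)" and b: "\<And>z. z \<in> space (Rn n) \<Longrightarrow> \<bar>F z\<bar> \<le> b (nsq n z)"
    and z: "z \<in> space (Rn n)"
  shows "(\<lambda>k. exp (- (rate * t)) * ((rate * t) ^ k / fact k) * (avg ^^ k) F z) sums (\<integral>\<omega>. F (RR \<omega> z) \<partial>Om t)"
proof -
  have r: "0 \<le> rate * t" using t rate_pos by simp
  interpret p: prob_space "pois (rate * t)" by (rule prob_space_pois[OF r])
  interpret P: pair_prob_space "pois (rate * t)" seqm ..
  have m: "(\<lambda>\<omega>. F (RR \<omega> z)) \<in> borel_measurable (pois (rate * t) \<Otimes>\<^sub>M seqm)"
    unfolding Om_def[symmetric]
    by (rule measurable_compose[OF measurable_RR[where t=t] F]) (use z in auto)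
  have i: "integrable (pois (rate * t) \<Otimes>\<^sub>M seqm) (\<lambda>\<omega>. F (RR \<omega> z))"
  proof (rule P.integrable_const_bound[where B="b (nsq n z)", OF _ m], rule AE_I2)
    fix \<omega> assume "\<omega> \<in> space (pois (rate * t) \<Otimes>\<^sub>M seqm)"
    then have w: "snd \<omega> \<in> space seqm" by (auto simp: space_pair_measure)
    show "norm (F (RR \<omega> z)) \<le> b (nsq n z)"
      using b[OF word_space[OF w z], of "fst \<omega>"] word_nsq[OF w, of "fst \<omega>" z] by (simp add: RR_def)
  qed
  have "(\<integral>\<omega>. F (RR \<omega> z) \<partial>Om t) = (\<integral>k. (\<integral>\<omega>. F (word k \<omega> z) \<partial>seqm) \<partial>pois (rate * t))"
    unfolding Om_def by (subst P.integral_fst'[OF i, symmetric]) (simp add: RR_def)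
  also have "\<dots> = (\<integral>k. (avg ^^ k) F z \<partial>pois (rate * t))"
    by (simp add: word_avg[OF F b z])
  finally show ?thesis
    using pois_integral[OF r avg_pow_abs[OF F b z]] by simp
qed

lemma CC_pos: "0 < CC t"
  unfolding CC_def using M_pos by (intro add_pos_nonneg) auto

lemma rand_iso_Om: assumes t: "0 \<le> t" shows "rand_iso (Om t) RR n M (CC t)"
proof -
  interpret o: prob_space "Om t" by (rule prob_space_Om[OF t])
  show ?thesis
  proof (unfold_locales)
    have "(\<lambda>x. RR (fst x) (snd x)) \<in> measurable (Om t \<Otimes>\<^sub>M Rn n) (Rn n)"
      by (rule measurable_RR) measurable
    then show "(\<lambda>(\<omega>, z). RR \<omega> z) \<in> measurable (Om t \<Otimes>\<^sub>M Rn n) (Rn n)" by (simp add: split_beta)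
    show "0 < CC t" by (rule CC_pos)
    fix \<omega> assume "\<omega> \<in> space (Om t)"
    then have w: "snd \<omega> \<in> space seqm" by (auto simp: space_Om)
    show "RR \<omega> (vadd n z s w) = vadd n (RR \<omega> z) s (RR \<omega> w)" for z s w
      unfolding RR_def by (rule word_vadd[OF w])
    show "nsq n (RR \<omega> z) = nsq n z" for z unfolding RR_def by (rule word_nsq[OF w])
    show "distr (gam n) (gam n) (RR \<omega>) = gam n" unfolding RR_def by (rule word_gam[OF w])
  next
    fix e assume e: "e \<in> space (Rn n)"
    let ?c = "real N + real M" and ?r = "rate * t"
    have c: "0 < ?c" using M_pos by simp
    have "(\<lambda>k. exp (- ?r) * (?r ^ k / fact k) * ((real M * nsq n e + contr_factor ^ k * Yf e) / ?c))
       sums (\<integral>\<omega>. nsq M (RR \<omega> e) \<partial>Om t)"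
      using Om_integral[OF t nsq_M_meas _ e, of "\<lambda>x. x"] nsq_M_le by (simp add: avg_pow_nsq_M[OF e])
    \<comment> \<open>The invariant part and the eigenfunction part are summed separately, with the
      generating function taken at 1 and at \<open>contr_factor\<close>.\<close>
    moreover have "(\<lambda>k. exp (- ?r) * (?r ^ k / fact k) * ((real M * nsq n e + contr_factor ^ k * Yf e) / ?c))
       sums (exp (?r * 1 - ?r) * (real M * nsq n e / ?c) + exp (?r * contr_factor - ?r) * (Yf e / ?c))"
      using sums_add[OF sums_mult2[OF pois_sums[of ?r 1], of "real M * nsq n e / ?c"]
        sums_mult2[OF pois_sums[of ?r contr_factor], of "Yf e / ?c"]]
      by (rule sums_cong[THEN iffD1, rotated]) (simp add: add_divide_distrib algebra_simps)
    ultimately have "(\<integral>\<omega>. nsq M (RR \<omega> e) \<partial>Om t)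
       = real M * nsq n e / ?c + exp (?r * contr_factor - ?r) * (Yf e / ?c)"
      using sums_unique2 by fastforce
    also have "?r * contr_factor - ?r = - t * (mu * muS) * real (N + M) / real N"
      using rate_pos N_pos unfolding contr_factor_def by (simp add: field_simps)
    \<comment> \<open>For a given norm \<open>Yf\<close> is largest when \<open>e\<close> lies in
      the system coordinates. There it equals N \<open>nsq n e\<close>, and the two parts add up to
      \<open>CC t\<close>.\<close>
    also have "exp (- t * (mu * muS) * real (N + M) / real N) * (Yf e / ?c)
      \<le> exp (- t * (mu * muS) * real (N + M) / real N) * (real N * nsq n e / ?c)"
    proof (intro mult_left_mono divide_right_mono)
      have "?c * nsq M e \<le> ?c * nsq n e" using nsq_M_le c by (intro mult_left_mono) auto
      then show "Yf e \<le> real N * nsq n e" unfolding Yf_def by (simp add: algebra_simps)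
    qed (use c in auto)
    finally show "(\<integral>\<omega>. nsq M (RR \<omega> e) \<partial>Om t) \<le> CC t * nsq n e"
      unfolding CC_def by (simp add: algebra_simps)
  qed
qed

end

section \<open>Duality with the generator\<close>

context kac begin

lemma gen_eq:
  "gen M N lamS lamR mu \<rho> F z = (\<Sum>p\<in>idx. wt p * (Rop \<rho> (fst p) (snd p) F z - F z))"
proof -
  let ?f = "\<lambda>p. Rop \<rho> (fst p) (snd p) F z - F z"
  let ?A = "Sigma {..<M} (\<lambda>i. {i<..<M})" and ?B = "Sigma {M..<n} (\<lambda>i. {i<..<n})"
    and ?C = "{..<M} \<times> {M..<n}"
  have idx: "idx = ?A \<union> (?B \<union> ?C)" by (auto simp: idx_def)
  have "(\<Sum>p\<in>idx. wt p * ?f p) = (\<Sum>p\<in>?A. wt p * ?f p) + ((\<Sum>p\<in>?B. wt p * ?f p) + (\<Sum>p\<in>?C. wt p * ?f p))"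
    unfolding idx by (subst sum.union_disjoint, simp, simp, force)
      (subst sum.union_disjoint, simp, simp, auto)
  also have "(\<Sum>p\<in>?A. wt p * ?f p) = lamS / (real M - 1) * (\<Sum>p\<in>?A. ?f p)"
    unfolding sum_distrib_left by (intro sum.cong refl) (auto simp: wt_def)
  also have "(\<Sum>p\<in>?A. ?f p) = (\<Sum>i<M. \<Sum>j\<in>{i<..<M}. Rop \<rho> i j F z - F z)"
    by (subst sum.Sigma) (auto simp: split_beta)
  also have "(\<Sum>p\<in>?B. wt p * ?f p) = lamR / (real N - 1) * (\<Sum>p\<in>?B. ?f p)"
    unfolding sum_distrib_left by (intro sum.cong refl) (auto simp: wt_def)
  also have "(\<Sum>p\<in>?B. ?f p) = (\<Sum>i\<in>{M..<n}. \<Sum>j\<in>{i<..<n}. Rop \<rho> i j F z - F z)"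
    by (subst sum.Sigma) (auto simp: split_beta)
  also have "(\<Sum>p\<in>?C. wt p * ?f p) = mu / real N * (\<Sum>p\<in>?C. ?f p)"
    unfolding sum_distrib_left by (intro sum.cong refl) (auto simp: wt_def)
  also have "(\<Sum>p\<in>?C. ?f p) = (\<Sum>i<M. \<Sum>j\<in>{M..<n}. Rop \<rho> i j F z - F z)"
    by (subst sum.cartesian_product) (auto simp: split_beta)
  finally show ?thesis unfolding gen_def by simp
qed

lemma Rop_eq:
  assumes "F \<in> borel_measurable (Rn n)" "z \<in> space (Rn n)" "i < n" "j < n"
  shows "Rop \<rho> i j F z = (\<integral>\<theta>. F (rotinv i j \<theta> z) \<partial>rhom)"
proof -
  have "(\<lambda>\<theta>. F (rotinv i j \<theta> z)) \<in> borel_measurable borel"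
    by (rule measurable_compose[OF measurable_rotinv_pair assms(1)]) (use assms in auto)
  then show ?thesis unfolding Rop_def by (rule integral_rhom[symmetric])
qed

lemma rot_pair_measurable:
  assumes "F \<in> borel_measurable (Rn n)" "i < n" "j < n"
  shows "(\<lambda>x. F (rotinv i j (c * snd x) (fst x))) \<in> borel_measurable (Rn n \<Otimes>\<^sub>M rhom)"
proof (rule measurable_compose[OF measurable_rotinv_pair[OF assms(2,3)] assms(1)])
  have "snd \<in> borel_measurable (Rn n \<Otimes>\<^sub>M rhom)"
    using measurable_snd[of "Rn n" rhom] by (simp add: measurable_cong_sets[OF refl sets_rhom])
  then show "(\<lambda>x. c * snd x) \<in> borel_measurable (Rn n \<Otimes>\<^sub>M rhom)" by simp
qed simp

lemma pair_sf: "pair_sigma_finite (Rn n) rhom"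
  by (simp add: pair_sigma_finite_def Rn.sigma_finite_measure_axioms rh.sigma_finite_measure_axioms)

text \<open>Each rotation preserves the L^1 norm and the angle has total probability one, so Tonelli
  bounds the joint integral by the norm of \<open>F\<close>. This licenses the exchanges of
  integrals in \<open>Rop_dual\<close>.\<close>

lemma rot_integrable:
  fixes F :: "(nat \<Rightarrow> real) \<Rightarrow> real"
  assumes F: "integrable (Rn n) F" and ij: "i < n" "j < n" "i \<noteq> j"
  shows "integrable (Rn n \<Otimes>\<^sub>M rhom) (\<lambda>x. F (rotinv i j (snd x) (fst x)))"
proof (rule integrableI_bounded)
  interpret P: pair_sigma_finite "Rn n" rhom by (rule pair_sf)
  have Fm: "F \<in> borel_measurable (Rn n)" using F by simp
  note m = rot_pair_measurable[OF Fm ij(1,2), of 1, simplified]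
  show "(\<lambda>x. F (rotinv i j (snd x) (fst x))) \<in> borel_measurable (Rn n \<Otimes>\<^sub>M rhom)" by (rule m)
  have "(\<integral>\<^sup>+ x. norm (F (rotinv i j (snd x) (fst x))) \<partial>(Rn n \<Otimes>\<^sub>M rhom))
    = (\<integral>\<^sup>+ \<theta>. (\<integral>\<^sup>+ z. norm (F (rotinv i j \<theta> z)) \<partial>Rn n) \<partial>rhom)"
    by (subst P.nn_integral_snd[symmetric]) (use m in auto)
  also have "\<dots> = (\<integral>\<^sup>+ \<theta>. (\<integral>\<^sup>+ z. norm (F z) \<partial>Rn n) \<partial>rhom)"
    by (intro nn_integral_cong rotinv_preserves[OF ij]) (use Fm in measurable)
  also have "\<dots> = (\<integral>\<^sup>+ z. norm (F z) \<partial>Rn n)"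
    using rh.emeasure_space_1 by simp
  also have "\<dots> < \<infinity>" using F by (simp add: integrable_iff_bounded)
  finally show "(\<integral>\<^sup>+ x. norm (F (rotinv i j (snd x) (fst x))) \<partial>(Rn n \<Otimes>\<^sub>M rhom)) < \<infinity>" .
qed

lemma integrable_bounded_mult:
  fixes F \<Phi> :: "'a \<Rightarrow> real"
  assumes F: "integrable A F" and P: "\<Phi> \<in> borel_measurable A" "\<And>z. z \<in> space A \<Longrightarrow> \<bar>\<Phi> z\<bar> \<le> c"
  shows "integrable A (\<lambda>z. \<Phi> z * F z)"
proof (rule Bochner_Integration.integrable_bound[where f="\<lambda>z. c * F z"])
  show "integrable A (\<lambda>z. c * F z)" using F by simp
  show "(\<lambda>z. \<Phi> z * F z) \<in> borel_measurable A" using F P by auto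
  show "AE z in A. norm (\<Phi> z * F z) \<le> norm (c * F z)"
  proof (rule AE_I2)
    fix z assume "z \<in> space A"
    then have "\<bar>\<Phi> z\<bar> \<le> \<bar>c\<bar>" using P(2)[of z] by linarith
    then show "norm (\<Phi> z * F z) \<le> norm (c * F z)" by (simp add: abs_mult mult_right_mono)
  qed
qed

text \<open>For a fixed angle, the change of variables by the rotation, which preserves Lebesgue
  measure, moves it from \<open>F\<close> to \<open>\<Phi>\<close> as its inverse; Fubini restores
  the average over the angle.\<close>

lemma Rop_dual:
  fixes F \<Phi> :: "(nat \<Rightarrow> real) \<Rightarrow> real"
  assumes F: "integrable (Rn n) F" and P: "\<Phi> \<in> borel_measurable (Rn n)"
    and b: "\<And>z. z \<in> space (Rn n) \<Longrightarrow> \<bar>\<Phi> z\<bar> \<le> c" and ij: "i < n" "j < n" "i \<noteq> j"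
  shows "integrable (Rn n) (Rop \<rho> i j F)"
    and "(\<integral>z. \<Phi> z * Rop \<rho> i j F z \<partial>Rn n) = (\<integral>z. (\<integral>\<theta>. \<Phi> (rotinv i j (- \<theta>) z) \<partial>rhom) * F z \<partial>Rn n)"
    and "integrable (Rn n) (\<lambda>z. (\<integral>\<theta>. \<Phi> (rotinv i j (- \<theta>) z) \<partial>rhom) * F z)"
proof -
  interpret Q: pair_sigma_finite "Rn n" rhom by (rule pair_sf)
  have Fm: "F \<in> borel_measurable (Rn n)" using F by simp
  note i1 = rot_integrable[OF F ij]
  have R: "z \<in> space (Rn n) \<Longrightarrow> Rop \<rho> i j F z = (\<integral>\<theta>. F (rotinv i j \<theta> z) \<partial>rhom)" for z
    by (rule Rop_eq[OF Fm _ ij(1,2)])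
  show "integrable (Rn n) (Rop \<rho> i j F)"
    by (subst Bochner_Integration.integrable_cong[OF refl R]) (use Q.integrable_fst'[OF i1] in auto)
  have i2: "integrable (Rn n \<Otimes>\<^sub>M rhom) (\<lambda>x. \<Phi> (fst x) * F (rotinv i j (snd x) (fst x)))"
    by (rule integrable_bounded_mult[OF i1, where c=c]) (use P b in \<open>auto simp: space_pair_measure\<close>)
  have i3a: "integrable (Rn n \<Otimes>\<^sub>M rhom) (\<lambda>x. F (fst x))"
  proof (rule integrableI_bounded)
    show "(\<lambda>x. F (fst x)) \<in> borel_measurable (Rn n \<Otimes>\<^sub>M rhom)" using Fm by measurable
    have "(\<integral>\<^sup>+ x. norm (F (fst x)) \<partial>(Rn n \<Otimes>\<^sub>M rhom)) = (\<integral>\<^sup>+ z. (\<integral>\<^sup>+ \<theta>. norm (F z) \<partial>rhom) \<partial>Rn n)"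
      by (subst rh.nn_integral_fst[symmetric]) (use Fm in auto)
    also have "\<dots> = (\<integral>\<^sup>+ z. norm (F z) \<partial>Rn n)" using rh.emeasure_space_1 by simp
    also have "\<dots> < \<infinity>" using F by (simp add: integrable_iff_bounded)
    finally show "(\<integral>\<^sup>+ x. norm (F (fst x)) \<partial>(Rn n \<Otimes>\<^sub>M rhom)) < \<infinity>" .
  qed
  have i3: "integrable (Rn n \<Otimes>\<^sub>M rhom) (\<lambda>x. \<Phi> (rotinv i j (- snd x) (fst x)) * F (fst x))"
    by (rule integrable_bounded_mult[OF i3a, where c=c])
      (use rot_pair_measurable[OF P ij(1,2), of "-1"] b rotinv_space[OF ij(1,2)] in \<open>auto simp: space_pair_measure\<close>)
  have inner: "(\<integral>z. \<Phi> z * F (rotinv i j \<theta> z) \<partial>Rn n) = (\<integral>z. \<Phi> (rotinv i j (- \<theta>) z) * F z \<partial>Rn n)" for \<theta>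
  proof -
    have m: "rotinv i j \<theta> \<in> measurable (Rn n) (Rn n)" by (rule measurable_rotinv[OF ij(1,2)])
    have gm: "(\<lambda>z. \<Phi> (rotinv i j (- \<theta>) z) * F z) \<in> borel_measurable (Rn n)"
      by (rule borel_measurable_times[OF measurable_compose[OF measurable_rotinv[OF ij(1,2)] P] Fm])
    have "(\<integral>z. \<Phi> (rotinv i j (- \<theta>) z) * F z \<partial>Rn n)
      = (\<integral>z. \<Phi> (rotinv i j (- \<theta>) z) * F z \<partial>distr (Rn n) (Rn n) (rotinv i j \<theta>))"
      by (simp only: distr_rotinv_Rn[OF ij])
    also have "\<dots> = (\<integral>z. \<Phi> (rotinv i j (- \<theta>) (rotinv i j \<theta> z)) * F (rotinv i j \<theta> z) \<partial>Rn n)"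
      by (rule integral_distr[OF m gm])
    also have "(\<lambda>z. \<Phi> (rotinv i j (- \<theta>) (rotinv i j \<theta> z)) * F (rotinv i j \<theta> z)) = (\<lambda>z. \<Phi> z * F (rotinv i j \<theta> z))"
      using ij by (simp add: rotinv_add) (simp add: rotinv_def)
    finally show ?thesis by simp
  qed
  have "(\<integral>z. \<Phi> z * Rop \<rho> i j F z \<partial>Rn n) = (\<integral>z. (\<integral>\<theta>. \<Phi> z * F (rotinv i j \<theta> z) \<partial>rhom) \<partial>Rn n)"
    by (rule Bochner_Integration.integral_cong[OF refl]) (simp add: R)
  also have "\<dots> = (\<integral>\<theta>. (\<integral>z. \<Phi> z * F (rotinv i j \<theta> z) \<partial>Rn n) \<partial>rhom)"
    by (rule Q.Fubini_integral[symmetric]) (unfold split_beta, rule i2)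
  also have "\<dots> = (\<integral>\<theta>. (\<integral>z. \<Phi> (rotinv i j (- \<theta>) z) * F z \<partial>Rn n) \<partial>rhom)"
    by (simp only: inner)
  also have "\<dots> = (\<integral>z. (\<integral>\<theta>. \<Phi> (rotinv i j (- \<theta>) z) * F z \<partial>rhom) \<partial>Rn n)"
    by (rule Q.Fubini_integral) (unfold split_beta, rule i3)
  finally show "(\<integral>z. \<Phi> z * Rop \<rho> i j F z \<partial>Rn n)
     = (\<integral>z. (\<integral>\<theta>. \<Phi> (rotinv i j (- \<theta>) z) \<partial>rhom) * F z \<partial>Rn n)" by simp
  show "integrable (Rn n) (\<lambda>z. (\<integral>\<theta>. \<Phi> (rotinv i j (- \<theta>) z) \<partial>rhom) * F z)"
    using Q.integrable_fst'[OF i3] by simp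
qed

abbreviation L :: "((nat \<Rightarrow> real) \<Rightarrow> real) \<Rightarrow> (nat \<Rightarrow> real) \<Rightarrow> real" where
  "L \<equiv> gen M N lamS lamR mu \<rho>"

lemma gen_integrable:
  assumes F: "integrable (Rn n) F"
  shows "integrable (Rn n) (L F)"
proof -
  have "integrable (Rn n) (\<lambda>z. \<Sum>p\<in>idx. wt p * (Rop \<rho> (fst p) (snd p) F z - F z))"
  proof (intro Bochner_Integration.integrable_sum integrable_mult_right Bochner_Integration.integrable_diff F)
    fix p assume "p \<in> idx"
    then show "integrable (Rn n) (Rop \<rho> (fst p) (snd p) F)"
      using Rop_dual(1)[OF F, of "\<lambda>_. 0" 0] idxD by auto
  qed
  moreover have "L F = (\<lambda>z. \<Sum>p\<in>idx. wt p * (Rop \<rho> (fst p) (snd p) F z - F z))"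
    by (rule ext) (rule gen_eq)
  ultimately show ?thesis by simp
qed

text \<open>Summing \<open>Rop_dual\<close> with the weights: the rotated terms assemble to
  \<open>rate\<close> times \<open>avg\<close>, the subtracted identities to the total weight
  \<open>rate\<close>.\<close>

lemma gen_dual:
  fixes F \<Phi> :: "(nat \<Rightarrow> real) \<Rightarrow> real"
  assumes F: "integrable (Rn n) F" and P: "\<Phi> \<in> borel_measurable (Rn n)"
    and b: "\<And>z. z \<in> space (Rn n) \<Longrightarrow> \<bar>\<Phi> z\<bar> \<le> c"
  shows "(\<integral>z. \<Phi> z * L F z \<partial>Rn n) = rate * ((\<integral>z. avg \<Phi> z * F z \<partial>Rn n) - (\<integral>z. \<Phi> z * F z \<partial>Rn n))"
proof -
  have iPF: "integrable (Rn n) (\<lambda>z. \<Phi> z * F z)" by (rule integrable_bounded_mult[OF F P b])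
  have iR: "integrable (Rn n) (\<lambda>z. \<Phi> z * Rop \<rho> (fst p) (snd p) F z)" if "p \<in> idx" for p
    using Rop_dual(1)[OF F P b] idxD[OF that] by (intro integrable_bounded_mult[OF _ P b]) auto
  have "(\<integral>z. \<Phi> z * L F z \<partial>Rn n)
    = (\<integral>z. (\<Sum>p\<in>idx. wt p * (\<Phi> z * Rop \<rho> (fst p) (snd p) F z - \<Phi> z * F z)) \<partial>Rn n)"
    by (simp add: gen_eq sum_distrib_left algebra_simps)
  also have "\<dots> = (\<Sum>p\<in>idx. wt p * ((\<integral>z. \<Phi> z * Rop \<rho> (fst p) (snd p) F z \<partial>Rn n) - (\<integral>z. \<Phi> z * F z \<partial>Rn n)))"
    using iR iPF by (subst Bochner_Integration.integral_sum) (auto intro!: sum.cong)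
  also have "\<dots> = (\<Sum>p\<in>idx. wt p * (\<integral>z. \<Phi> z * Rop \<rho> (fst p) (snd p) F z \<partial>Rn n)) - rate * (\<integral>z. \<Phi> z * F z \<partial>Rn n)"
    by (simp add: right_diff_distrib sum_subtractf rate_def sum_distrib_right)
  also have "(\<Sum>p\<in>idx. wt p * (\<integral>z. \<Phi> z * Rop \<rho> (fst p) (snd p) F z \<partial>Rn n))
    = (\<Sum>p\<in>idx. wt p * (\<integral>z. (\<integral>\<theta>. \<Phi> (rotinv (fst p) (snd p) (- \<theta>) z) \<partial>rhom) * F z \<partial>Rn n))"
    by (intro sum.cong refl arg_cong2[where f="(*)"] Rop_dual(2)[OF F P b]) (use idxD in auto)
  also have "\<dots> = (\<integral>z. (\<Sum>p\<in>idx. wt p * ((\<integral>\<theta>. \<Phi> (rotinv (fst p) (snd p) (- \<theta>) z) \<partial>rhom) * F z)) \<partial>Rn n)"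
    by (subst Bochner_Integration.integral_sum) (use Rop_dual(3)[OF F P b] idxD in auto)
  also have "\<dots> = (\<integral>z. rate * (avg \<Phi> z * F z) \<partial>Rn n)"
  proof (rule Bochner_Integration.integral_cong[OF refl])
    fix z assume z: "z \<in> space (Rn n)"
    have "avg \<Phi> z = (\<Sum>p\<in>idx. wt p / rate * (\<integral>\<theta>. \<Phi> (rotinv (fst p) (snd p) (- \<theta>) z) \<partial>rhom))"
      by (rule avg_sum[OF P b z])
    then have "rate * avg \<Phi> z = (\<Sum>p\<in>idx. wt p * (\<integral>\<theta>. \<Phi> (rotinv (fst p) (snd p) (- \<theta>) z) \<partial>rhom))"
      using rate_pos by (simp add: sum_distrib_left)
    then have "rate * avg \<Phi> z * F z = (\<Sum>p\<in>idx. wt p * (\<integral>\<theta>. \<Phi> (rotinv (fst p) (snd p) (- \<theta>) z) \<partial>rhom)) * F z"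
      by simp
    then show "(\<Sum>p\<in>idx. wt p * ((\<integral>\<theta>. \<Phi> (rotinv (fst p) (snd p) (- \<theta>) z) \<partial>rhom) * F z)) = rate * (avg \<Phi> z * F z)"
      by (simp add: sum_distrib_right mult.assoc)
  qed
  finally show ?thesis by (simp add: right_diff_distrib)
qed

section \<open>The exponential series\<close>

lemma gen_pow_integrable: "integrable (Rn n) F \<Longrightarrow> integrable (Rn n) ((L ^^ k) F)"
  by (induct k) (auto intro: gen_integrable)

text \<open>If \<open>a l\<close> is the value of \<open>avg ^^ l\<close> on a function, then \<open>fdiff a k l\<close> is that of
  \<open>(avg - I)\<^sup>k avg\<^sup>l\<close>.\<close>
definition fdiff :: "(nat \<Rightarrow> real) \<Rightarrow> nat \<Rightarrow> nat \<Rightarrow> real" where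
  "fdiff a k l = (\<Sum>j\<le>k. real (k choose j) * (- 1) ^ (k - j) * a (l + j))"

lemma fdiff_Suc: "fdiff a (Suc k) l = fdiff a k (Suc l) - fdiff a k l"
proof -
  \<comment> \<open>The Pascal terms with unshifted binomial coefficient; the extra power of -1
    makes their sum the negative of \<open>fdiff a k l\<close>.\<close>
  let ?g = "\<lambda>j. real (k choose j) * (- 1) ^ (Suc k - j) * a (l + j)"
  have 1: "(\<Sum>j\<le>Suc k. ?g j) = - fdiff a k l"
    unfolding fdiff_def by (simp add: Suc_diff_le sum_negf)
  have "fdiff a (Suc k) l = (- 1) ^ Suc k * a l
     + (\<Sum>j\<le>k. real (Suc k choose Suc j) * (- 1) ^ (Suc k - Suc j) * a (l + Suc j))"
    unfolding fdiff_def sum.atMost_Suc_shift by simp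
  also have "(\<Sum>j\<le>k. real (Suc k choose Suc j) * (- 1) ^ (Suc k - Suc j) * a (l + Suc j))
    = fdiff a k (Suc l) + (\<Sum>j\<le>k. ?g (Suc j))"
    unfolding fdiff_def sum.distrib[symmetric]
    by (intro sum.cong refl) (simp add: algebra_simps)
  also have "(- 1) ^ Suc k * a l + (fdiff a k (Suc l) + (\<Sum>j\<le>k. ?g (Suc j)))
    = fdiff a k (Suc l) + (\<Sum>j\<le>Suc k. ?g j)"
    unfolding sum.atMost_Suc_shift by simp
  finally show ?thesis unfolding 1 by simp
qed

text \<open>\<open>l\<close> is kept general because moving one factor of the generator across
  raises the power of \<open>avg\<close> on the test function by one; the two resulting terms obey
  the recursion \<open>fdiff_Suc\<close>.\<close>

lemma gen_pow_dual:
  fixes F \<Phi> :: "(nat \<Rightarrow> real) \<Rightarrow> real"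
  assumes F: "integrable (Rn n) F" and P: "\<Phi> \<in> borel_measurable (Rn n)"
    and b: "\<And>z. z \<in> space (Rn n) \<Longrightarrow> \<bar>\<Phi> z\<bar> \<le> c"
  shows "(\<integral>z. (avg ^^ l) \<Phi> z * (L ^^ k) F z \<partial>Rn n)
    = rate ^ k * fdiff (\<lambda>j. \<integral>z. (avg ^^ j) \<Phi> z * F z \<partial>Rn n) k l"
proof (induct k arbitrary: l)
  case 0
  then show ?case by (simp add: fdiff_def)
next
  case (Suc k)
  have "(\<integral>z. (avg ^^ l) \<Phi> z * (L ^^ Suc k) F z \<partial>Rn n) = (\<integral>z. (avg ^^ l) \<Phi> z * L ((L ^^ k) F) z \<partial>Rn n)"
    by simp
  also have "\<dots> = rate * ((\<integral>z. avg ((avg ^^ l) \<Phi>) z * (L ^^ k) F z \<partial>Rn n) - (\<integral>z. (avg ^^ l) \<Phi> z * (L ^^ k) F z \<partial>Rn n))"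
    by (rule gen_dual[OF gen_pow_integrable[OF F] avg_pow_meas[OF P] avg_pow_abs[OF P b]])
  also have "avg ((avg ^^ l) \<Phi>) = (avg ^^ Suc l) \<Phi>" by simp
  finally show ?case unfolding Suc fdiff_Suc by (simp add: right_diff_distrib)
qed

text \<open>The identity exp (r (A - I)) = exp (- r) exp (r A), where the scalar a_k stands for A^k
  paired with fixed functions: the Cauchy product of the series of r^j a_j / j! and of (- r)^j /
  j!.\<close>

lemma exp_series:
  fixes a :: "nat \<Rightarrow> real"
  assumes a: "\<And>k. \<bar>a k\<bar> \<le> c" and r: "0 \<le> r"
  shows "(\<lambda>k. r ^ k / fact k * fdiff a k 0) sums (\<Sum>k. exp (- r) * (r ^ k / fact k) * a k)"
proof -
  let ?u = "\<lambda>j. r ^ j / fact j * a j" and ?v = "\<lambda>j. (- r) ^ j / fact j"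
  have sv: "(\<lambda>j. ?v j) sums exp (- r)"
    using exp_converges[of "- r"] by (simp add: divide_inverse mult.commute)
  have su: "summable (\<lambda>j. norm (?u j))"
  proof (rule summable_comparison_test')
    show "summable (\<lambda>j. r ^ j / fact j * c)"
      using summable_mult2[OF sums_summable[OF exp_converges[of r]], of c] by (simp add: divide_inverse mult.commute)
    show "norm (norm (?u j)) \<le> r ^ j / fact j * c" if "0 \<le> j" for j
      using a[of j] r by (auto simp: abs_mult intro!: mult_left_mono divide_right_mono)
  qed
  have sv': "summable (\<lambda>j. norm (?v j))"
  proof -
    have "norm (?v j) = r ^ j /\<^sub>R fact j" for j using r by (simp add: abs_mult power_abs divide_inverse mult.commute)
    then show ?thesis using sums_summable[OF exp_converges[of r]] by simp
  qed
  have "(\<lambda>k. \<Sum>i\<le>k. ?u i * ?v (k - i)) sums ((\<Sum>k. ?u k) * (\<Sum>k. ?v k))"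
    by (rule Cauchy_product_sums[OF su sv'])
  also have "(\<lambda>k. \<Sum>i\<le>k. ?u i * ?v (k - i)) = (\<lambda>k. r ^ k / fact k * fdiff a k 0)"
  proof (rule ext)
    fix k
    show "(\<Sum>i\<le>k. ?u i * ?v (k - i)) = r ^ k / fact k * fdiff a k 0"
      unfolding fdiff_def sum_distrib_left
    proof (rule sum.cong[OF refl])
      fix i assume "i \<in> {..k}"
      then have i: "i \<le> k" by simp
      have "(- r) ^ (k - i) = (- 1) ^ (k - i) * r ^ (k - i)" by (subst power_minus) simp
      moreover have "r ^ i * r ^ (k - i) = r ^ k" using i by (simp flip: power_add)
      moreover have "real (k choose i) = fact k / (fact i * fact (k - i))"
        using i by (rule binomial_fact)
      ultimately show "?u i * ?v (k - i) = r ^ k / fact k * (real (k choose i) * (- 1) ^ (k - i) * a (0 + i))"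
        by (simp add: field_simps)
    qed
  qed
  also have "(\<Sum>k. ?u k) * (\<Sum>k. ?v k) = (\<Sum>k. exp (- r) * (r ^ k / fact k) * a k)"
    unfolding sums_unique[OF sv, symmetric]
    using suminf_mult2[OF summable_norm_cancel[OF su], of "exp (- r)"] by (simp add: mult_ac)
  finally show ?thesis .
qed

text \<open>The pairings of the partial sums with \<open>\<Phi>\<close> have two limits: the pairing
  of \<open>G\<close>, by convergence in L^1, and a Poisson mixture of powers of \<open>avg\<close>,
  by \<open>exp_series\<close>. Dominated convergence identifies the mixture with the mean over
  random words.\<close>

theorem exp_gen_dual:
  assumes t: "0 \<le> t" and F: "integrable (Rn n) F"
    and G: "is_exp_gen M N lamS lamR mu \<rho> t F G"
  shows "integrable (Rn n) G"
    and "\<And>\<Phi> c. \<Phi> \<in> borel_measurable (Rn n) \<Longrightarrow> (\<And>z. z \<in> space (Rn n) \<Longrightarrow> \<bar>\<Phi> z\<bar> \<le> c) \<Longrightarrow>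
      (\<integral>z. \<Phi> z * G z \<partial>Rn n) = (\<integral>z. (\<integral>\<omega>. \<Phi> (RR \<omega> z) \<partial>Om t) * F z \<partial>Rn n)"
proof -
  let ?S = "\<lambda>m z. \<Sum>k<m. t ^ k / fact k * (L ^^ k) F z"
  have Gm: "G \<in> borel_measurable (Rn n)" using G by (simp add: is_exp_gen_def)
  have lim: "(\<lambda>m. \<integral>\<^sup>+ z. ennreal \<bar>?S m z - G z\<bar> \<partial>Rn n) \<longlonglongrightarrow> 0" using G by (simp add: is_exp_gen_def)
  have iS: "integrable (Rn n) (?S m)" for m
    by (intro Bochner_Integration.integrable_sum integrable_mult_right gen_pow_integrable F)
  have Sm: "?S m \<in> borel_measurable (Rn n)" for m using iS[of m] by (rule borel_measurable_integrable)
  have "\<forall>\<^sub>F m in sequentially. (\<integral>\<^sup>+ z. ennreal \<bar>?S m z - G z\<bar> \<partial>Rn n) < 1"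
    by (rule order_tendstoD(2)[OF lim]) simp
  \<comment> \<open>A single partial sum at finite distance suffices for the integrability of
    \<open>G\<close>.\<close>
  then obtain m0 where m0: "(\<integral>\<^sup>+ z. ennreal \<bar>?S m0 z - G z\<bar> \<partial>Rn n) < 1"
    by (auto simp: eventually_sequentially)
  have "integrable (Rn n) (\<lambda>z. ?S m0 z - G z)"
  proof (rule integrableI_bounded)
    show "(\<lambda>z. ?S m0 z - G z) \<in> borel_measurable (Rn n)" using Sm Gm by (rule borel_measurable_diff)
    show "(\<integral>\<^sup>+ z. norm (?S m0 z - G z) \<partial>Rn n) < \<infinity>"
      unfolding real_norm_def by (rule order.strict_trans[OF m0]) simp
  qed
  from Bochner_Integration.integrable_diff[OF iS[of m0] this] show iG: "integrable (Rn n) G" by simp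
  fix \<Phi> :: "(nat \<Rightarrow> real) \<Rightarrow> real" and c :: real
  assume P: "\<Phi> \<in> borel_measurable (Rn n)" and b: "\<And>z. z \<in> space (Rn n) \<Longrightarrow> \<bar>\<Phi> z\<bar> \<le> c"
  define r where "r = rate * t"
  have r: "0 \<le> r" using t rate_pos by (simp add: r_def)
  define a where "a = (\<lambda>j. \<integral>z. (avg ^^ j) \<Phi> z * F z \<partial>Rn n)"
  have c0: "0 \<le> c" using b[of "\<lambda>i\<in>{..<n}. 0"] by (simp add: space_Rn)
  have ia: "integrable (Rn n) (\<lambda>z. (avg ^^ j) \<Phi> z * F z)" for j
    by (rule integrable_bounded_mult[OF F avg_pow_meas[OF P] avg_pow_abs[OF P b]])
  have ab: "\<bar>a j\<bar> \<le> c * (\<integral>z. \<bar>F z\<bar> \<partial>Rn n)" for j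
  proof -
    have "\<bar>a j\<bar> \<le> (\<integral>z. \<bar>(avg ^^ j) \<Phi> z * F z\<bar> \<partial>Rn n)" unfolding a_def by (rule integral_abs_bound)
    also have "\<dots> \<le> (\<integral>z. c * \<bar>F z\<bar> \<partial>Rn n)"
    proof (rule integral_mono[OF integrable_abs[OF ia]])
      show "\<bar>(avg ^^ j) \<Phi> z * F z\<bar> \<le> c * \<bar>F z\<bar>" if "z \<in> space (Rn n)" for z
        using avg_pow_abs[OF P b that] by (simp add: abs_mult mult_right_mono)
    qed (use F in simp)
    finally show ?thesis by simp
  qed
  have iPS: "integrable (Rn n) (\<lambda>z. \<Phi> z * ?S m z)" for m by (rule integrable_bounded_mult[OF iS P b])
  have iPL: "integrable (Rn n) (\<lambda>z. \<Phi> z * (L ^^ k) F z)" for k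
    by (rule integrable_bounded_mult[OF gen_pow_integrable[OF F] P b])
  have iPG: "integrable (Rn n) (\<lambda>z. \<Phi> z * G z)" by (rule integrable_bounded_mult[OF iG P b])
  have S_eq: "(\<integral>z. \<Phi> z * ?S m z \<partial>Rn n) = (\<Sum>k<m. r ^ k / fact k * fdiff a k 0)" for m
  proof -
    have "(\<integral>z. \<Phi> z * ?S m z \<partial>Rn n) = (\<integral>z. (\<Sum>k<m. t ^ k / fact k * (\<Phi> z * (L ^^ k) F z)) \<partial>Rn n)"
      by (simp add: sum_distrib_left mult.left_commute)
    also have "\<dots> = (\<Sum>k<m. t ^ k / fact k * (\<integral>z. \<Phi> z * (L ^^ k) F z \<partial>Rn n))"
      using iPL by (subst Bochner_Integration.integral_sum) auto
    also have "\<dots> = (\<Sum>k<m. r ^ k / fact k * fdiff a k 0)"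
    proof (rule sum.cong[OF refl])
      fix k
      show "t ^ k / fact k * (\<integral>z. \<Phi> z * (L ^^ k) F z \<partial>Rn n) = r ^ k / fact k * fdiff a k 0"
        using gen_pow_dual[OF F P b, of 0 k] unfolding a_def[symmetric]
        by (simp add: r_def power_mult_distrib)
    qed
    finally show ?thesis .
  qed
  have lim1: "(\<lambda>m. \<integral>z. \<Phi> z * ?S m z \<partial>Rn n) \<longlonglongrightarrow> (\<Sum>k. exp (- r) * (r ^ k / fact k) * a k)"
    unfolding S_eq using exp_series[OF ab r] by (simp add: sums_def)
  have lim2: "(\<lambda>m. \<integral>z. \<Phi> z * ?S m z \<partial>Rn n) \<longlonglongrightarrow> (\<integral>z. \<Phi> z * G z \<partial>Rn n)"
  proof -
    have e: "ennreal \<bar>(\<integral>z. \<Phi> z * ?S m z \<partial>Rn n) - (\<integral>z. \<Phi> z * G z \<partial>Rn n)\<bar>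
      \<le> ennreal c * (\<integral>\<^sup>+ z. ennreal \<bar>?S m z - G z\<bar> \<partial>Rn n)" for m
    proof -
      have iD: "integrable (Rn n) (\<lambda>z. ?S m z - G z)" using iS iG by (rule Bochner_Integration.integrable_diff)
      have "\<bar>(\<integral>z. \<Phi> z * ?S m z \<partial>Rn n) - (\<integral>z. \<Phi> z * G z \<partial>Rn n)\<bar> = \<bar>\<integral>z. \<Phi> z * (?S m z - G z) \<partial>Rn n\<bar>"
        using iPS[of m] iPG by (simp add: right_diff_distrib)
      also have "\<dots> \<le> (\<integral>z. \<bar>\<Phi> z * (?S m z - G z)\<bar> \<partial>Rn n)" by (rule integral_abs_bound)
      also have "\<dots> \<le> (\<integral>z. c * \<bar>?S m z - G z\<bar> \<partial>Rn n)"
      proof (rule integral_mono[OF integrable_abs[OF integrable_bounded_mult[OF iD P b]]])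
        show "\<bar>\<Phi> z * (?S m z - G z)\<bar> \<le> c * \<bar>?S m z - G z\<bar>" if "z \<in> space (Rn n)" for z
          unfolding abs_mult using b[OF that] by (rule mult_right_mono) simp
      qed (assumption, intro integrable_mult_right integrable_abs iD)
      also have "\<dots> = c * (\<integral>z. \<bar>?S m z - G z\<bar> \<partial>Rn n)" by simp
      finally have "ennreal \<bar>(\<integral>z. \<Phi> z * ?S m z \<partial>Rn n) - (\<integral>z. \<Phi> z * G z \<partial>Rn n)\<bar>
        \<le> ennreal (c * (\<integral>z. \<bar>?S m z - G z\<bar> \<partial>Rn n))" by (rule ennreal_leI)
      also have "\<dots> = ennreal c * ennreal (\<integral>z. \<bar>?S m z - G z\<bar> \<partial>Rn n)" using c0 by (simp add: ennreal_mult)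
      also have "ennreal (\<integral>z. \<bar>?S m z - G z\<bar> \<partial>Rn n) = (\<integral>\<^sup>+ z. ennreal \<bar>?S m z - G z\<bar> \<partial>Rn n)"
        by (rule nn_integral_eq_integral[symmetric]) (use iD in auto)
      finally show ?thesis .
    qed
    have "(\<lambda>m. ennreal c * (\<integral>\<^sup>+ z. ennreal \<bar>?S m z - G z\<bar> \<partial>Rn n)) \<longlonglongrightarrow> ennreal c * 0"
      by (rule ennreal_tendsto_cmult[OF _ lim]) simp
    then have "(\<lambda>m. ennreal \<bar>(\<integral>z. \<Phi> z * ?S m z \<partial>Rn n) - (\<integral>z. \<Phi> z * G z \<partial>Rn n)\<bar>) \<longlonglongrightarrow> 0"
      unfolding mult_zero_right
      by (rule tendsto_sandwich[OF always_eventually always_eventually tendsto_const, rotated 2])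
        (simp, rule allI, rule e)
    then have "(\<lambda>m. \<bar>(\<integral>z. \<Phi> z * ?S m z \<partial>Rn n) - (\<integral>z. \<Phi> z * G z \<partial>Rn n)\<bar>) \<longlonglongrightarrow> 0"
      using tendsto_ennreal_iff[of "\<lambda>m. \<bar>(\<integral>z. \<Phi> z * ?S m z \<partial>Rn n) - (\<integral>z. \<Phi> z * G z \<partial>Rn n)\<bar>" sequentially 0] by simp
    then show ?thesis by (simp add: tendsto_rabs_zero_iff LIM_zero_iff)
  qed
  let ?w = "\<lambda>k. exp (- r) * (r ^ k / fact k)"
  have w0: "0 \<le> ?w k" for k using r by simp
  have w1: "(\<Sum>k<m. ?w k) \<le> 1" for m
    using sum_le_suminf[OF sums_summable[OF pois_sums[of r 1]], of "{..<m}"] sums_unique[OF pois_sums[of r 1]] w0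
    by simp
  have lim3: "(\<lambda>m. \<Sum>k<m. ?w k * a k) \<longlonglongrightarrow> (\<integral>z. (\<integral>\<omega>. \<Phi> (RR \<omega> z) \<partial>Om t) * F z \<partial>Rn n)"
  proof -
    have "(\<lambda>m. \<integral>z. (\<Sum>k<m. ?w k * (avg ^^ k) \<Phi> z) * F z \<partial>Rn n)
      \<longlonglongrightarrow> (\<integral>z. (\<integral>\<omega>. \<Phi> (RR \<omega> z) \<partial>Om t) * F z \<partial>Rn n)"
    proof (rule integral_dominated_convergence[where w="\<lambda>z. c * \<bar>F z\<bar>"])
      have Fm: "F \<in> borel_measurable (Rn n)" using F by simp
      interpret RI: rand_iso "Om t" RR n M "CC t" by (rule rand_iso_Om[OF t])
      have "RI.Kop \<Phi> \<in> borel_measurable (Rn n)" by (rule RI.Kop_measurable[OF P])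
      then show "(\<lambda>z. (\<integral>\<omega>. \<Phi> (RR \<omega> z) \<partial>Om t) * F z) \<in> borel_measurable (Rn n)"
        unfolding RI.Kop_def using Fm by (intro borel_measurable_times) auto
      show "(\<lambda>z. (\<Sum>k<m. ?w k * (avg ^^ k) \<Phi> z) * F z) \<in> borel_measurable (Rn n)" for m
        using Fm by (intro borel_measurable_times borel_measurable_sum avg_pow_meas P) auto
      show "integrable (Rn n) (\<lambda>z. c * \<bar>F z\<bar>)" using F by simp
      show "AE z in Rn n. (\<lambda>m. (\<Sum>k<m. ?w k * (avg ^^ k) \<Phi> z) * F z) \<longlonglongrightarrow> (\<integral>\<omega>. \<Phi> (RR \<omega> z) \<partial>Om t) * F z"
      proof (rule AE_I2)
        fix z assume z: "z \<in> space (Rn n)"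
        show "(\<lambda>m. (\<Sum>k<m. ?w k * (avg ^^ k) \<Phi> z) * F z) \<longlonglongrightarrow> (\<integral>\<omega>. \<Phi> (RR \<omega> z) \<partial>Om t) * F z"
          using Om_integral[OF t P b z, folded r_def] unfolding sums_def by (intro tendsto_mult tendsto_const)
      qed
      show "AE z in Rn n. norm ((\<Sum>k<m. ?w k * (avg ^^ k) \<Phi> z) * F z) \<le> c * \<bar>F z\<bar>" for m
      proof (rule AE_I2)
        fix z assume z: "z \<in> space (Rn n)"
        have "\<bar>\<Sum>k<m. ?w k * (avg ^^ k) \<Phi> z\<bar> \<le> (\<Sum>k<m. \<bar>?w k * (avg ^^ k) \<Phi> z\<bar>)" by (rule sum_abs)
        also have "\<dots> \<le> (\<Sum>k<m. ?w k * c)"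
        proof (rule sum_mono)
          fix k
          have "\<bar>?w k * (avg ^^ k) \<Phi> z\<bar> = ?w k * \<bar>(avg ^^ k) \<Phi> z\<bar>"
            unfolding abs_mult[of "?w k"] abs_of_nonneg[OF w0] ..
          also have "\<dots> \<le> ?w k * c" by (rule mult_left_mono[OF avg_pow_abs[OF P b z] w0])
          finally show "\<bar>?w k * (avg ^^ k) \<Phi> z\<bar> \<le> ?w k * c" .
        qed
        also have "\<dots> = (\<Sum>k<m. ?w k) * c" by (rule sum_distrib_right[symmetric])
        also have "\<dots> \<le> 1 * c" using w1 c0 by (rule mult_right_mono)
        finally show "norm ((\<Sum>k<m. ?w k * (avg ^^ k) \<Phi> z) * F z) \<le> c * \<bar>F z\<bar>"
          by (simp add: abs_mult mult_right_mono)
      qed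
    qed
    moreover have "(\<integral>z. (\<Sum>k<m. ?w k * (avg ^^ k) \<Phi> z) * F z \<partial>Rn n) = (\<Sum>k<m. ?w k * a k)" for m
    proof -
      have "(\<integral>z. (\<Sum>k<m. ?w k * (avg ^^ k) \<Phi> z) * F z \<partial>Rn n) = (\<integral>z. (\<Sum>k<m. ?w k * ((avg ^^ k) \<Phi> z * F z)) \<partial>Rn n)"
        by (simp add: sum_distrib_right mult.assoc)
      also have "\<dots> = (\<Sum>k<m. ?w k * a k)"
        unfolding a_def by (subst Bochner_Integration.integral_sum) (intro integrable_mult_right ia, simp)
      finally show ?thesis .
    qed
    ultimately show ?thesis by simp
  qed
  have "(\<lambda>m. \<Sum>k<m. ?w k * a k) \<longlonglongrightarrow> (\<Sum>k. ?w k * a k)"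
    using summable_LIMSEQ[OF sums_summable[OF pois_integral[OF r ab]]] by simp
  from LIMSEQ_unique[OF lim1 lim2] LIMSEQ_unique[OF this lim3]
  show "(\<integral>z. \<Phi> z * G z \<partial>Rn n) = (\<integral>z. (\<integral>\<omega>. \<Phi> (RR \<omega> z) \<partial>Om t) * F z \<partial>Rn n)" by simp
qed

end

section \<open>Smooth cutoff functions and density\<close>

text \<open>Regular stand-ins for indicators, closed under complement and product; they take part in
  the approximation of bounded test functions by tame ones.\<close>

definition cutoff :: "nat \<Rightarrow> ((nat \<Rightarrow> real) \<Rightarrow> real) \<Rightarrow> bool" where
  "cutoff m h \<longleftrightarrow> (\<exists>D p. tame m m 0 1 D h p)"

lemma cutoff_const: "cutoff m (\<lambda>_. 1)"
proof -
  have "tame m m 0 1 0 (\<lambda>_. 1) (\<lambda>_ _. 0)" by (simp add: tame_def)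
  then show ?thesis unfolding cutoff_def by blast
qed

lemma tame_compl:
  assumes t: "tame n M a b D g p"
  shows "tame n M (1 - b) (1 - a) D (\<lambda>z. 1 - g z) (\<lambda>i z. - p i z)"
proof -
  note T = tameD[OF t]
  show ?thesis unfolding tame_def
  proof (intro conjI ballI allI impI)
    fix z assume z: "z \<in> space (Rn n)"
    show "1 - b \<le> 1 - g z" "1 - g z \<le> 1 - a" using T(5,6)[OF z] by auto
    show "\<bar>- p i z\<bar> \<le> D" if "i < M" for i using T(7)[OF z that] by simp
    fix s w
    show "\<bar>1 - g (vadd n z s w) - (1 - g z)\<bar> \<le> D * (\<bar>s\<bar> * sqrt (nsq n w))"
      using T(8)[OF z, of s w] by (simp add: abs_minus_commute)
    have "1 - g (vadd n z s w) - (1 - g z) - s * (\<Sum>i<M. - p i z * w i)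
      = - (g (vadd n z s w) - g z - s * (\<Sum>i<M. p i z * w i))"
      by (simp add: sum_negf)
    then show "\<bar>1 - g (vadd n z s w) - (1 - g z) - s * (\<Sum>i<M. - p i z * w i)\<bar> \<le> D * (s\<^sup>2 * nsq n w)"
      using T(9)[OF z, of s w] by (simp only: abs_minus_cancel)
  qed (use T in auto)
qed

lemma tame_scale:
  assumes t: "tame n M 0 1 D g p"
  shows "tame n M (- \<bar>c\<bar>) \<bar>c\<bar> (\<bar>c\<bar> * D) (\<lambda>z. c * g z) (\<lambda>i z. c * p i z)"
proof -
  note T = tameD[OF t]
  show ?thesis unfolding tame_def
  proof (intro conjI ballI allI impI)
    fix z assume z: "z \<in> space (Rn n)"
    have "\<bar>c * g z\<bar> \<le> \<bar>c\<bar> * 1" unfolding abs_mult using T(5,6)[OF z] by (intro mult_left_mono) auto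
    then show "- \<bar>c\<bar> \<le> c * g z" "c * g z \<le> \<bar>c\<bar>" by auto
    show "\<bar>c * p i z\<bar> \<le> \<bar>c\<bar> * D" if "i < M" for i
      unfolding abs_mult using T(7)[OF z that] by (intro mult_left_mono) auto
    fix s w
    have "\<bar>c * g (vadd n z s w) - c * g z\<bar> = \<bar>c\<bar> * \<bar>g (vadd n z s w) - g z\<bar>"
      by (simp flip: right_diff_distrib add: abs_mult)
    also have "\<dots> \<le> \<bar>c\<bar> * (D * (\<bar>s\<bar> * sqrt (nsq n w)))" by (intro mult_left_mono T(8)[OF z]) auto
    finally show "\<bar>c * g (vadd n z s w) - c * g z\<bar> \<le> \<bar>c\<bar> * D * (\<bar>s\<bar> * sqrt (nsq n w))" by (simp add: mult.assoc)
    have "c * g (vadd n z s w) - c * g z - s * (\<Sum>i<M. c * p i z * w i)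
      = c * (g (vadd n z s w) - g z - s * (\<Sum>i<M. p i z * w i))"
      by (simp add: right_diff_distrib sum_distrib_left mult_ac)
    then have "\<bar>c * g (vadd n z s w) - c * g z - s * (\<Sum>i<M. c * p i z * w i)\<bar>
      = \<bar>c\<bar> * \<bar>g (vadd n z s w) - g z - s * (\<Sum>i<M. p i z * w i)\<bar>" by (simp only: abs_mult)
    also have "\<dots> \<le> \<bar>c\<bar> * (D * (s\<^sup>2 * nsq n w))" by (intro mult_left_mono T(9)[OF z]) auto
    finally show "\<bar>c * g (vadd n z s w) - c * g z - s * (\<Sum>i<M. c * p i z * w i)\<bar> \<le> \<bar>c\<bar> * D * (s\<^sup>2 * nsq n w)"
      by (simp add: mult.assoc)
  qed (use T in auto)
qed

lemma tame_add:
  assumes t: "tame n M a b D g p" and t': "tame n M a' b' D' g' p'"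
  shows "tame n M (a + a') (b + b') (D + D') (\<lambda>z. g z + g' z) (\<lambda>i z. p i z + p' i z)"
proof -
  note T = tameD[OF t] and T' = tameD[OF t']
  show ?thesis unfolding tame_def
  proof (intro conjI ballI allI impI)
    fix z assume z: "z \<in> space (Rn n)"
    show "a + a' \<le> g z + g' z" "g z + g' z \<le> b + b'" using T(5,6)[OF z] T'(5,6)[OF z] by auto
    show "\<bar>p i z + p' i z\<bar> \<le> D + D'" if "i < M" for i
      using T(7)[OF z that] T'(7)[OF z that] by linarith
    fix s w
    show "\<bar>g (vadd n z s w) + g' (vadd n z s w) - (g z + g' z)\<bar> \<le> (D + D') * (\<bar>s\<bar> * sqrt (nsq n w))"
      unfolding distrib_right using T(8)[OF z, of s w] T'(8)[OF z, of s w] by linarith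
    have e: "s * (\<Sum>i<M. (p i z + p' i z) * w i) = s * (\<Sum>i<M. p i z * w i) + s * (\<Sum>i<M. p' i z * w i)"
      by (simp add: distrib_right sum.distrib distrib_left)
    show "\<bar>g (vadd n z s w) + g' (vadd n z s w) - (g z + g' z) - s * (\<Sum>i<M. (p i z + p' i z) * w i)\<bar>
        \<le> (D + D') * (s\<^sup>2 * nsq n w)"
      unfolding e distrib_right[of D] using T(9)[OF z, of s w] T'(9)[OF z, of s w] by linarith
  qed (use T T' in auto)
qed

lemma tame_mult:
  assumes t: "tame n M 0 1 D g p" and t': "tame n M 0 1 D' g' p'"
  shows "tame n M 0 1 (D + D' + D * D') (\<lambda>z. g z * g' z) (\<lambda>i z. p i z * g' z + g z * p' i z)"
proof -
  note T = tameD[OF t] and T' = tameD[OF t']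
  have D: "0 \<le> D" "0 \<le> D'" by (rule T(2), rule T'(2))
  show ?thesis unfolding tame_def
  proof (intro conjI ballI allI impI)
    show "0 \<le> D + D' + D * D'" using D by simp
    fix z assume z: "z \<in> space (Rn n)"
    have g: "0 \<le> g z" "g z \<le> 1" "0 \<le> g' z" "g' z \<le> 1" using T(5,6)[OF z] T'(5,6)[OF z] by auto
    show "0 \<le> g z * g' z" "g z * g' z \<le> 1" using g by (auto intro: mult_le_one)
    show "\<bar>p i z * g' z + g z * p' i z\<bar> \<le> D + D' + D * D'" if i: "i < M" for i
    proof -
      have "\<bar>p i z * g' z\<bar> \<le> D * 1" unfolding abs_mult using T(7)[OF z i] g D by (intro mult_mono) auto
      moreover have "\<bar>g z * p' i z\<bar> \<le> 1 * D'" unfolding abs_mult using T'(7)[OF z i] g D by (intro mult_mono) auto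
      moreover have "0 \<le> D * D'" using D by simp
      ultimately show ?thesis by linarith
    qed
    fix s :: real and w :: "nat \<Rightarrow> real"
    let ?y = "g (vadd n z s w)" and ?y' = "g' (vadd n z s w)" and ?r = "\<bar>s\<bar> * sqrt (nsq n w)"
    have y: "0 \<le> ?y" "?y \<le> 1" "0 \<le> ?y'" "?y' \<le> 1"
      using T(5,6)[OF vadd_space] T'(5,6)[OF vadd_space] by auto
    have l: "\<bar>?y - g z\<bar> \<le> D * ?r" "\<bar>?y' - g' z\<bar> \<le> D' * ?r" by (rule T(8)[OF z], rule T'(8)[OF z])
    have r0: "0 \<le> D * D' * ?r" using D by simp
    have "?y * ?y' - g z * g' z = (?y - g z) * ?y' + g z * (?y' - g' z)" by (simp add: algebra_simps)
    then have "\<bar>?y * ?y' - g z * g' z\<bar> \<le> \<bar>(?y - g z) * ?y'\<bar> + \<bar>g z * (?y' - g' z)\<bar>"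
      by (simp only: abs_triangle_ineq)
    also have "\<dots> \<le> D * ?r * 1 + 1 * (D' * ?r)"
      unfolding abs_mult using l y g D by (intro add_mono mult_mono) auto
    also have "\<dots> \<le> (D + D' + D * D') * ?r" using r0 by (simp add: distrib_right)
    finally show "\<bar>?y * ?y' - g z * g' z\<bar> \<le> (D + D' + D * D') * ?r" .
    let ?l = "s * (\<Sum>i<M. p i z * w i)" and ?l' = "s * (\<Sum>i<M. p' i z * w i)" and ?q = "s\<^sup>2 * nsq n w"
    have e: "s * (\<Sum>i<M. (p i z * g' z + g z * p' i z) * w i) = ?l * g' z + g z * ?l'"
      by (simp add: distrib_right sum.distrib distrib_left sum_distrib_left sum_distrib_right mult_ac)
    \<comment> \<open>Product rule with remainder: the product of the two increments is of second
      order by the Lipschitz bounds and accounts for the summand D D'.\<close>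
    have e2: "?y * ?y' - g z * g' z - (?l * g' z + g z * ?l')
      = (?y - g z - ?l) * g' z + g z * (?y' - g' z - ?l') + (?y - g z) * (?y' - g' z)"
      by (simp add: algebra_simps)
    have rr: "?r * ?r = ?q"
      using power_mult_distrib[of "\<bar>s\<bar>" "sqrt (nsq n w)" 2] by (simp add: power2_eq_square)
    have "\<bar>?y * ?y' - g z * g' z - s * (\<Sum>i<M. (p i z * g' z + g z * p' i z) * w i)\<bar>
      \<le> \<bar>(?y - g z - ?l) * g' z\<bar> + \<bar>g z * (?y' - g' z - ?l')\<bar> + \<bar>(?y - g z) * (?y' - g' z)\<bar>"
      unfolding e e2 by linarith
    also have "\<dots> \<le> D * ?q * 1 + 1 * (D' * ?q) + (D * ?r) * (D' * ?r)"
      unfolding abs_mult using T(9)[OF z, of s w] T'(9)[OF z, of s w] l g D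
      by (intro add_mono mult_mono) auto
    also have "(D * ?r) * (D' * ?r) = D * D' * ?q" unfolding rr[symmetric] by (simp add: mult_ac)
    also have "D * ?q * 1 + 1 * (D' * ?q) + D * D' * ?q = (D + D' + D * D') * ?q" by (simp add: distrib_right)
    finally show "\<bar>?y * ?y' - g z * g' z - s * (\<Sum>i<M. (p i z * g' z + g z * p' i z) * w i)\<bar>
        \<le> (D + D' + D * D') * ?q" .
  qed (use T T' in \<open>auto intro!: borel_measurable_times borel_measurable_add\<close>)
qed

lemma cutoff_compl: "cutoff m h \<Longrightarrow> cutoff m (\<lambda>z. 1 - h z)"
  unfolding cutoff_def using tame_compl[of m m 0 1] by fastforce

lemma cutoff_mult: "cutoff m h \<Longrightarrow> cutoff m h' \<Longrightarrow> cutoff m (\<lambda>z. h z * h' z)"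
  unfolding cutoff_def using tame_mult by blast

lemma cutoff_prod: "finite I \<Longrightarrow> (\<And>i. i \<in> I \<Longrightarrow> cutoff m (h i)) \<Longrightarrow> cutoff m (\<lambda>z. \<Prod>i\<in>I. h i z)"
  by (induct I rule: finite_induct) (auto intro: cutoff_const cutoff_mult)

lemma cutoffD:
  assumes "cutoff m h"
  shows "h \<in> borel_measurable (Rn m)" "z \<in> space (Rn m) \<Longrightarrow> 0 \<le> h z" "z \<in> space (Rn m) \<Longrightarrow> h z \<le> 1"
proof -
  obtain D p where t: "tame m m 0 1 D h p" using assms by (auto simp: cutoff_def)
  show "h \<in> borel_measurable (Rn m)" by (rule tameD(3)[OF t])
  show "z \<in> space (Rn m) \<Longrightarrow> 0 \<le> h z" by (rule tameD(5)[OF t])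
  show "z \<in> space (Rn m) \<Longrightarrow> h z \<le> 1" by (rule tameD(6)[OF t])
qed

text \<open>The mean value theorem, together with the fact that the derivative 1 / (1 + x^2) is
  bounded by 1 and is 1-Lipschitz.\<close>

lemma arctan_taylor:
  "\<bar>arctan (x + h) - arctan x\<bar> \<le> \<bar>h\<bar>" "\<bar>arctan (x + h) - arctan x - h / (1 + x\<^sup>2)\<bar> \<le> h\<^sup>2"
proof -
  have d: "(arctan has_real_derivative inverse (1 + y\<^sup>2)) (at y)" for y by (rule DERIV_arctan)
  have mvt: "\<exists>y. \<bar>y - x\<bar> \<le> \<bar>h\<bar> \<and> arctan (x + h) - arctan x = h * inverse (1 + y\<^sup>2)"
  proof (cases "h = 0")
    case False
    show ?thesis
    proof (cases "h > 0")
      case True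
      then obtain y where "x < y" "y < x + h" "arctan (x + h) - arctan x = (x + h - x) * inverse (1 + y\<^sup>2)"
        using MVT2[of x "x + h" arctan "\<lambda>y. inverse (1 + y\<^sup>2)"] d by auto
      then show ?thesis by (intro exI[of _ y]) auto
    next
      case h: False
      then obtain y where "x + h < y" "y < x" "arctan x - arctan (x + h) = (x - (x + h)) * inverse (1 + y\<^sup>2)"
        using MVT2[of "x + h" x arctan "\<lambda>y. inverse (1 + y\<^sup>2)"] d False by auto
      then show ?thesis using h False by (intro exI[of _ y]) auto
    qed
  qed (auto intro: exI[of _ x])
  then obtain y where y: "\<bar>y - x\<bar> \<le> \<bar>h\<bar>" "arctan (x + h) - arctan x = h * inverse (1 + y\<^sup>2)" by blast
  have p: "0 < 1 + u\<^sup>2" "inverse (1 + u\<^sup>2) \<le> 1" for u :: real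
    by (auto simp: add_pos_nonneg inverse_le_1_iff)
  have "\<bar>h * inverse (1 + y\<^sup>2)\<bar> \<le> \<bar>h\<bar> * 1"
    unfolding abs_mult using p(1)[of y] p(2)[of y] by (intro mult_left_mono) (auto simp del: inverse_le_1_iff)
  then show "\<bar>arctan (x + h) - arctan x\<bar> \<le> \<bar>h\<bar>" unfolding y(2) by simp
  have i: "\<bar>inverse (1 + y\<^sup>2) - inverse (1 + x\<^sup>2)\<bar> \<le> \<bar>y - x\<bar>"
  proof -
    have "inverse (1 + y\<^sup>2) - inverse (1 + x\<^sup>2) = (x - y) * ((x + y) / ((1 + y\<^sup>2) * (1 + x\<^sup>2)))"
      using p(1)[of x] p(1)[of y] by (simp add: field_simps power2_eq_square)
    moreover have "\<bar>(x + y) / ((1 + y\<^sup>2) * (1 + x\<^sup>2))\<bar> \<le> 1"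
    proof -
      have "2 * \<bar>x\<bar> \<le> 1 + x\<^sup>2" "2 * \<bar>y\<bar> \<le> 1 + y\<^sup>2"
        using sum_squares_bound[of 1 "\<bar>x\<bar>"] sum_squares_bound[of 1 "\<bar>y\<bar>"] by auto
      moreover have "0 \<le> x\<^sup>2 * y\<^sup>2" by simp
      ultimately have "\<bar>x + y\<bar> \<le> (1 + y\<^sup>2) * (1 + x\<^sup>2)"
        unfolding distrib_right distrib_left
        by (smt (verit) mult_1 mult.right_neutral mult.commute zero_le_power2)
      then show ?thesis using p(1)[of x] p(1)[of y] by (simp add: abs_divide abs_mult)
    qed
    ultimately show ?thesis
      using mult_left_mono[of "\<bar>(x + y) / ((1 + y\<^sup>2) * (1 + x\<^sup>2))\<bar>" 1 "\<bar>x - y\<bar>"]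
      by (simp add: abs_mult abs_minus_commute)
  qed
  have "arctan (x + h) - arctan x - h / (1 + x\<^sup>2) = h * (inverse (1 + y\<^sup>2) - inverse (1 + x\<^sup>2))"
    unfolding y(2) by (simp add: algebra_simps divide_inverse)
  also have "\<bar>\<dots>\<bar> \<le> \<bar>h\<bar> * \<bar>h\<bar>"
    unfolding abs_mult using i y(1) by (intro mult_left_mono) auto
  finally show "\<bar>arctan (x + h) - arctan x - h / (1 + x\<^sup>2)\<bar> \<le> h\<^sup>2" by (simp add: power2_eq_square)
qed

text \<open>In the tame constant, |c| pays for the slope and c^2 for the second-order remainder of
  \<open>arctan_taylor\<close>; division by pi only decreases them.\<close>

lemma cutoff_arctan:
  assumes k: "k < m"
  shows "cutoff m (\<lambda>z. arctan (b + c * z k) / pi + 1 / 2)"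
proof -
  let ?p = "\<lambda>i z. if i = k then c / (1 + (b + c * z k)\<^sup>2) / pi else 0"
  have m: "(\<lambda>z. z k) \<in> borel_measurable (Rn m)" by (rule measurable_component_Rn[OF k])
  have pi1: "1 \<le> pi" using pi_gt3 by simp
  have "tame m m 0 1 (\<bar>c\<bar> + c\<^sup>2) (\<lambda>z. arctan (b + c * z k) / pi + 1 / 2) ?p"
    unfolding tame_def
  proof (intro conjI ballI allI impI)
    show "(\<lambda>z. arctan (b + c * z k) / pi + 1 / 2) \<in> borel_measurable (Rn m)" using m by measurable
    show "?p i \<in> borel_measurable (Rn m)" for i using m by (cases "i = k") simp_all
    fix z
    have "- (pi / 2) \<le> arctan (b + c * z k)" "arctan (b + c * z k) \<le> pi / 2"
      using arctan_lbound[of "b + c * z k"] arctan_ubound[of "b + c * z k"] by auto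
    then have "- (pi / 2) / pi \<le> arctan (b + c * z k) / pi" "arctan (b + c * z k) / pi \<le> (pi / 2) / pi"
      by (intro divide_right_mono; simp)+
    then have "- (1 / 2) \<le> arctan (b + c * z k) / pi" "arctan (b + c * z k) / pi \<le> 1 / 2"
      using pi_neq_zero by simp_all
    then show "0 \<le> arctan (b + c * z k) / pi + 1 / 2" "arctan (b + c * z k) / pi + 1 / 2 \<le> 1"
      by linarith+
    show "\<bar>?p i z\<bar> \<le> \<bar>c\<bar> + c\<^sup>2" for i
    proof -
      have "1 \<le> (1 + (b + c * z k)\<^sup>2) * pi" using pi1 mult_mono[of 1 "1 + (b + c * z k)\<^sup>2" 1 pi] by simp
      then have "\<bar>c\<bar> / ((1 + (b + c * z k)\<^sup>2) * pi) \<le> \<bar>c\<bar> / 1" by (intro divide_left_mono) auto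
      then have "\<bar>c / (1 + (b + c * z k)\<^sup>2) / pi\<bar> \<le> \<bar>c\<bar>" by (simp add: abs_divide abs_mult)
      moreover have "0 \<le> c\<^sup>2" by simp
      ultimately show ?thesis by (auto intro: order_trans)
    qed
    fix s w
    let ?x = "b + c * z k" and ?h = "c * (s * w k)"
    have v: "b + c * vadd m z s w k = ?x + ?h" using k by (simp add: vadd_def algebra_simps)
    have wk: "\<bar>w k\<bar> \<le> sqrt (nsq m w)" using sq_le_nsq[OF k, of w] by (simp add: real_le_rsqrt)
    have d: "arctan (?x + ?h) / pi + 1 / 2 - (arctan ?x / pi + 1 / 2) = (arctan (?x + ?h) - arctan ?x) / pi"
      by (simp add: diff_divide_distrib)
    have div: "\<bar>u / pi\<bar> \<le> \<bar>u\<bar>" for u using pi1 by (simp add: abs_divide divide_le_eq mult_left_mono[of 1 pi "\<bar>u\<bar>", simplified])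
    have "\<bar>(arctan (?x + ?h) - arctan ?x) / pi\<bar> \<le> \<bar>?h\<bar>" using div arctan_taylor(1)[of ?x ?h] by (rule order_trans)
    also have "\<dots> \<le> \<bar>c\<bar> * (\<bar>s\<bar> * sqrt (nsq m w))"
      unfolding abs_mult by (intro mult_left_mono wk) auto
    also have "\<dots> \<le> (\<bar>c\<bar> + c\<^sup>2) * (\<bar>s\<bar> * sqrt (nsq m w))" by (intro mult_right_mono) auto
    finally show "\<bar>arctan (b + c * vadd m z s w k) / pi + 1 / 2 - (arctan (b + c * z k) / pi + 1 / 2)\<bar>
       \<le> (\<bar>c\<bar> + c\<^sup>2) * (\<bar>s\<bar> * sqrt (nsq m w))"
      unfolding v d .
    have e: "s * (\<Sum>i<m. ?p i z * w i) = ?h / (1 + ?x\<^sup>2) / pi"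
    proof -
      have "(\<Sum>i<m. ?p i z * w i) = (\<Sum>i<m. if i = k then c / (1 + ?x\<^sup>2) / pi * w i else 0)"
        by (intro sum.cong) auto
      then show ?thesis using k by simp
    qed
    have d2: "(arctan (?x + ?h) - arctan ?x) / pi - ?h / (1 + ?x\<^sup>2) / pi
      = (arctan (?x + ?h) - arctan ?x - ?h / (1 + ?x\<^sup>2)) / pi" by (simp add: diff_divide_distrib)
    have "\<bar>(arctan (?x + ?h) - arctan ?x - ?h / (1 + ?x\<^sup>2)) / pi\<bar> \<le> ?h\<^sup>2"
      using div arctan_taylor(2)[of ?x ?h] by (rule order_trans)
    also have "\<dots> = c\<^sup>2 * (s\<^sup>2 * (w k)\<^sup>2)" by (simp add: power_mult_distrib)
    also have "\<dots> \<le> c\<^sup>2 * (s\<^sup>2 * nsq m w)" by (intro mult_left_mono sq_le_nsq[OF k]) auto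
    also have "\<dots> \<le> (\<bar>c\<bar> + c\<^sup>2) * (s\<^sup>2 * nsq m w)" by (intro mult_right_mono) auto
    finally show "\<bar>arctan (b + c * vadd m z s w k) / pi + 1 / 2 - (arctan (b + c * z k) / pi + 1 / 2)
       - s * (\<Sum>i<m. ?p i z * w i)\<bar> \<le> (\<bar>c\<bar> + c\<^sup>2) * (s\<^sup>2 * nsq m w)"
      unfolding v d e d2 .
  qed auto
  then show ?thesis unfolding cutoff_def by blast
qed

text \<open>The shift by \<open>sqrt k\<close> makes the limit the indicator of the closed half-line also at \<open>x = a\<close>.\<close>
lemma step_limit:
  fixes a x :: real
  shows "(\<lambda>k. arctan (real k * a + sqrt (real k) + - real k * x) / pi + 1 / 2) \<longlonglongrightarrow> indicator {..a} x"
proof -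
  have e: "real k * a + sqrt (real k) + - real k * x = real k * (a - x) + sqrt (real k)" for k
    by (simp add: algebra_simps)
  show ?thesis
  proof (cases "x \<le> a")
    case True
    have "filterlim (\<lambda>k. real k * (a - x) + sqrt (real k)) at_top sequentially"
    proof (rule filterlim_at_top_mono)
      show "filterlim (\<lambda>k. sqrt (real k)) at_top sequentially" by real_asymp
      show "\<forall>\<^sub>F k in sequentially. sqrt (real k) \<le> real k * (a - x) + sqrt (real k)"
        using True by (intro always_eventually) simp
    qed
    from filterlim_compose[OF tendsto_arctan_at_top this]
    have "(\<lambda>k. arctan (real k * (a - x) + sqrt (real k)) / pi + 1 / 2) \<longlonglongrightarrow> pi / 2 / pi + 1 / 2"
      by (intro tendsto_intros) auto
    then show ?thesis using True unfolding e by simp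
  next
    case False
    then have "0 < x - a" by simp
    then have "filterlim (\<lambda>k. real k * (x - a) - sqrt (real k)) at_top sequentially"
      by real_asymp
    then have "filterlim (\<lambda>k. - (real k * (x - a) - sqrt (real k))) at_bot sequentially"
      by (simp add: filterlim_uminus_at_bot)
    then have "filterlim (\<lambda>k. real k * (a - x) + sqrt (real k)) at_bot sequentially"
      by (simp add: algebra_simps)
    from filterlim_compose[OF tendsto_arctan_at_bot this]
    have "(\<lambda>k. arctan (real k * (a - x) + sqrt (real k)) / pi + 1 / 2) \<longlonglongrightarrow> - (pi / 2) / pi + 1 / 2"
      by (intro tendsto_intros) auto
    then show ?thesis using False unfolding e by simp
  qed
qed

section \<open>Density of cutoffs for a finite measure\<close>

lemma one_minus_prod_le_sum:
  fixes x :: "'i \<Rightarrow> real"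
  assumes "finite I" "\<And>i. i \<in> I \<Longrightarrow> 0 \<le> x i \<and> x i \<le> 1"
  shows "1 - (\<Prod>i\<in>I. 1 - x i) \<le> (\<Sum>i\<in>I. x i)"
  using assms
proof (induct I rule: finite_induct)
  case (insert i I)
  have P: "0 \<le> (\<Prod>i\<in>I. 1 - x i)" "(\<Prod>i\<in>I. 1 - x i) \<le> 1"
    using insert by (auto intro!: prod_nonneg prod_le_1)
  have "1 - (\<Prod>j\<in>insert i I. 1 - x j) = (1 - (\<Prod>j\<in>I. 1 - x j)) + x i * (\<Prod>j\<in>I. 1 - x j)"
    using insert by (simp add: algebra_simps)
  also have "\<dots> \<le> (\<Sum>j\<in>I. x j) + x i * 1"
    using insert P by (intro add_mono mult_left_mono) auto
  finally show ?case using insert by simp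
qed simp

lemma abs_diff_indicator_le: "0 \<le> x \<Longrightarrow> x \<le> 1 \<Longrightarrow> \<bar>x - indicator A z\<bar> \<le> (1 :: real)"
  by (auto simp: indicator_def)

context
  fixes m :: nat and \<mu> :: "(nat \<Rightarrow> real) measure"
  assumes fin: "finite_measure \<mu>" and sets_mu: "sets \<mu> = sets (Rn m)"
begin

interpretation finite_measure \<mu> by (rule fin)

text \<open>The sets whose indicators are L^1 limits of cutoffs. They turn out to form a
  sigma-algebra containing the coordinate half-spaces, hence to be all measurable sets.\<close>

definition approximable :: "(nat \<Rightarrow> real) set \<Rightarrow> bool" where
  "approximable A \<longleftrightarrow> A \<in> sets (Rn m) \<and>
     (\<forall>e>0. \<exists>h. cutoff m h \<and> (\<integral>z. \<bar>h z - indicator A z\<bar> \<partial>\<mu>) < e)"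

lemma space_mu: "space \<mu> = space (Rn m)"
  using sets_mu by (rule sets_eq_imp_space_eq)

lemma meas_mu: "borel_measurable \<mu> = (borel_measurable (Rn m) :: ((nat \<Rightarrow> real) \<Rightarrow> real) set)"
  by (rule measurable_cong_sets[OF sets_mu refl])

lemma cutoff_diff_int:
  assumes "cutoff m h" "A \<in> sets (Rn m)"
  shows "integrable \<mu> (\<lambda>z. \<bar>h z - indicator A z\<bar>)"
proof (rule integrable_const_bound[where B=1])
  show "(\<lambda>z. \<bar>h z - indicator A z\<bar>) \<in> borel_measurable \<mu>"
    unfolding meas_mu
    by (intro borel_measurable_abs borel_measurable_diff borel_measurable_indicator cutoffD assms)
  show "AE z in \<mu>. norm \<bar>h z - indicator A z\<bar> \<le> 1"
    unfolding real_norm_def abs_abs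
    by (intro AE_I2 abs_diff_indicator_le cutoffD(2,3)[OF assms(1)]) (simp_all only: space_mu)
qed

lemma approximable_compl:
  assumes A: "approximable A" shows "approximable (space (Rn m) - A)"
  unfolding approximable_def
proof (intro conjI allI impI)
  show "space (Rn m) - A \<in> sets (Rn m)" using A unfolding approximable_def by (intro sets.compl_sets) blast
  fix e :: real assume "0 < e"
  then obtain h where h: "cutoff m h" "(\<integral>z. \<bar>h z - indicator A z\<bar> \<partial>\<mu>) < e"
    using A unfolding approximable_def by blast
  have "(\<integral>z. \<bar>(1 - h z) - indicator (space (Rn m) - A) z\<bar> \<partial>\<mu>) = (\<integral>z. \<bar>h z - indicator A z\<bar> \<partial>\<mu>)"
    by (rule Bochner_Integration.integral_cong) (auto simp: space_mu indicator_def)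
  then show "\<exists>h. cutoff m h \<and> (\<integral>z. \<bar>h z - indicator (space (Rn m) - A) z\<bar> \<partial>\<mu>) < e"
    using h cutoff_compl by (intro exI[of _ "\<lambda>z. 1 - h z"]) auto
qed

lemma approximable_empty: "approximable {}"
  unfolding approximable_def using cutoff_compl[OF cutoff_const[of m]]
  by (auto intro!: exI[of _ "\<lambda>_. 0"])

text \<open>Finitely many of the sets carry all but e / 2 of the measure of the union; their cutoffs
  are combined by 1 - prod (1 - h), the analogue of a union.\<close>

lemma approximable_Union:
  fixes A :: "nat \<Rightarrow> (nat \<Rightarrow> real) set"
  assumes A: "\<And>i. approximable (A i)" shows "approximable (\<Union>i. A i)"
  unfolding approximable_def
proof (intro conjI allI impI)
  have As: "A i \<in> sets (Rn m)" for i using A unfolding approximable_def by blast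
  then show U: "(\<Union>i. A i) \<in> sets (Rn m)" by (intro sets.countable_UN) blast
  fix e :: real assume e: "0 < e"
  define B where "B = (\<lambda>k. \<Union>i<k. A i)"
  have Bs: "B k \<in> sets (Rn m)" for k unfolding B_def by (intro sets.finite_UN) (use As in auto)
  have "(\<lambda>k. measure \<mu> (B k)) \<longlonglongrightarrow> measure \<mu> (\<Union>k. B k)"
  proof (rule finite_Lim_measure_incseq)
    show "range B \<subseteq> sets \<mu>" using Bs sets_mu by auto
    show "incseq B" unfolding B_def by (intro monoI UN_mono) auto
  qed
  also have "(\<Union>k. B k) = (\<Union>i. A i)" by (auto simp: B_def)
  finally have "\<forall>\<^sub>F k in sequentially. measure \<mu> (\<Union>i. A i) - e / 2 < measure \<mu> (B k)"
    by (rule order_tendstoD(1)) (use e in simp)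
  then obtain K where K: "measure \<mu> (\<Union>i. A i) - e / 2 < measure \<mu> (B K)"
    by (auto simp: eventually_sequentially)
  have tail: "measure \<mu> ((\<Union>i. A i) - B K) < e / 2"
  proof -
    have "measure \<mu> ((\<Union>i. A i) - B K) = measure \<mu> (\<Union>i. A i) - measure \<mu> (B K)"
      by (rule finite_measure_Diff) (use U Bs sets_mu in \<open>auto simp: B_def\<close>)
    then show ?thesis using K by linarith
  qed
  \<comment> \<open>An equal share of e / 2 for each of the K cutoffs; K + 1 keeps the quotient
    meaningful for K = 0.\<close>
  define d where "d = e / (2 * (real K + 1))"
  have d: "0 < d" using e by (simp add: d_def)
  have "\<exists>h. cutoff m h \<and> (\<integral>z. \<bar>h z - indicator (A i) z\<bar> \<partial>\<mu>) < d" for i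
    using A d unfolding approximable_def by blast
  then obtain h where h: "\<And>i. cutoff m (h i)" "\<And>i. (\<integral>z. \<bar>h i z - indicator (A i) z\<bar> \<partial>\<mu>) < d"
    by metis
  define H where "H = (\<lambda>z. 1 - (\<Prod>i<K. 1 - h i z))"
  have cH: "cutoff m H" unfolding H_def
    by (intro cutoff_compl cutoff_prod h) auto
  \<comment> \<open>On the finite union one good factor suffices; on the remainder of the union the
    indicator of the tail pays; outside the union every h_i equals its own error.\<close>
  have pw: "\<bar>H z - indicator (\<Union>i. A i) z\<bar>
      \<le> (\<Sum>i<K. \<bar>h i z - indicator (A i) z\<bar>) + indicator ((\<Union>i. A i) - B K) z" if z: "z \<in> space (Rn m)" for z
  proof -
    have hz: "0 \<le> h i z \<and> h i z \<le> 1" for i using cutoffD(2,3)[OF h(1) z] by auto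
    have Hz: "0 \<le> H z" "H z \<le> 1" using cutoffD(2,3)[OF cH z] by auto
    have S0: "0 \<le> (\<Sum>i<K. \<bar>h i z - indicator (A i) z\<bar>)" by (intro sum_nonneg) simp
    show ?thesis
    proof (cases "z \<in> B K")
      case True
      then obtain i where i: "i < K" "z \<in> A i" by (auto simp: B_def)
      have "(\<Prod>i<K. 1 - h i z) = (1 - h i z) * (\<Prod>j\<in>{..<K}-{i}. 1 - h j z)"
        using i by (intro prod.remove) auto
      also have "\<dots> \<le> (1 - h i z) * 1"
        using hz by (intro mult_left_mono prod_le_1) auto
      finally have "1 - H z \<le> \<bar>h i z - indicator (A i) z\<bar>" using i hz[of i] by (simp add: H_def)
      also have "\<dots> \<le> (\<Sum>i<K. \<bar>h i z - indicator (A i) z\<bar>)"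
        by (rule member_le_sum) (use i in auto)
      finally show ?thesis using Hz i True by (auto simp: indicator_def)
    next
      case F: False
      show ?thesis
      proof (cases "z \<in> (\<Union>i. A i)")
        case True
        then have i: "indicator (\<Union>i. A i) z = (1 :: real)" "indicator ((\<Union>i. A i) - B K) z = (1 :: real)"
          using F by simp_all
        show ?thesis unfolding i using Hz S0 by linarith
      next
        case False
        then have nA: "z \<notin> A i" for i by auto
        have "H z \<le> (\<Sum>i<K. h i z)" unfolding H_def by (rule one_minus_prod_le_sum) (use hz in auto)
        also have "\<dots> = (\<Sum>i<K. \<bar>h i z - indicator (A i) z\<bar>)"
          using nA hz by (intro sum.cong) auto
        finally show ?thesis using False Hz by (simp add: indicator_def)
      qed
    qed
  qed
  have it: "integrable \<mu> (indicator ((\<Union>i. A i) - B K) :: _ \<Rightarrow> real)"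
    using U Bs sets_mu by (intro integrable_real_indicator) (auto simp: emeasure_eq_measure)
  have "(\<integral>z. \<bar>H z - indicator (\<Union>i. A i) z\<bar> \<partial>\<mu>)
    \<le> (\<integral>z. (\<Sum>i<K. \<bar>h i z - indicator (A i) z\<bar>) + indicator ((\<Union>i. A i) - B K) z \<partial>\<mu>)"
    by (rule integral_mono)
      (use pw cutoff_diff_int[OF cH U] cutoff_diff_int[OF h(1) As] it in \<open>auto simp: space_mu\<close>)
  also have "\<dots> = (\<Sum>i<K. (\<integral>z. \<bar>h i z - indicator (A i) z\<bar> \<partial>\<mu>)) + measure \<mu> ((\<Union>i. A i) - B K)"
  proof -
    have "(\<integral>z. indicator ((\<Union>i. A i) - B K) z \<partial>\<mu>) = measure \<mu> ((\<Union>i. A i) - B K)"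
      using U Bs sets_mu sets.sets_into_space[of "(\<Union>i. A i) - B K" \<mu>] by (simp add: Int_absorb2)
    then show ?thesis
      using cutoff_diff_int[OF h(1) As] it
      by (subst Bochner_Integration.integral_add) (auto simp: Bochner_Integration.integral_sum)
  qed
  also have "\<dots> < (\<Sum>i<K. d) + e / 2"
    using h(2) tail by (intro add_le_less_mono sum_mono) (auto intro: less_imp_le)
  also have "\<dots> \<le> e"
  proof -
    have "real K * d \<le> e / 2" using e by (simp add: d_def field_simps)
    then show ?thesis by simp
  qed
  finally show "\<exists>h. cutoff m h \<and> (\<integral>z. \<bar>h z - indicator (\<Union>i. A i) z\<bar> \<partial>\<mu>) < e"
    using cH by blast
qed

text \<open>Steeper and steeper arctangents converge pointwise to the indicator, and constants
  dominate because the measure is finite.\<close>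

lemma approximable_halfspace:
  assumes k: "k < m" shows "approximable {z \<in> space (Rn m). z k \<le> a}"
  unfolding approximable_def
proof (intro conjI allI impI)
  let ?A = "{z \<in> space (Rn m). z k \<le> a}"
  show A: "?A \<in> sets (Rn m)"
    using measurable_component_Rn[OF k] by measurable
  fix e :: real assume e: "0 < e"
  let ?h = "\<lambda>j z. arctan (real j * a + sqrt (real j) + - real j * z k) / pi + 1 / 2"
  have c: "cutoff m (?h j)" for j by (rule cutoff_arctan[OF k])
  have "(\<lambda>j. \<integral>z. \<bar>?h j z - indicator ?A z\<bar> \<partial>\<mu>) \<longlonglongrightarrow> (\<integral>z. 0 \<partial>\<mu>)"
  proof (rule integral_dominated_convergence[where w="\<lambda>_. 1"])
    show "(\<lambda>z. \<bar>?h j z - indicator ?A z\<bar>) \<in> borel_measurable \<mu>" for j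
      using cutoff_diff_int[OF c A] by (rule borel_measurable_integrable)
    show "AE z in \<mu>. (\<lambda>j. \<bar>?h j z - indicator ?A z\<bar>) \<longlonglongrightarrow> 0"
    proof (rule AE_I2)
      fix z assume z: "z \<in> space \<mu>"
      have "indicator ?A z = (indicator {..a} (z k) :: real)" using z by (simp add: space_mu indicator_def)
      then show "(\<lambda>j. \<bar>?h j z - indicator ?A z\<bar>) \<longlonglongrightarrow> 0"
        using step_limit[of a "z k"] by (simp add: tendsto_rabs_zero_iff LIM_zero_iff)
    qed
    show "AE z in \<mu>. norm \<bar>?h j z - indicator ?A z\<bar> \<le> 1" for j
      unfolding real_norm_def abs_abs
      by (intro AE_I2 abs_diff_indicator_le cutoffD(2,3)[OF c]) (simp_all only: space_mu)
  qed simp_all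
  then have "\<forall>\<^sub>F j in sequentially. (\<integral>z. \<bar>?h j z - indicator ?A z\<bar> \<partial>\<mu>) < e"
    using e by (intro order_tendstoD(2)) auto
  then obtain j where "(\<integral>z. \<bar>?h j z - indicator ?A z\<bar> \<partial>\<mu>) < e" by (auto simp: eventually_sequentially)
  then show "\<exists>h. cutoff m h \<and> (\<integral>z. \<bar>h z - indicator ?A z\<bar> \<partial>\<mu>) < e" using c by blast
qed

text \<open>Induction over the sigma-algebra generated by the closed half-lines; every generating
  operation is known to preserve approximability.\<close>

lemma approximable_coordinate:
  assumes k: "k < m" and B: "B \<in> sets (borel :: real measure)"
  shows "approximable {z \<in> space (Rn m). z k \<in> B}"
proof -
  have "B \<in> sigma_sets UNIV (range (\<lambda>a::real. {..a}))"
    using B by (subst (asm) borel_eq_atMost) simp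
  then show ?thesis
  proof (induct B rule: sigma_sets.induct)
    case (Basic B)
    then show ?case using approximable_halfspace[OF k] by auto
  next
    case Empty
    show ?case using approximable_empty by simp
  next
    case (Compl B)
    have "{z \<in> space (Rn m). z k \<in> UNIV - B} = space (Rn m) - {z \<in> space (Rn m). z k \<in> B}" by auto
    then show ?case using approximable_compl[OF Compl(2)] by simp
  next
    case (Union B)
    have "{z \<in> space (Rn m). z k \<in> (\<Union>i. B i)} = (\<Union>i. {z \<in> space (Rn m). z k \<in> B i})" by auto
    then show ?case using approximable_Union[OF Union(2)] by simp
  qed
qed

lemma approximable_sets: assumes A: "A \<in> sets (Rn m)" shows "approximable A"
proof -
  have "A \<in> sigma_sets (\<Pi>\<^sub>E i\<in>{..<m}. UNIV) {{f \<in> \<Pi>\<^sub>E i\<in>{..<m}. UNIV. f i \<in> B} | i B. i \<in> {..<m} \<and> B \<in> sets (borel::real measure)}"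
    using A by (simp add: sets_PiM_single)
  moreover have "(\<Pi>\<^sub>E i\<in>{..<m}. UNIV) = space (Rn m)" by (simp add: space_PiM)
  ultimately have "A \<in> sigma_sets (space (Rn m)) {{f \<in> space (Rn m). f i \<in> B} | i B. i \<in> {..<m} \<and> B \<in> sets (borel::real measure)}"
    by simp
  then show ?thesis
  proof (induct A rule: sigma_sets.induct)
    case (Basic A)
    then show ?case using approximable_coordinate by auto
  qed (use approximable_empty approximable_compl approximable_Union in auto)
qed

text \<open>The level sets are approximated one by one. The supremum bound does not depend on the
  accuracy \<open>e\<close>, which later keeps the exponentials of the approximants under
  control.\<close>

lemma approximate_simple:
  fixes \<phi> :: "(nat \<Rightarrow> real) \<Rightarrow> real"
  assumes \<phi>: "\<phi> \<in> borel_measurable (Rn m)" and fin: "finite (\<phi> ` space (Rn m))" and e: "0 < e"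
  obtains \<alpha> \<beta> D g p where "tame m m \<alpha> \<beta> D g p"
    "\<And>z. z \<in> space (Rn m) \<Longrightarrow> \<bar>g z\<bar> \<le> (\<Sum>y\<in>\<phi> ` space (Rn m). \<bar>y\<bar>)"
    "(\<integral>z. \<bar>g z - \<phi> z\<bar> \<partial>\<mu>) \<le> (\<Sum>y\<in>\<phi> ` space (Rn m). \<bar>y\<bar>) * e"
proof -
  let ?Y = "\<phi> ` space (Rn m)"
  define A where "A = (\<lambda>y. {z \<in> space (Rn m). \<phi> z = y})"
  have As: "A y \<in> sets (Rn m)" for y unfolding A_def using \<phi> by measurable
  have "\<exists>h. cutoff m h \<and> (\<integral>z. \<bar>h z - indicator (A y) z\<bar> \<partial>\<mu>) < e" for y
    using approximable_sets[OF As] e unfolding approximable_def by blast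
  then obtain h where h: "\<And>y. cutoff m (h y)" "\<And>y. (\<integral>z. \<bar>h y z - indicator (A y) z\<bar> \<partial>\<mu>) < e" by metis
  define g where "g = (\<lambda>z. \<Sum>y\<in>?Y. y * h y z)"
  have "\<exists>\<alpha> \<beta> D p. tame m m \<alpha> \<beta> D (\<lambda>z. \<Sum>y\<in>Y. y * h y z) p" if "finite Y" for Y
    using that
  proof (induct Y rule: finite_induct)
    case empty
    have "tame m m 0 0 0 (\<lambda>_. 0) (\<lambda>_ _. 0)" by (simp add: tame_def)
    then show ?case by auto
  next
    case (insert y Y)
    then obtain \<alpha> \<beta> D p where 1: "tame m m \<alpha> \<beta> D (\<lambda>z. \<Sum>y\<in>Y. y * h y z) p" by blast
    obtain D' p' where "tame m m 0 1 D' (h y) p'" using h(1)[of y] unfolding cutoff_def by blast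
    from tame_add[OF tame_scale[OF this, of y] 1] show ?case using insert(1,2) by auto
  qed
  from this[OF fin] obtain \<alpha> \<beta> D p where t: "tame m m \<alpha> \<beta> D g p" unfolding g_def by blast
  show thesis
  proof (rule that[OF t])
    show "\<bar>g z\<bar> \<le> (\<Sum>y\<in>?Y. \<bar>y\<bar>)" if z: "z \<in> space (Rn m)" for z
    proof -
      have "\<bar>g z\<bar> \<le> (\<Sum>y\<in>?Y. \<bar>y * h y z\<bar>)" unfolding g_def by (rule sum_abs)
      also have "\<dots> \<le> (\<Sum>y\<in>?Y. \<bar>y\<bar>)"
      proof (rule sum_mono)
        fix y
        have "\<bar>y * h y z\<bar> \<le> \<bar>y\<bar> * 1" unfolding abs_mult using cutoffD(2,3)[OF h(1) z]
          by (intro mult_left_mono) auto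
        then show "\<bar>y * h y z\<bar> \<le> \<bar>y\<bar>" by simp
      qed
      finally show ?thesis .
    qed
    have pw: "\<bar>g z - \<phi> z\<bar> \<le> (\<Sum>y\<in>?Y. \<bar>y\<bar> * \<bar>h y z - indicator (A y) z\<bar>)" if z: "z \<in> space (Rn m)" for z
    proof -
      have "(\<Sum>y\<in>?Y. y * indicator (A y) z) = (\<Sum>y\<in>?Y. if y = \<phi> z then y else 0)"
        using z by (intro sum.cong) (auto simp: A_def indicator_def)
      also have "\<dots> = \<phi> z" using fin z by simp
      finally have "g z - \<phi> z = (\<Sum>y\<in>?Y. y * (h y z - indicator (A y) z))"
        by (simp add: g_def right_diff_distrib sum_subtractf)
      also have "\<bar>\<dots>\<bar> \<le> (\<Sum>y\<in>?Y. \<bar>y * (h y z - indicator (A y) z)\<bar>)" by (rule sum_abs)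
      finally show ?thesis by (simp add: abs_mult)
    qed
    have iR: "integrable \<mu> (\<lambda>z. \<Sum>y\<in>?Y. \<bar>y\<bar> * \<bar>h y z - indicator (A y) z\<bar>)"
      by (intro Bochner_Integration.integrable_sum integrable_mult_right cutoff_diff_int h As)
    have gm: "(\<lambda>z. \<bar>g z - \<phi> z\<bar>) \<in> borel_measurable \<mu>"
      unfolding meas_mu using tameD(3)[OF t] \<phi> by (intro borel_measurable_abs borel_measurable_diff)
    have iL: "integrable \<mu> (\<lambda>z. \<bar>g z - \<phi> z\<bar>)"
      by (rule Bochner_Integration.integrable_bound[OF iR gm]) (use pw in \<open>auto simp: space_mu intro!: AE_I2 order_trans[OF _ abs_ge_self]\<close>)
    have "(\<integral>z. \<bar>g z - \<phi> z\<bar> \<partial>\<mu>) \<le> (\<integral>z. (\<Sum>y\<in>?Y. \<bar>y\<bar> * \<bar>h y z - indicator (A y) z\<bar>) \<partial>\<mu>)"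
      by (rule integral_mono[OF iL iR]) (use pw in \<open>simp add: space_mu\<close>)
    also have "\<dots> = (\<Sum>y\<in>?Y. \<bar>y\<bar> * (\<integral>z. \<bar>h y z - indicator (A y) z\<bar> \<partial>\<mu>))"
      by (subst Bochner_Integration.integral_sum) (auto intro!: integrable_mult_right cutoff_diff_int h As)
    also have "\<dots> \<le> (\<Sum>y\<in>?Y. \<bar>y\<bar> * e)"
      using h(2) by (intro sum_mono mult_left_mono) (auto intro: less_imp_le)
    also have "\<dots> = (\<Sum>y\<in>?Y. \<bar>y\<bar>) * e" by (simp add: sum_distrib_right)
    finally show "(\<integral>z. \<bar>g z - \<phi> z\<bar> \<partial>\<mu>) \<le> (\<Sum>y\<in>?Y. \<bar>y\<bar>) * e" .
  qed
qed

end

section \<open>Splitting points into system and reservoir coordinates\<close>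

lemma merge_measurable:
  "(\<lambda>(v, w). merge_vw M N v w) \<in> measurable (Rn M \<Otimes>\<^sub>M Rn N) (Rn (M + N))"
proof (rule measurable_RnI)
  fix i assume i: "i < M + N"
  show "(\<lambda>x. (case x of (v, w) \<Rightarrow> merge_vw M N v w) i) \<in> borel_measurable (Rn M \<Otimes>\<^sub>M Rn N)"
  proof (cases "i < M")
    case True
    then have "(\<lambda>x. fst x i) \<in> borel_measurable (Rn M \<Otimes>\<^sub>M Rn N)"
      by (intro measurable_compose[OF measurable_fst measurable_component_Rn])
    then show ?thesis using True by (simp add: merge_vw_def split_beta)
  next
    case False
    then have "(\<lambda>x. snd x (i - M)) \<in> borel_measurable (Rn M \<Otimes>\<^sub>M Rn N)"
      using i by (intro measurable_compose[OF measurable_snd measurable_component_Rn]) auto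
    then show ?thesis using False i by (simp add: merge_vw_def split_beta)
  qed
qed (auto simp: merge_vw_def)

text \<open>Checked on boxes, whose preimage is the product of a system box and a reservoir
  box.\<close>

lemma distr_merge_Rn:
  "distr (Rn M \<Otimes>\<^sub>M Rn N) (Rn (M + N)) (\<lambda>(v, w). merge_vw M N v w) = Rn (M + N)"
proof (rule lb.PiM_eqI)
  fix A :: "nat \<Rightarrow> real set" assume "\<And>i. i \<in> {..<M + N} \<Longrightarrow> A i \<in> sets lborel"
  then have A: "i < M + N \<Longrightarrow> A i \<in> sets lborel" for i by simp
  let ?P = "Pi\<^sub>E {..<M + N} A"
  have P: "?P \<in> sets (Rn (M + N))" by (rule sets_PiM_I_finite) (use A in auto)
  let ?A1 = "Pi\<^sub>E {..<M} A" and ?A2 = "Pi\<^sub>E {..<N} (\<lambda>j. A (M + j))"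
  have eq: "(\<lambda>(v, w). merge_vw M N v w) -` ?P \<inter> space (Rn M \<Otimes>\<^sub>M Rn N) = ?A1 \<times> ?A2"
  proof (intro set_eqI iffI)
    fix x assume "x \<in> (\<lambda>(v, w). merge_vw M N v w) -` ?P \<inter> space (Rn M \<Otimes>\<^sub>M Rn N)"
    then obtain v w where x: "x = (v, w)" "v \<in> space (Rn M)" "w \<in> space (Rn N)" "merge_vw M N v w \<in> ?P"
      by (auto simp: space_pair_measure)
    have "v i \<in> A i" if "i < M" for i
      using PiE_mem[OF x(4), of i] that by (simp add: merge_vw_def)
    moreover have "w j \<in> A (M + j)" if "j < N" for j
      using PiE_mem[OF x(4), of "M + j"] that by (simp add: merge_vw_def)
    ultimately show "x \<in> ?A1 \<times> ?A2" using x by (auto simp: space_Rn PiE_def)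
  next
    fix x assume "x \<in> ?A1 \<times> ?A2"
    then obtain v w where x: "x = (v, w)" "v \<in> ?A1" "w \<in> ?A2" by auto
    have "merge_vw M N v w \<in> ?P"
    proof (rule PiE_I)
      fix i assume "i \<in> {..<M + N}"
      then show "merge_vw M N v w i \<in> A i"
        using PiE_mem[OF x(2), of i] PiE_mem[OF x(3), of "i - M"] by (auto simp: merge_vw_def)
    qed (auto simp: merge_vw_def)
    then show "x \<in> (\<lambda>(v, w). merge_vw M N v w) -` ?P \<inter> space (Rn M \<Otimes>\<^sub>M Rn N)"
      using x by (auto simp: space_pair_measure space_Rn PiE_def)
  qed
  have "emeasure (distr (Rn M \<Otimes>\<^sub>M Rn N) (Rn (M + N)) (\<lambda>(v, w). merge_vw M N v w)) ?P
    = emeasure (Rn M \<Otimes>\<^sub>M Rn N) (?A1 \<times> ?A2)"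
    unfolding eq[symmetric] by (rule emeasure_distr[OF merge_measurable P])
  also have "\<dots> = emeasure (Rn M) ?A1 * emeasure (Rn N) ?A2"
    by (rule Rn.emeasure_pair_measure_Times) (auto intro!: sets_PiM_I_finite A[simplified] simp del: sets_Rn)
  also have "emeasure (Rn M) ?A1 = (\<Prod>i<M. emeasure lborel (A i))"
    by (rule lb.emeasure_PiM) (use A in auto)
  also have "emeasure (Rn N) ?A2 = (\<Prod>j<N. emeasure lborel (A (M + j)))"
    by (rule lb.emeasure_PiM) (use A in auto)
  also have "(\<Prod>i<M. emeasure lborel (A i)) * (\<Prod>j<N. emeasure lborel (A (M + j))) = (\<Prod>i<M + N. emeasure lborel (A i))"
    by (induct N) (simp_all add: mult.assoc[symmetric])
  finally show "emeasure (distr (Rn M \<Otimes>\<^sub>M Rn N) (Rn (M + N)) (\<lambda>(v, w). merge_vw M N v w)) ?P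
    = (\<Prod>i<M + N. emeasure lborel (A i))" .
qed simp_all

lemma pair_sf_Rn: "pair_sigma_finite (Rn M) (Rn N)"
  by (simp add: pair_sigma_finite_def Rn.sigma_finite_measure_axioms)

lemma integral_merge:
  fixes H :: "(nat \<Rightarrow> real) \<Rightarrow> real"
  assumes H: "integrable (Rn (M + N)) H"
  shows "integrable (Rn M \<Otimes>\<^sub>M Rn N) (\<lambda>p. H (merge_vw M N (fst p) (snd p)))"
    and "integrable (Rn M) (\<lambda>v. \<integral>w. H (merge_vw M N v w) \<partial>Rn N)"
    and "(\<integral>v. (\<integral>w. H (merge_vw M N v w) \<partial>Rn N) \<partial>Rn M) = (\<integral>z. H z \<partial>Rn (M + N))"
proof -
  interpret P: pair_sigma_finite "Rn M" "Rn N" by (rule pair_sf_Rn)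
  have Hm: "H \<in> borel_measurable (Rn (M + N))" using H by simp
  have H': "integrable (distr (Rn M \<Otimes>\<^sub>M Rn N) (Rn (M + N)) (\<lambda>(v, w). merge_vw M N v w)) H"
    unfolding distr_merge_Rn by (rule H)
  show i: "integrable (Rn M \<Otimes>\<^sub>M Rn N) (\<lambda>p. H (merge_vw M N (fst p) (snd p)))"
    using integrable_distr_eq[OF merge_measurable Hm] H' by (simp add: split_beta)
  show "integrable (Rn M) (\<lambda>v. \<integral>w. H (merge_vw M N v w) \<partial>Rn N)"
    using P.integrable_fst'[OF i] by simp
  have "(\<integral>z. H z \<partial>Rn (M + N)) = (\<integral>z. H z \<partial>distr (Rn M \<Otimes>\<^sub>M Rn N) (Rn (M + N)) (\<lambda>(v, w). merge_vw M N v w))"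
    by (simp only: distr_merge_Rn)
  also have "\<dots> = (\<integral>p. H (merge_vw M N (fst p) (snd p)) \<partial>(Rn M \<Otimes>\<^sub>M Rn N))"
    by (subst integral_distr[OF merge_measurable Hm]) (simp add: split_beta)
  also have "\<dots> = (\<integral>v. (\<integral>w. H (merge_vw M N v w) \<partial>Rn N) \<partial>Rn M)"
    using P.integral_fst'[OF i] by simp
  finally show "(\<integral>v. (\<integral>w. H (merge_vw M N v w) \<partial>Rn N) \<partial>Rn M) = (\<integral>z. H z \<partial>Rn (M + N))" ..
qed

lemma restrict_measurable: "M \<le> n \<Longrightarrow> (\<lambda>z. restrict z {..<M}) \<in> measurable (Rn n) (Rn M)"
  by (rule measurable_RnI) (auto intro: measurable_component_Rn)

lemma restrict_merge: "v \<in> space (Rn M) \<Longrightarrow> restrict (merge_vw M N v w) {..<M} = v"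
  by (auto simp: merge_vw_def space_Rn extensional_def fun_eq_iff)

lemma gauss_merge: "gauss N (\<lambda>j. merge_vw M N v w (M + j)) = gauss N w"
  by (simp add: gauss_def merge_vw_def)

lemma gauss_shift_measurable: "(\<lambda>z. gauss N (\<lambda>j. z (M + j))) \<in> borel_measurable (Rn (M + N))"
proof -
  have "(\<lambda>z. \<Sum>j<N. (z (M + j))\<^sup>2) \<in> borel_measurable (Rn (M + N))"
    by (intro borel_measurable_sum borel_measurable_power measurable_component_Rn) auto
  then show ?thesis unfolding gauss_def by measurable
qed

lemma gauss_split: "gauss (M + N) z = gauss M (restrict z {..<M}) * gauss N (\<lambda>j. z (M + j))"
proof -
  have "(\<Sum>i<M + N. (z i)\<^sup>2) = (\<Sum>i<M. (z i)\<^sup>2) + (\<Sum>j<N. (z (M + j))\<^sup>2)"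
    by (induct N) simp_all
  then show ?thesis unfolding gauss_def by (simp add: distrib_left flip: exp_add)
qed

lemma gauss_pos: "0 < gauss n z" by (simp add: gauss_def)

lemma gam_integral:
  assumes "f \<in> borel_measurable (Rn n)"
  shows "(\<integral>z. f z \<partial>gam n) = (\<integral>z. gauss n z * (f z :: real) \<partial>Rn n)"
    and "integrable (gam n) f \<longleftrightarrow> integrable (Rn n) (\<lambda>z. gauss n z * f z)"
proof -
  have g: "AE z in Rn n. 0 \<le> gauss n z" using gauss_pos[of n, THEN less_imp_le] by simp
  show "(\<integral>z. f z \<partial>gam n) = (\<integral>z. gauss n z * f z \<partial>Rn n)"
    unfolding gam_eq_density using integral_density[OF assms measurable_gauss g] by simp
  show "integrable (gam n) f \<longleftrightarrow> integrable (Rn n) (\<lambda>z. gauss n z * f z)"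
    unfolding gam_eq_density using integrable_density[OF assms measurable_gauss g] by simp
qed

lemma gauss_integrable: "integrable (Rn n) (gauss n)" "(\<integral>z. gauss n z \<partial>Rn n) = 1"
proof -
  have "integrable (gam n) (\<lambda>_. 1 :: real)" by simp
  then show "integrable (Rn n) (gauss n)" by (subst (asm) gam_integral) simp_all
  have "(\<integral>z. (1 :: real) \<partial>gam n) = 1" by (simp add: gam.prob_space)
  then show "(\<integral>z. gauss n z \<partial>Rn n) = 1" by (subst (asm) gam_integral) simp_all
qed

text \<open>The reservoir Gaussian has mass one, so integrals against a product state reduce to the
  system.\<close>

lemma integral_product_Rn:
  fixes a :: "(nat \<Rightarrow> real) \<Rightarrow> real"
  assumes a: "integrable (Rn M) a"
  shows "integrable (Rn (M + N)) (\<lambda>z. a (restrict z {..<M}) * gauss N (\<lambda>j. z (M + j)))"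
    and "(\<integral>z. a (restrict z {..<M}) * gauss N (\<lambda>j. z (M + j)) \<partial>Rn (M + N)) = (\<integral>v. a v \<partial>Rn M)"
proof -
  let ?H = "\<lambda>z. a (restrict z {..<M}) * gauss N (\<lambda>j. z (M + j))"
  interpret P: pair_sigma_finite "Rn M" "Rn N" by (rule pair_sf_Rn)
  have am: "a \<in> borel_measurable (Rn M)" using a by simp
  have Hm: "?H \<in> borel_measurable (Rn (M + N))"
    by (intro borel_measurable_times gauss_shift_measurable measurable_compose[OF restrict_measurable am]) simp
  have "integrable (Rn M \<Otimes>\<^sub>M Rn N) (\<lambda>p. a (fst p) * gauss N (snd p))"
  proof (rule P.Fubini_integrable)
    show "(\<lambda>p. a (fst p) * gauss N (snd p)) \<in> borel_measurable (Rn M \<Otimes>\<^sub>M Rn N)"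
      by (intro borel_measurable_times measurable_compose[OF measurable_fst am] measurable_compose[OF measurable_snd measurable_gauss])
    have "(\<integral>w. norm (a (fst (v, w)) * gauss N (snd (v, w))) \<partial>Rn N) = \<bar>a v\<bar>" for v
      using gauss_integrable[of N] gauss_pos[of N, THEN less_imp_le] by (simp add: abs_mult)
    then show "integrable (Rn M) (\<lambda>v. \<integral>w. norm (a (fst (v, w)) * gauss N (snd (v, w))) \<partial>Rn N)"
      using a by simp
    show "AE v in Rn M. integrable (Rn N) (\<lambda>w. a (fst (v, w)) * gauss N (snd (v, w)))"
      using gauss_integrable[of N] by simp
  qed
  moreover have "a (fst p) * gauss N (snd p) = ?H (case p of (v, w) \<Rightarrow> merge_vw M N v w)"
    if "p \<in> space (Rn M \<Otimes>\<^sub>M Rn N)" for p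
    using that by (auto simp: restrict_merge gauss_merge space_pair_measure)
  ultimately have "integrable (Rn M \<Otimes>\<^sub>M Rn N) (\<lambda>p. ?H (case p of (v, w) \<Rightarrow> merge_vw M N v w))"
    by (rule Bochner_Integration.integrable_cong[THEN iffD1, rotated 2, OF _ refl])
  then have "integrable (distr (Rn M \<Otimes>\<^sub>M Rn N) (Rn (M + N)) (\<lambda>(v, w). merge_vw M N v w)) ?H"
    by (subst integrable_distr_eq[OF merge_measurable Hm])
  then show i: "integrable (Rn (M + N)) ?H" unfolding distr_merge_Rn .
  have "(\<integral>z. ?H z \<partial>Rn (M + N)) = (\<integral>v. (\<integral>w. ?H (merge_vw M N v w) \<partial>Rn N) \<partial>Rn M)"
    by (rule integral_merge(3)[OF i, symmetric])
  also have "\<dots> = (\<integral>v. (\<integral>w. a v * gauss N w \<partial>Rn N) \<partial>Rn M)"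
    by (intro Bochner_Integration.integral_cong refl) (simp add: restrict_merge gauss_merge)
  also have "\<dots> = (\<integral>v. a v \<partial>Rn M)" using gauss_integrable[of N] by simp
  finally show "(\<integral>z. ?H z \<partial>Rn (M + N)) = (\<integral>v. a v \<partial>Rn M)" .
qed

text \<open>The system marginal of the Gaussian. It turns the right side of
  \<open>entropic_ineq\<close>, which lives on all coordinates, into an integral over the
  system.\<close>

lemma gam_restrict:
  fixes f :: "(nat \<Rightarrow> real) \<Rightarrow> real"
  assumes f: "f \<in> borel_measurable (Rn M)" "\<And>v. v \<in> space (Rn M) \<Longrightarrow> \<bar>f v\<bar> \<le> c"
  shows "(\<integral>z. f (restrict z {..<M}) \<partial>gam (M + N)) = (\<integral>v. f v \<partial>gam M)"
proof -
  have fr: "(\<lambda>z. f (restrict z {..<M})) \<in> borel_measurable (Rn (M + N))"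
    by (rule measurable_compose[OF restrict_measurable f(1)]) simp
  have "integrable (gam M) f"
    by (rule integrable_bounded_gam[where c=c]) (use f in \<open>auto simp: measurable_gam_Rn\<close>)
  then have i: "integrable (Rn M) (\<lambda>v. gauss M v * f v)" using gam_integral(2)[OF f(1)] by simp
  have "(\<integral>z. f (restrict z {..<M}) \<partial>gam (M + N))
    = (\<integral>z. (gauss M (restrict z {..<M}) * f (restrict z {..<M})) * gauss N (\<lambda>j. z (M + j)) \<partial>Rn (M + N))"
    unfolding gam_integral(1)[OF fr] gauss_split by (simp add: mult_ac)
  also have "\<dots> = (\<integral>v. gauss M v * f v \<partial>Rn M)" by (rule integral_product_Rn(2)[OF i])
  also have "\<dots> = (\<integral>v. f v \<partial>gam M)" by (rule gam_integral(1)[OF f(1), symmetric])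
  finally show ?thesis .
qed

lemma tame_lift:
  assumes t: "tame M M a b D g p" and Mn: "M \<le> n"
  shows "tame n M a b D (\<lambda>z. g (restrict z {..<M})) (\<lambda>i z. p i (restrict z {..<M}))"
proof -
  note T = tameD[OF t]
  have sp: "restrict z {..<M} \<in> space (Rn M)" for z :: "nat \<Rightarrow> real" by (simp add: space_Rn)
  have v: "restrict (vadd n z s w) {..<M} = vadd M (restrict z {..<M}) s w" for z s w
    using Mn by (auto simp: vadd_def fun_eq_iff)
  have le: "nsq M w \<le> nsq n w" for w unfolding nsq_def using Mn by (intro sum_mono2) auto
  show ?thesis unfolding tame_def
  proof (intro conjI ballI allI impI)
    show "(\<lambda>z. g (restrict z {..<M})) \<in> borel_measurable (Rn n)"
      by (rule measurable_compose[OF restrict_measurable[OF Mn] T(3)])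
    show "(\<lambda>z. p i (restrict z {..<M})) \<in> borel_measurable (Rn n)" if "i < M" for i
      by (rule measurable_compose[OF restrict_measurable[OF Mn] T(4)[OF that]])
    fix z s w
    have "D * (\<bar>s\<bar> * sqrt (nsq M w)) \<le> D * (\<bar>s\<bar> * sqrt (nsq n w))"
      using le T(2) by (intro mult_left_mono) auto
    then show "\<bar>g (restrict (vadd n z s w) {..<M}) - g (restrict z {..<M})\<bar> \<le> D * (\<bar>s\<bar> * sqrt (nsq n w))"
      unfolding v using T(8)[OF sp, of z s w] by linarith
    have "D * (s\<^sup>2 * nsq M w) \<le> D * (s\<^sup>2 * nsq n w)"
      using le T(2) by (intro mult_left_mono) auto
    then show "\<bar>g (restrict (vadd n z s w) {..<M}) - g (restrict z {..<M}) - s * (\<Sum>i<M. p i (restrict z {..<M}) * w i)\<bar>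
      \<le> D * (s\<^sup>2 * nsq n w)"
      unfolding v using T(9)[OF sp, of z s w] by linarith
  qed (use T sp Mn in auto)
qed

section \<open>Entropy decay\<close>

text \<open>The Fenchel-Young inequality for the conjugate pair h ln h - h and exp, obtained from 1
  + x <= exp x at x = u - ln h.\<close>

lemma gibbs_pointwise:
  fixes h u :: real
  assumes "0 \<le> h"
  shows "h * u \<le> h * ln h - h + exp u"
proof (cases "h = 0")
  case False
  then have h: "0 < h" using assms by simp
  have "1 + (u - ln h) \<le> exp (u - ln h)" by (rule exp_ge_add_one_self)
  then have "h * (1 + (u - ln h)) \<le> h * exp (u - ln h)" using h by (intro mult_left_mono) auto
  also have "h * exp (u - ln h) = exp u" using h by (simp add: exp_diff)
  finally show ?thesis by (simp add: algebra_simps)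
qed simp

lemma mult_ln_ge: "0 < (h::real) \<Longrightarrow> - 1 \<le> h * ln h"
proof -
  assume h: "0 < h"
  have "h * (1 - 1 / h) \<le> h * ln h"
    using h ln_le_minus_one[of "1 / h"] by (intro mult_left_mono) (auto simp: ln_div)
  moreover have "h * (1 - 1 / h) = h - 1" using h by (simp add: right_diff_distrib)
  ultimately show ?thesis using h by linarith
qed

lemma pos_integral:
  fixes f :: "'a \<Rightarrow> real"
  assumes "prob_space P" "integrable P f" "\<And>x. x \<in> space P \<Longrightarrow> c \<le> f x" "0 < c"
  shows "0 < (\<integral>x. f x \<partial>P)"
proof -
  interpret prob_space P by fact
  have "c = (\<integral>x. c \<partial>P)" by (simp add: prob_space)
  also have "\<dots> \<le> (\<integral>x. f x \<partial>P)" by (rule integral_mono) (use assms in auto)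
  finally show ?thesis using assms(4) by simp
qed

text \<open>\<open>ent_int\<close> confines the argument to finite initial entropy; in the other
  case the right side of the final bound is infinite.\<close>

locale kac_evolution = kac +
  fixes t :: real and f0 :: "(nat \<Rightarrow> real) \<Rightarrow> real" and G :: "(nat \<Rightarrow> real) \<Rightarrow> real"
  assumes t: "0 \<le> t"
    and f0_meas: "f0 \<in> borel_measurable (Rn M)"
    and f0_nonneg: "\<And>v. 0 \<le> f0 v"
    and f0_int: "integrable (Rn M) f0"
    and f0_one: "(\<integral>v. f0 v \<partial>Rn M) = 1"
    and G_exp: "is_exp_gen M N lamS lamR mu \<rho> t
           (\<lambda>z. f0 (restrict z {..<M}) * gauss N (\<lambda>j. z (M + j))) G"
    and ent_int: "integrable (Rn M) (\<lambda>v. f0 v * ln (f0 v / gauss M v))"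
begin

definition F0 :: "(nat \<Rightarrow> real) \<Rightarrow> real" where
  "F0 z = f0 (restrict z {..<M}) * gauss N (\<lambda>j. z (M + j))"

definition ft :: "(nat \<Rightarrow> real) \<Rightarrow> real" where
  "ft v = (\<integral>w. G (merge_vw M N v w) \<partial>Rn N)"

definition D0 :: real where "D0 = (\<integral>v. f0 v * ln (f0 v / gauss M v) \<partial>Rn M)"

sublocale RI: rand_iso "Om t" RR n M "CC t" by (rule rand_iso_Om[OF t])

lemma F0_int: "integrable (Rn n) F0" and F0_one: "(\<integral>z. F0 z \<partial>Rn n) = 1"
  unfolding F0_def using integral_product_Rn[OF f0_int] f0_one by auto

lemma G_int: "integrable (Rn n) G"
  by (rule exp_gen_dual(1)[OF t F0_int]) (use G_exp in \<open>simp add: F0_def[abs_def]\<close>)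

lemma ft_int: "integrable (Rn M) ft"
  unfolding ft_def by (rule integral_merge(2)[OF G_int])

lemma ft_dual:
  fixes \<phi> :: "(nat \<Rightarrow> real) \<Rightarrow> real"
  assumes m: "\<phi> \<in> borel_measurable (Rn M)" and b: "\<And>v. v \<in> space (Rn M) \<Longrightarrow> \<bar>\<phi> v\<bar> \<le> c"
  shows "(\<integral>v. \<phi> v * ft v \<partial>Rn M) = (\<integral>z. RI.Kop (\<lambda>z. \<phi> (restrict z {..<M})) z * F0 z \<partial>Rn n)"
proof -
  let ?P = "\<lambda>z. \<phi> (restrict z {..<M})"
  have Pm: "?P \<in> borel_measurable (Rn n)"
    by (rule measurable_compose[OF restrict_measurable m]) simp
  have Pb: "\<bar>?P z\<bar> \<le> c" for z by (rule b) (simp add: space_Rn)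
  have iPG: "integrable (Rn n) (\<lambda>z. ?P z * G z)" by (rule integrable_bounded_mult[OF G_int Pm Pb])
  have "(\<integral>v. \<phi> v * ft v \<partial>Rn M) = (\<integral>v. (\<integral>w. ?P (merge_vw M N v w) * G (merge_vw M N v w) \<partial>Rn N) \<partial>Rn M)"
    unfolding ft_def by (intro Bochner_Integration.integral_cong refl) (simp add: restrict_merge)
  also have "\<dots> = (\<integral>z. ?P z * G z \<partial>Rn n)" by (rule integral_merge(3)[OF iPG])
  also have "\<dots> = (\<integral>z. RI.Kop ?P z * F0 z \<partial>Rn n)"
    unfolding RI.Kop_def
    by (rule exp_gen_dual(2)[OF t F0_int _ Pm Pb]) (use G_exp in \<open>simp add: F0_def[abs_def]\<close>)
  finally show ?thesis .
qed

lemma ft_one: "(\<integral>v. ft v \<partial>Rn M) = 1"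
proof -
  have "(\<integral>v. 1 * ft v \<partial>Rn M) = (\<integral>z. RI.Kop (\<lambda>z. 1) z * F0 z \<partial>Rn n)"
    by (rule ft_dual[where c=1]) auto
  moreover have "RI.Kop (\<lambda>z. 1) z = 1" for z by (simp add: RI.Kop_def RI.prob_space)
  ultimately show ?thesis using F0_one by simp
qed

text \<open>\<open>G\<close> is merely an L^1 limit of signed partial sums, so positivity comes by
  duality: tested with the indicator of its negative set, \<open>ft\<close> gives a nonnegative
  number, hence that set is null.\<close>

lemma ft_nonneg: "AE v in Rn M. 0 \<le> ft v"
proof -
  let ?A = "{v \<in> space (Rn M). ft v < 0}"
  have fm: "ft \<in> borel_measurable (Rn M)" using ft_int by simp
  have A: "?A \<in> sets (Rn M)" using fm by measurable
  have F0n: "0 \<le> F0 z" for z using f0_nonneg gauss_pos[of N] by (simp add: F0_def less_imp_le)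
  have "0 \<le> (\<integral>z. RI.Kop (\<lambda>z. indicator ?A (restrict z {..<M})) z * F0 z \<partial>Rn n)"
    by (intro integral_nonneg_AE AE_I2 mult_nonneg_nonneg F0n) (simp add: RI.Kop_def)
  also have "\<dots> = (\<integral>v. indicator ?A v * ft v \<partial>Rn M)"
    by (rule ft_dual[symmetric, where c=1]) (use borel_measurable_indicator[OF A] in auto)
  finally have 1: "0 \<le> (\<integral>v. indicator ?A v * ft v \<partial>Rn M)" .
  have i: "integrable (Rn M) (\<lambda>v. indicator ?A v * ft v)"
    by (rule integrable_bounded_mult[OF ft_int, where c=1]) (use borel_measurable_indicator[OF A] in auto)
  have np: "indicator ?A v * ft v \<le> 0" for v by (auto simp: indicator_def)
  have "(\<integral>v. - (indicator ?A v * ft v) \<partial>Rn M) = 0"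
  proof (rule antisym)
    show "(\<integral>v. - (indicator ?A v * ft v) \<partial>Rn M) \<le> 0" using 1 by simp
    show "0 \<le> (\<integral>v. - (indicator ?A v * ft v) \<partial>Rn M)"
      by (rule Bochner_Integration.integral_nonneg) (use np in simp)
  qed
  moreover have "integrable (Rn M) (\<lambda>v. - (indicator ?A v * ft v))" using i by (rule integrable_minus)
  moreover have "AE v in Rn M. 0 \<le> - (indicator ?A v * ft v)" using np by simp
  ultimately have "AE v in Rn M. - (indicator ?A v * ft v) = 0"
    using integral_nonneg_eq_0_iff_AE by blast
  then show ?thesis by (rule AE_mp) (auto intro!: AE_I2 simp: indicator_def not_less)
qed

text \<open>The Gibbs variational principle for the initial state tested against \<open>Kop g / CC t\<close>,
  combined with the entropic inequality for \<open>exp g\<close>.\<close>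
lemma variational_tame:
  assumes tg: "tame M M \<alpha> \<beta> E g p"
  shows "(\<integral>v. g v * ft v \<partial>Rn M) \<le> CC t * D0 + ln (\<integral>v. exp (g v) \<partial>gam M)"
proof -
  let ?P = "\<lambda>z. g (restrict z {..<M})"
  have C: "0 < CC t" by (rule CC_pos)
  have gb: "\<bar>g v\<bar> \<le> \<bar>\<alpha>\<bar> + \<bar>\<beta>\<bar>" if "v \<in> space (Rn M)" for v by (rule tame_abs[OF tg that])
  have tP: "tame n M \<alpha> \<beta> E ?P (\<lambda>i z. p i (restrict z {..<M}))" by (rule tame_lift[OF tg]) simp
  have tE: "tame n M (exp \<alpha>) (exp \<beta>) (exp \<beta> * (E + E\<^sup>2)) (\<lambda>z. exp (?P z)) (\<lambda>i z. exp (?P z) * p i (restrict z {..<M}))"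
    by (rule tame_exp[OF tP])
  define K where "K = RI.Kop ?P"
  have Km: "K \<in> borel_measurable (Rn n)" unfolding K_def by (rule RI.Kop_measurable[OF tameD(3)[OF tP]])
  have Kb: "\<bar>K z\<bar> \<le> \<bar>\<alpha>\<bar> + \<bar>\<beta>\<bar>" if "z \<in> space (Rn n)" for z
    unfolding K_def by (rule RI.Kop_abs[OF tameD(3)[OF tP] tame_abs[OF tP] that])
  define Z where "Z = (\<integral>z. exp (K z / CC t) \<partial>gam n)"
  have eKm: "(\<lambda>z. exp (K z / CC t)) \<in> borel_measurable (Rn n)" using Km by measurable
  have eKb: "exp (- (\<bar>\<alpha>\<bar> + \<bar>\<beta>\<bar>) / CC t) \<le> exp (K z / CC t)" "\<bar>exp (K z / CC t)\<bar> \<le> exp ((\<bar>\<alpha>\<bar> + \<bar>\<beta>\<bar>) / CC t)"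
    if z: "z \<in> space (Rn n)" for z
  proof -
    have "- (\<bar>\<alpha>\<bar> + \<bar>\<beta>\<bar>) \<le> K z" "K z \<le> \<bar>\<alpha>\<bar> + \<bar>\<beta>\<bar>" using Kb[OF z] by auto
    then have "- (\<bar>\<alpha>\<bar> + \<bar>\<beta>\<bar>) / CC t \<le> K z / CC t" "K z / CC t \<le> (\<bar>\<alpha>\<bar> + \<bar>\<beta>\<bar>) / CC t"
      using C by (intro divide_right_mono; simp)+
    then show "exp (- (\<bar>\<alpha>\<bar> + \<bar>\<beta>\<bar>) / CC t) \<le> exp (K z / CC t)" "\<bar>exp (K z / CC t)\<bar> \<le> exp ((\<bar>\<alpha>\<bar> + \<bar>\<beta>\<bar>) / CC t)"
      by simp_all
  qed
  have iK: "integrable (gam n) (\<lambda>z. exp (K z / CC t))"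
    by (rule integrable_bounded_gam[OF _ eKb(2)]) (use eKm in \<open>simp add: measurable_gam_Rn\<close>)
  have Zpos: "0 < Z" unfolding Z_def
    by (rule pos_integral[OF prob_space_gam iK eKb(1)]) (auto simp: space_gam)
  have Zle: "ln Z \<le> ln (\<integral>v. exp (g v) \<partial>gam M) / CC t"
  proof -
    have "Z \<le> exp (ln (\<integral>z. exp (?P z) \<partial>gam n) / CC t)"
      using RI.entropic_ineq[OF tE exp_gt_zero] unfolding Z_def K_def by simp
    also have "(\<integral>z. exp (?P z) \<partial>gam n) = (\<integral>v. exp (g v) \<partial>gam M)"
    proof (rule gam_restrict[where c="exp (\<bar>\<alpha>\<bar> + \<bar>\<beta>\<bar>)"])
      show "(\<lambda>v. exp (g v)) \<in> borel_measurable (Rn M)" using tameD(3)[OF tg] by measurable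
      show "\<bar>exp (g v)\<bar> \<le> exp (\<bar>\<alpha>\<bar> + \<bar>\<beta>\<bar>)" if "v \<in> space (Rn M)" for v using gb[OF that] by auto
    qed
    finally have "ln Z \<le> ln (exp (ln (\<integral>v. exp (g v) \<partial>gam M) / CC t))"
      using Zpos by (subst ln_le_cancel_iff) auto
    then show ?thesis by simp
  qed
  \<comment> \<open>Normalised so that exp u is a probability density with respect to
    \<open>gam n\<close>; the last two terms of the pointwise Gibbs inequality then cancel on
    integration.\<close>
  define u where "u = (\<lambda>z. K z / CC t - ln Z)"
  have um: "u \<in> borel_measurable (Rn n)" unfolding u_def using Km by measurable
  have eu: "exp (u z) = exp (K z / CC t) / Z" for z using Zpos by (simp add: u_def exp_diff)
  have igu: "integrable (Rn n) (\<lambda>z. gauss n z * exp (u z))" "(\<integral>z. gauss n z * exp (u z) \<partial>Rn n) = 1"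
  proof -
    have "integrable (gam n) (\<lambda>z. exp (u z))" unfolding eu using iK by simp
    then show "integrable (Rn n) (\<lambda>z. gauss n z * exp (u z))"
      using gam_integral(2)[of "\<lambda>z. exp (u z)" n] um by simp
    have "(\<integral>z. exp (u z) \<partial>gam n) = 1" unfolding eu using Zpos by (simp add: Z_def)
    then show "(\<integral>z. gauss n z * exp (u z) \<partial>Rn n) = 1"
      using gam_integral(1)[of "\<lambda>z. exp (u z)" n] um by simp
  qed
  \<comment> \<open>The reservoir starts in equilibrium, so the density of the initial state
    relative to \<open>gam n\<close> is the system ratio alone, and its entropy is
    \<open>D0\<close>.\<close>
  let ?h = "\<lambda>z. f0 (restrict z {..<M}) / gauss M (restrict z {..<M})"
  let ?L = "\<lambda>z. (f0 (restrict z {..<M}) * ln (?h z)) * gauss N (\<lambda>j. z (M + j))"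
  have iL: "integrable (Rn n) ?L" "(\<integral>z. ?L z \<partial>Rn n) = D0"
    unfolding D0_def by (rule integral_product_Rn[OF ent_int])+
  have pw: "u z * F0 z \<le> ?L z - F0 z + gauss n z * exp (u z)" for z
  proof -
    have g: "0 < gauss M (restrict z {..<M})" "0 < gauss n z" by (rule gauss_pos)+
    have "?h z * u z \<le> ?h z * ln (?h z) - ?h z + exp (u z)"
      by (rule gibbs_pointwise) (use g f0_nonneg in simp)
    then have "gauss n z * (?h z * u z) \<le> gauss n z * (?h z * ln (?h z) - ?h z + exp (u z))"
      using g by (intro mult_left_mono) auto
    moreover have gh: "gauss n z * ?h z = F0 z"
      using g unfolding gauss_split F0_def by simp
    moreover have "gauss n z * (?h z * u z) = (gauss n z * ?h z) * u z" by simp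
    moreover have "gauss n z * (?h z * ln (?h z) - ?h z + exp (u z))
      = (gauss n z * ?h z) * ln (?h z) - gauss n z * ?h z + gauss n z * exp (u z)"
      by (simp only: distrib_left right_diff_distrib mult.assoc)
    ultimately have "F0 z * u z \<le> F0 z * ln (?h z) - F0 z + gauss n z * exp (u z)"
      unfolding gh by simp
    then show ?thesis unfolding F0_def by (simp add: mult_ac)
  qed
  have iKF: "integrable (Rn n) (\<lambda>z. K z * F0 z)" by (rule integrable_bounded_mult[OF F0_int Km Kb])
  have uF: "u z * F0 z = K z * F0 z / CC t - ln Z * F0 z" for z by (simp add: u_def left_diff_distrib)
  have iuF: "integrable (Rn n) (\<lambda>z. u z * F0 z)" unfolding uF using iKF F0_int by auto
  have "(\<integral>z. u z * F0 z \<partial>Rn n) \<le> (\<integral>z. ?L z - F0 z + gauss n z * exp (u z) \<partial>Rn n)"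
    by (rule integral_mono[OF iuF _ pw]) (use iL F0_int igu in auto)
  also have "\<dots> = D0" using iL F0_int igu F0_one by simp
  finally have "(\<integral>z. K z * F0 z \<partial>Rn n) / CC t - ln Z \<le> D0"
    unfolding uF using iKF F0_int F0_one by simp
  then have "(\<integral>z. K z * F0 z \<partial>Rn n) / CC t \<le> D0 + ln (\<integral>v. exp (g v) \<partial>gam M) / CC t"
    using Zle by linarith
  then have "(\<integral>z. K z * F0 z \<partial>Rn n) \<le> CC t * D0 + ln (\<integral>v. exp (g v) \<partial>gam M)"
    using C by (simp add: field_simps)
  then show ?thesis
    using ft_dual[OF tameD(3)[OF tg] gb] unfolding K_def by simp
qed

text \<open>Tame approximants converge to \<open>\<phi>\<close> in L^1 of a weighted measure, under
  a common supremum bound; both sides of \<open>variational_tame\<close> pass to the limit.\<close>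

lemma variational_simple:
  fixes \<phi> :: "(nat \<Rightarrow> real) \<Rightarrow> real"
  assumes m: "\<phi> \<in> borel_measurable (Rn M)" and fin: "finite (\<phi> ` space (Rn M))"
  shows "(\<integral>v. \<phi> v * ft v \<partial>Rn M) \<le> CC t * D0 + ln (\<integral>v. exp (\<phi> v) \<partial>gam M)"
proof -
  define B where "B = (\<Sum>y\<in>\<phi> ` space (Rn M). \<bar>y\<bar>)"
  \<comment> \<open>One weight dominating both the density in the linear term and the Gaussian in
    the exponential term, so that a single approximating sequence serves both limits.\<close>
  define wgt where "wgt = (\<lambda>v. \<bar>ft v\<bar> + gauss M v)"
  define \<mu> where "\<mu> = density (Rn M) (\<lambda>v. ennreal (wgt v))"
  have fm: "ft \<in> borel_measurable (Rn M)" using ft_int by simp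
  have wm: "wgt \<in> borel_measurable (Rn M)" unfolding wgt_def using fm by measurable
  have iw: "integrable (Rn M) wgt" unfolding wgt_def using ft_int gauss_integrable(1)[of M] by auto
  have w0: "0 \<le> wgt v" for v unfolding wgt_def using gauss_pos[of M v] by simp
  have sets_mu: "sets \<mu> = sets (Rn M)" by (simp add: \<mu>_def)
  have fmu: "finite_measure \<mu>"
  proof
    have "emeasure \<mu> (space \<mu>) = (\<integral>\<^sup>+ v. ennreal (wgt v) \<partial>Rn M)"
    proof -
      have "(\<lambda>v. ennreal (wgt v)) \<in> borel_measurable (Rn M)" using wm by measurable
      from emeasure_density[OF this sets.top] show ?thesis
        unfolding \<mu>_def space_density by (simp cong: nn_integral_cong)
    qed
    also have "\<dots> = ennreal (\<integral>v. wgt v \<partial>Rn M)" by (rule nn_integral_eq_integral[OF iw]) (use w0 in simp)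
    finally show "emeasure \<mu> (space \<mu>) \<noteq> \<infinity>" by simp
  qed
  have \<phi>b: "\<bar>\<phi> v\<bar> \<le> B" if "v \<in> space (Rn M)" for v
    unfolding B_def by (rule member_le_sum[of "\<phi> v" _ abs]) (use fin that in auto)
  have "\<exists>\<alpha> \<beta> E g p. tame M M \<alpha> \<beta> E g p \<and> (\<forall>v\<in>space (Rn M). \<bar>g v\<bar> \<le> B)
      \<and> (\<integral>v. \<bar>g v - \<phi> v\<bar> \<partial>\<mu>) \<le> B * (1 / real (Suc k))" for k
  proof (rule approximate_simple[OF fmu sets_mu m fin, of "1 / real (Suc k)"])
    show "0 < 1 / real (Suc k)" by simp
  qed (unfold B_def, blast)
  then obtain g where g: "\<And>k. \<exists>\<alpha> \<beta> E p. tame M M \<alpha> \<beta> E (g k) p"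
    "\<And>k v. v \<in> space (Rn M) \<Longrightarrow> \<bar>g k v\<bar> \<le> B" "\<And>k. (\<integral>v. \<bar>g k v - \<phi> v\<bar> \<partial>\<mu>) \<le> B * (1 / real (Suc k))"
    by metis
  have gm: "g k \<in> borel_measurable (Rn M)" for k using g(1)[of k] tameD(3) by blast
  have dm: "(\<lambda>v. \<bar>g k v - \<phi> v\<bar>) \<in> borel_measurable (Rn M)" for k
    using gm m by (intro borel_measurable_abs borel_measurable_diff)
  have db: "\<bar>g k v - \<phi> v\<bar> \<le> 2 * B" if "v \<in> space (Rn M)" for k v
    using g(2)[OF that, of k] \<phi>b[OF that] by linarith
  have di: "integrable (Rn M) (\<lambda>v. \<bar>g k v - \<phi> v\<bar> * wgt v)" for k
    by (rule integrable_bounded_mult[OF iw dm]) (use db in auto)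
  have dle: "(\<integral>v. \<bar>g k v - \<phi> v\<bar> * wgt v \<partial>Rn M) \<le> B * (1 / real (Suc k))" for k
  proof -
    have "(\<integral>v. \<bar>g k v - \<phi> v\<bar> \<partial>\<mu>) = (\<integral>v. wgt v * \<bar>g k v - \<phi> v\<bar> \<partial>Rn M)"
      unfolding \<mu>_def using integral_density[OF dm wm] w0 by simp
    then show ?thesis using g(3)[of k] by (simp add: mult.commute)
  qed
  have lim0: "(\<lambda>k. c * (B * (1 / real (Suc k)))) \<longlonglongrightarrow> 0" for c
  proof -
    have "(\<lambda>k. 1 / real (Suc k)) \<longlonglongrightarrow> 0" by real_asymp
    then have "(\<lambda>k. c * (B * (1 / real (Suc k)))) \<longlonglongrightarrow> c * (B * 0)" by (intro tendsto_mult tendsto_const)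
    then show ?thesis by simp
  qed
  have ig: "integrable (Rn M) (\<lambda>v. g k v * ft v)" for k by (rule integrable_bounded_mult[OF ft_int gm g(2)])
  have i\<phi>: "integrable (Rn M) (\<lambda>v. \<phi> v * ft v)" by (rule integrable_bounded_mult[OF ft_int m \<phi>b])
  have lim1: "(\<lambda>k. \<integral>v. g k v * ft v \<partial>Rn M) \<longlonglongrightarrow> (\<integral>v. \<phi> v * ft v \<partial>Rn M)"
  proof -
    have "\<bar>(\<integral>v. g k v * ft v \<partial>Rn M) - (\<integral>v. \<phi> v * ft v \<partial>Rn M)\<bar> \<le> 1 * (B * (1 / real (Suc k)))" for k
    proof -
      have "\<bar>(\<integral>v. g k v * ft v \<partial>Rn M) - (\<integral>v. \<phi> v * ft v \<partial>Rn M)\<bar> = \<bar>\<integral>v. g k v * ft v - \<phi> v * ft v \<partial>Rn M\<bar>"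
        using ig[of k] i\<phi> by simp
      also have "\<dots> \<le> (\<integral>v. \<bar>g k v * ft v - \<phi> v * ft v\<bar> \<partial>Rn M)" by (rule integral_abs_bound)
      also have "\<dots> \<le> (\<integral>v. \<bar>g k v - \<phi> v\<bar> * wgt v \<partial>Rn M)"
      proof (rule integral_mono[OF integrable_abs[OF Bochner_Integration.integrable_diff[OF ig i\<phi>]] di])
        show "\<bar>g k v * ft v - \<phi> v * ft v\<bar> \<le> \<bar>g k v - \<phi> v\<bar> * wgt v" for v
          unfolding left_diff_distrib[symmetric] abs_mult wgt_def
          using gauss_pos[of M v] by (intro mult_left_mono) auto
      qed
      finally show ?thesis using dle[of k] by simp
    qed
    then have "(\<lambda>k. (\<integral>v. g k v * ft v \<partial>Rn M) - (\<integral>v. \<phi> v * ft v \<partial>Rn M)) \<longlonglongrightarrow> 0"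
      by (intro tendsto_rabs_zero_cancel[OF tendsto_sandwich[OF _ _ tendsto_const lim0[of 1]]]) auto
    then show ?thesis by (simp add: LIM_zero_iff)
  qed
  have exm: "(\<lambda>v. exp (h v)) \<in> borel_measurable (gam M)" if "h \<in> borel_measurable (Rn M)" for h :: "_ \<Rightarrow> real"
    using that unfolding measurable_gam_Rn by measurable
  have exi: "integrable (gam M) (\<lambda>v. exp (h v))"
    if h: "h \<in> borel_measurable (Rn M)" "\<And>v. v \<in> space (Rn M) \<Longrightarrow> \<bar>h v\<bar> \<le> B" for h :: "_ \<Rightarrow> real"
  proof (rule integrable_bounded_gam[OF exm[OF h(1)]])
    show "\<bar>exp (h z)\<bar> \<le> exp B" if "z \<in> space (Rn M)" for z using h(2)[OF that] by auto
  qed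
  have lim2: "(\<lambda>k. \<integral>v. exp (g k v) \<partial>gam M) \<longlonglongrightarrow> (\<integral>v. exp (\<phi> v) \<partial>gam M)"
  proof -
    have "\<bar>(\<integral>v. exp (g k v) \<partial>gam M) - (\<integral>v. exp (\<phi> v) \<partial>gam M)\<bar> \<le> exp B * (B * (1 / real (Suc k)))" for k
    proof -
      note i1 = exi[OF gm g(2), of k] and i2 = exi[OF m \<phi>b]
      have dg: "integrable (gam M) (\<lambda>v. \<bar>g k v - \<phi> v\<bar>)"
        by (rule integrable_bounded_gam[where c="2 * B"]) (use dm db in \<open>auto simp: measurable_gam_Rn\<close>)
      have "\<bar>(\<integral>v. exp (g k v) \<partial>gam M) - (\<integral>v. exp (\<phi> v) \<partial>gam M)\<bar> = \<bar>\<integral>v. exp (g k v) - exp (\<phi> v) \<partial>gam M\<bar>"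
        using i1 i2 by simp
      also have "\<dots> \<le> (\<integral>v. \<bar>exp (g k v) - exp (\<phi> v)\<bar> \<partial>gam M)" by (rule integral_abs_bound)
      also have "\<dots> \<le> (\<integral>v. exp B * \<bar>g k v - \<phi> v\<bar> \<partial>gam M)"
      proof (rule gam_integral_mono[OF integrable_abs[OF Bochner_Integration.integrable_diff[OF i1 i2]]])
        show "integrable (gam M) (\<lambda>v. exp B * \<bar>g k v - \<phi> v\<bar>)" using dg by simp
        show "\<bar>exp (g k v) - exp (\<phi> v)\<bar> \<le> exp B * \<bar>g k v - \<phi> v\<bar>" if "v \<in> space (Rn M)" for v
          using exp_diff_bound(2)[of "\<phi> v" B "g k v"] g(2)[OF that, of k] \<phi>b[OF that] by (simp add: abs_le_iff)
      qed
      also have "\<dots> = exp B * (\<integral>v. gauss M v * \<bar>g k v - \<phi> v\<bar> \<partial>Rn M)"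
        using gam_integral(1)[OF dm, of k] by simp
      also have "\<dots> \<le> exp B * (\<integral>v. \<bar>g k v - \<phi> v\<bar> * wgt v \<partial>Rn M)"
      proof (intro mult_left_mono integral_mono[OF _ di])
        show "integrable (Rn M) (\<lambda>v. gauss M v * \<bar>g k v - \<phi> v\<bar>)" using gam_integral(2)[OF dm, of k] dg by simp
        show "gauss M v * \<bar>g k v - \<phi> v\<bar> \<le> \<bar>g k v - \<phi> v\<bar> * wgt v" for v
          unfolding wgt_def mult.commute[of "gauss M v"] by (intro mult_left_mono) auto
      qed auto
      also have "\<dots> \<le> exp B * (B * (1 / real (Suc k)))" by (intro mult_left_mono dle) auto
      finally show ?thesis .
    qed
    then have "(\<lambda>k. (\<integral>v. exp (g k v) \<partial>gam M) - (\<integral>v. exp (\<phi> v) \<partial>gam M)) \<longlonglongrightarrow> 0"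
      by (intro tendsto_rabs_zero_cancel[OF tendsto_sandwich[OF _ _ tendsto_const lim0[of "exp B"]]]) auto
    then show ?thesis by (simp add: LIM_zero_iff)
  qed
  have pos: "0 < (\<integral>v. exp (\<phi> v) \<partial>gam M)"
  proof (rule pos_integral[OF prob_space_gam exi[OF m \<phi>b], of "exp (- B)"])
    show "exp (- B) \<le> exp (\<phi> v)" if "v \<in> space (gam M)" for v
      using \<phi>b[of v] that by (simp add: space_gam abs_le_iff)
  qed auto
  have "(\<lambda>k. CC t * D0 + ln (\<integral>v. exp (g k v) \<partial>gam M)) \<longlonglongrightarrow> CC t * D0 + ln (\<integral>v. exp (\<phi> v) \<partial>gam M)"
    using pos by (intro tendsto_add tendsto_const tendsto_ln lim2) auto
  moreover have "(\<integral>v. g k v * ft v \<partial>Rn M) \<le> CC t * D0 + ln (\<integral>v. exp (g k v) \<partial>gam M)" for k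
    using g(1)[of k] variational_tame by blast
  ultimately show ?thesis using lim1 by (intro LIMSEQ_le) auto
qed

section \<open>Entropy as a limit over truncated logarithms\<close>

definition fp :: "(nat \<Rightarrow> real) \<Rightarrow> real" where "fp v = max 0 (ft v)"

definition hp :: "(nat \<Rightarrow> real) \<Rightarrow> real" where "hp v = fp v / gauss M v"

lemma fp_meas: "fp \<in> borel_measurable (Rn M)"
  unfolding fp_def using ft_int by simp

lemma hp_meas: "hp \<in> borel_measurable (Rn M)"
  unfolding hp_def using fp_meas by measurable

text \<open>Positivity of \<open>ft\<close> is known only almost everywhere; \<open>fp\<close> is
  the version that is nonnegative at every point, so that pointwise estimates of h ln h apply to
  it.\<close>

lemma fp_AE: "AE v in Rn M. fp v = ft v"
  using ft_nonneg by (rule AE_mp) (auto simp: fp_def intro!: AE_I2)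

lemma fp_int: "integrable (Rn M) fp" and fp_one: "(\<integral>v. fp v \<partial>Rn M) = 1"
proof -
  show "integrable (Rn M) fp"
    using integrable_cong_AE[OF fp_meas _ fp_AE] ft_int by simp
  show "(\<integral>v. fp v \<partial>Rn M) = 1"
    using integral_cong_AE[OF fp_meas _ fp_AE] ft_int ft_one by simp
qed

text \<open>In HOL \<open>ln 0 = 0\<close>, hence the case distinction.\<close>
definition clip :: "nat \<Rightarrow> (nat \<Rightarrow> real) \<Rightarrow> real" where
  "clip k v = (if hp v = 0 then - real k else max (- real k) (min (real k) (ln (hp v))))"

text \<open>Rounding \<open>clip\<close> down to multiples of 1 / k leaves finitely many values, as
  \<open>variational_simple\<close> demands, and costs at most 1 / k.\<close>

definition phi :: "nat \<Rightarrow> (nat \<Rightarrow> real) \<Rightarrow> real" where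
  "phi k v = of_int \<lfloor>real k * clip k v\<rfloor> / real k"

lemma clip_meas: "clip k \<in> borel_measurable (Rn M)"
  unfolding clip_def using hp_meas by measurable

lemma clip_bound: "\<bar>clip k v\<bar> \<le> real k" unfolding clip_def by auto

lemma phi_bounds:
  assumes k: "0 < k"
  shows "phi k v \<le> clip k v" "clip k v - 1 / real k \<le> phi k v"
proof -
  have 1: "of_int \<lfloor>real k * clip k v\<rfloor> \<le> real k * clip k v" "real k * clip k v - 1 \<le> of_int \<lfloor>real k * clip k v\<rfloor>"
    by linarith+
  from divide_right_mono[OF 1(1), of "real k"] show "phi k v \<le> clip k v" using k by (simp add: phi_def)
  from divide_right_mono[OF 1(2), of "real k"] show "clip k v - 1 / real k \<le> phi k v"
    using k by (simp add: phi_def diff_divide_distrib)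
qed

lemma phi_meas: "phi k \<in> borel_measurable (Rn M)"
  unfolding phi_def using clip_meas by measurable

lemma phi_finite: "finite (phi k ` A)"
proof (rule finite_subset)
  have "\<lfloor>real k * clip k v\<rfloor> \<in> {- int (k * k) - 1..int (k * k)}" for v
  proof -
    have "\<bar>real k * clip k v\<bar> \<le> real k * real k"
      unfolding abs_mult using clip_bound[of k v] by (intro mult_mono) auto
    then have "- (real k * real k) \<le> real k * clip k v" "real k * clip k v \<le> real k * real k" by (auto simp: abs_le_iff)
    then have "- real (k * k) \<le> real k * clip k v" "real k * clip k v \<le> real (k * k)" by simp_all
    from this[THEN floor_mono]
    have "\<lfloor>- real (k * k)\<rfloor> \<le> \<lfloor>real k * clip k v\<rfloor>" "\<lfloor>real k * clip k v\<rfloor> \<le> \<lfloor>real (k * k)\<rfloor>" .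
    moreover have "\<lfloor>real (k * k)\<rfloor> = int (k * k)" "\<lfloor>- real (k * k)\<rfloor> = - int (k * k)"
      by (simp_all only: floor_of_nat floor_minus ceiling_of_nat)
    ultimately show ?thesis by auto
  qed
  then show "phi k ` A \<subseteq> (\<lambda>i. of_int i / real k) ` {- int (k * k) - 1..int (k * k)}"
    by (auto simp: phi_def)
qed simp

text \<open>Truncation from above only decreases the exponential; truncation from below raises it to
  at most exp (- k), also at the zeros of \<open>hp\<close>.\<close>

lemma exp_clip: "exp (clip k v) \<le> hp v + exp (- real k)"
proof (cases "hp v = 0")
  case False
  moreover have "0 \<le> hp v" using gauss_pos[of M v] by (simp add: hp_def fp_def)
  ultimately have h: "0 < hp v" by simp
  have "clip k v \<le> max (- real k) (ln (hp v))" using False by (auto simp: clip_def)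
  then have "exp (clip k v) \<le> max (exp (- real k)) (exp (ln (hp v)))"
    by (metis exp_le_cancel_iff max_def)
  then show ?thesis using h by (auto simp: max_def split: if_splits intro: order_trans)
qed (simp add: clip_def)

lemma clip_int: "integrable (Rn M) (\<lambda>v. clip k v * fp v)"
  by (rule integrable_bounded_mult[OF fp_int clip_meas clip_bound])

text \<open>The optimal test function in the variational formula is ln \<open>hp\<close>: its
  exponential has Gaussian integral 1, so the logarithmic term vanishes. Truncation costs exp (- k),
  rounding 1 / k.\<close>

lemma clip_bound_integral:
  assumes k: "0 < k"
  shows "(\<integral>v. clip k v * fp v \<partial>Rn M) \<le> CC t * D0 + exp (- real k) + 1 / real k"
proof -
  have pb: "\<bar>phi k v\<bar> \<le> real k + 1" for v
  proof -
    have "1 / real k \<le> 1" using k by simp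
    then show ?thesis using phi_bounds[OF k, of v] clip_bound[of k v] by linarith
  qed
  have ih: "integrable (gam M) hp" and eh: "(\<integral>v. hp v \<partial>gam M) = 1"
  proof -
    have e: "gauss M v * hp v = fp v" for v using gauss_pos[of M v] by (simp add: hp_def)
    show "integrable (gam M) hp" using gam_integral(2)[OF hp_meas] fp_int by (simp add: e)
    show "(\<integral>v. hp v \<partial>gam M) = 1" using gam_integral(1)[OF hp_meas] fp_one by (simp add: e)
  qed
  have iphi: "integrable (gam M) (\<lambda>v. exp (phi k v))"
  proof (rule integrable_bounded_gam)
    show "(\<lambda>v. exp (phi k v)) \<in> borel_measurable (gam M)" unfolding measurable_gam_Rn using phi_meas by measurable
    show "\<bar>exp (phi k v)\<bar> \<le> exp (real k + 1)" for v using pb[of v] by (auto simp: abs_le_iff)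
  qed
  have "(\<integral>v. exp (phi k v) \<partial>gam M) \<le> (\<integral>v. hp v + exp (- real k) \<partial>gam M)"
  proof (rule gam_integral_mono[OF iphi])
    show "integrable (gam M) (\<lambda>v. hp v + exp (- real k))" using ih by simp
    show "exp (phi k v) \<le> hp v + exp (- real k)" for v
      using phi_bounds(1)[OF k, of v] exp_clip[of k v] by (meson exp_le_cancel_iff order_trans)
  qed
  also have "\<dots> = 1 + exp (- real k)" using ih eh by (simp add: gam.prob_space)
  finally have le: "(\<integral>v. exp (phi k v) \<partial>gam M) \<le> 1 + exp (- real k)" .
  have pos: "0 < (\<integral>v. exp (phi k v) \<partial>gam M)"
  proof (rule pos_integral[OF prob_space_gam iphi, of "exp (- (real k + 1))"])
    show "exp (- (real k + 1)) \<le> exp (phi k v)" for v using pb[of v] unfolding exp_le_cancel_iff by linarith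
  qed simp
  have lnle: "ln (\<integral>v. exp (phi k v) \<partial>gam M) \<le> exp (- real k)"
    using ln_le_minus_one[OF pos] le by linarith
  have iphif: "integrable (Rn M) (\<lambda>v. phi k v * fp v)"
    by (rule integrable_bounded_mult[OF fp_int phi_meas pb])
  have "(\<integral>v. phi k v * fp v \<partial>Rn M) = (\<integral>v. phi k v * ft v \<partial>Rn M)"
  proof (rule integral_cong_AE)
    show "(\<lambda>v. phi k v * fp v) \<in> borel_measurable (Rn M)" "(\<lambda>v. phi k v * ft v) \<in> borel_measurable (Rn M)"
      using phi_meas fp_meas ft_int by (auto intro!: borel_measurable_times)
    show "AE v in Rn M. phi k v * fp v = phi k v * ft v" using fp_AE by (rule AE_mp) simp
  qed
  also have "\<dots> \<le> CC t * D0 + ln (\<integral>v. exp (phi k v) \<partial>gam M)"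
    by (rule variational_simple[OF phi_meas phi_finite])
  finally have 1: "(\<integral>v. phi k v * fp v \<partial>Rn M) \<le> CC t * D0 + exp (- real k)" using lnle by linarith
  have "(\<integral>v. clip k v * fp v \<partial>Rn M) \<le> (\<integral>v. phi k v * fp v + 1 / real k * fp v \<partial>Rn M)"
  proof (rule integral_mono[OF clip_int])
    show "integrable (Rn M) (\<lambda>v. phi k v * fp v + 1 / real k * fp v)" using iphif fp_int by simp
    show "clip k v * fp v \<le> phi k v * fp v + 1 / real k * fp v" for v
      unfolding distrib_right[symmetric] using phi_bounds(2)[OF k, of v]
      by (intro mult_right_mono) (auto simp: fp_def)
  qed
  also have "\<dots> = (\<integral>v. phi k v * fp v \<partial>Rn M) + 1 / real k" using iphif fp_int fp_one by simp
  finally show ?thesis using 1 by linarith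
qed

text \<open>Fatou's lemma along the truncated logarithms. Adding the Gaussian, of mass one, makes
  the integrands nonnegative because h ln h >= -1; it is subtracted again at the end.\<close>

lemma fp_entropy:
  "integrable (Rn M) (\<lambda>v. fp v * ln (hp v))" "(\<integral>v. fp v * ln (hp v) \<partial>Rn M) \<le> CC t * D0"
proof -
  define X where "X = (\<lambda>k v. clip (Suc k) v * fp v + gauss M v)"
  define Y where "Y = (\<lambda>v. fp v * ln (hp v) + gauss M v)"
  have fpg: "fp v = hp v * gauss M v" for v using gauss_pos[of M v] by (simp add: hp_def)
  have h0: "0 \<le> hp v" for v using gauss_pos[of M v] by (simp add: hp_def fp_def)
  \<comment> \<open>Where \<open>clip\<close> is negative and \<open>hp\<close> positive,
    \<open>clip\<close> lies above ln \<open>hp\<close>, so the lower bound for h ln h is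
    inherited.\<close>
  have hc: "- 1 \<le> clip k v * hp v" for k v
  proof (cases "hp v = 0")
    case False
    then have h: "0 < hp v" using h0[of v] by simp
    show ?thesis
    proof (cases "0 \<le> clip k v")
      case True
      then have "0 \<le> clip k v * hp v" using h by simp
      then show ?thesis by linarith
    next
      case F: False
      then have "ln (hp v) \<le> clip k v" using False by (auto simp: clip_def min_def max_def split: if_splits)
      then have "hp v * ln (hp v) \<le> hp v * clip k v" using h by (intro mult_left_mono) auto
      then show ?thesis using mult_ln_ge[OF h] by (simp add: mult.commute)
    qed
  qed simp
  have X0: "0 \<le> X k v" for k v
  proof -
    have "X k v = (clip (Suc k) v * hp v + 1) * gauss M v" by (simp add: X_def fpg algebra_simps)
    then show ?thesis using hc[of "Suc k" v] gauss_pos[of M v] by simp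
  qed
  have Xm: "X k \<in> borel_measurable (Rn M)" for k
    unfolding X_def using clip_meas[of "Suc k"] fp_meas by (intro borel_measurable_add borel_measurable_times measurable_gauss)
  have Ym: "Y \<in> borel_measurable (Rn M)" unfolding Y_def using fp_meas hp_meas by measurable
  have lim: "(\<lambda>k. X k v) \<longlonglongrightarrow> Y v" for v
  proof (cases "hp v = 0")
    case True
    then show ?thesis by (simp add: X_def Y_def fpg)
  next
    case False
    have "\<forall>\<^sub>F k in sequentially. clip (Suc k) v = ln (hp v)"
    proof -
      \<comment> \<open>Truncation is inactive as soon as the level exceeds |ln (hp v)|, so the
        sequence is eventually constant.\<close>
      obtain m where m: "\<bar>ln (hp v)\<bar> \<le> real m" using real_arch_simple by blast
      show ?thesis
      proof (rule eventually_sequentiallyI[of m])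
        fix k assume "m \<le> k"
        then have "\<bar>ln (hp v)\<bar> \<le> real (Suc k)" using m by simp
        then show "clip (Suc k) v = ln (hp v)" using False by (simp add: clip_def abs_le_iff max_def min_def)
      qed
    qed
    then have "\<forall>\<^sub>F k in sequentially. X k v = Y v"
      by eventually_elim (simp add: X_def Y_def)
    then show ?thesis by (rule tendsto_eventually)
  qed
  have Y0: "0 \<le> Y v" for v by (rule LIMSEQ_le_const[OF lim]) (use X0 in auto)
  define b where "b = (\<lambda>k. CC t * D0 + exp (- real (Suc k)) + 1 / real (Suc k) + 1)"
  have iX: "integrable (Rn M) (X k)" for k unfolding X_def using clip_int[of "Suc k"] gauss_integrable(1)[of M] by simp
  have bX: "(\<integral>v. X k v \<partial>Rn M) \<le> b k" for k
    using clip_bound_integral[of "Suc k"] clip_int[of "Suc k"] gauss_integrable[of M] by (simp add: X_def b_def)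
  have limb: "b \<longlonglongrightarrow> CC t * D0 + 0 + 0 + 1"
    unfolding b_def by (intro tendsto_add tendsto_const) real_asymp+
  have b0: "0 \<le> CC t * D0 + 1"
  proof (rule LIMSEQ_le_const)
    show "b \<longlonglongrightarrow> CC t * D0 + 1" using limb by simp
    show "\<exists>N. \<forall>k\<ge>N. 0 \<le> b k"
      using bX X0 by (meson Bochner_Integration.integral_nonneg order_trans)
  qed
  have nnX: "(\<integral>\<^sup>+ v. ennreal (X k v) \<partial>Rn M) = ennreal (\<integral>v. X k v \<partial>Rn M)" for k
    by (rule nn_integral_eq_integral[OF iX]) (use X0 in simp)
  have "(\<integral>\<^sup>+ v. ennreal (Y v) \<partial>Rn M) = (\<integral>\<^sup>+ v. liminf (\<lambda>k. ennreal (X k v)) \<partial>Rn M)"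
  proof (rule nn_integral_cong)
    fix v
    have "(\<lambda>k. ennreal (X k v)) \<longlonglongrightarrow> ennreal (Y v)" using lim by (rule tendsto_ennrealI)
    then show "ennreal (Y v) = liminf (\<lambda>k. ennreal (X k v))"
      by (rule lim_imp_Liminf[OF sequentially_bot, symmetric])
  qed
  also have "\<dots> \<le> liminf (\<lambda>k. \<integral>\<^sup>+ v. ennreal (X k v) \<partial>Rn M)"
    by (rule nn_integral_liminf) (use Xm in simp)
  also have "\<dots> \<le> liminf (\<lambda>k. ennreal (b k))"
    unfolding nnX by (rule Liminf_mono) (use bX in \<open>auto intro!: always_eventually ennreal_leI\<close>)
  also have "\<dots> = ennreal (CC t * D0 + 1)"
    using tendsto_ennrealI[OF limb] by (intro lim_imp_Liminf) simp_all
  finally have nnY: "(\<integral>\<^sup>+ v. ennreal (Y v) \<partial>Rn M) \<le> ennreal (CC t * D0 + 1)" .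
  have iY: "integrable (Rn M) Y"
  proof (rule integrableI_nonneg[OF Ym])
    show "AE v in Rn M. 0 \<le> Y v" using Y0 by simp
    show "(\<integral>\<^sup>+ v. ennreal (Y v) \<partial>Rn M) < \<infinity>" by (rule le_less_trans[OF nnY]) simp
  qed
  have "ennreal (\<integral>v. Y v \<partial>Rn M) \<le> ennreal (CC t * D0 + 1)"
    using nnY nn_integral_eq_integral[OF iY] Y0 by simp
  then have eY: "(\<integral>v. Y v \<partial>Rn M) \<le> CC t * D0 + 1" using b0 by (simp add: ennreal_le_iff)
  have e: "fp v * ln (hp v) = Y v - gauss M v" for v by (simp add: Y_def)
  show "integrable (Rn M) (\<lambda>v. fp v * ln (hp v))" unfolding e using iY gauss_integrable(1)[of M] by simp
  show "(\<integral>v. fp v * ln (hp v) \<partial>Rn M) \<le> CC t * D0"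
    unfolding e using iY gauss_integrable[of M] eY by simp
qed

theorem entropy_decay: "rel_entropy M ft \<le> ereal (CC t) * rel_entropy M f0"
proof -
  have ft_m: "(\<lambda>v. ft v * ln (ft v / gauss M v)) \<in> borel_measurable (Rn M)"
    using ft_int by (intro borel_measurable_times borel_measurable_ln borel_measurable_divide measurable_gauss) auto
  have fp_m: "(\<lambda>v. fp v * ln (hp v)) \<in> borel_measurable (Rn M)"
    using fp_entropy(1) by (rule borel_measurable_integrable)
  have ae: "AE v in Rn M. fp v * ln (hp v) = ft v * ln (ft v / gauss M v)"
    using fp_AE by (rule AE_mp) (simp add: hp_def)
  have i: "integrable (Rn M) (\<lambda>v. ft v * ln (ft v / gauss M v))"
    using integrable_cong_AE[OF fp_m ft_m ae] fp_entropy(1) by simp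
  have "(\<integral>v. ft v * ln (ft v / gauss M v) \<partial>Rn M) \<le> CC t * D0"
    using integral_cong_AE[OF fp_m ft_m ae] fp_entropy(2) by simp
  then show ?thesis using i ent_int by (simp add: rel_entropy_def D0_def)
qed

end

theorem theorem2p1:
  fixes M N :: nat and lamS lamR mu t :: real and \<rho> :: "real \<Rightarrow> real"
    and f0 :: "(nat \<Rightarrow> real) \<Rightarrow> real" and G :: "(nat \<Rightarrow> real) \<Rightarrow> real"
  assumes "0 < M" and "M \<le> N"
    and "0 < lamS" and "0 < lamR" and "0 < mu"
    and "\<rho> \<in> borel_measurable lborel"
    and "\<forall>\<theta>\<in>{-pi..pi}. 0 \<le> \<rho> \<theta>"
    and "set_integrable lborel {-pi..pi} \<rho>"
    and "(LINT \<theta>:{-pi..pi}|lborel. \<rho> \<theta>) = 1"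
    and "(\<lambda>k::int. norm (LINT \<theta>:{-pi..pi}|lborel.
            complex_of_real (\<rho> \<theta>) * exp (- \<i> * of_int k * of_real \<theta>))) summable_on UNIV"
    and "(LINT \<theta>:{-pi..pi}|lborel. \<rho> \<theta> * sin \<theta> * cos \<theta>) = 0"
    and "f0 \<in> borel_measurable (Rn M)"
    and "\<forall>v. 0 \<le> f0 v"
    and "integrable (Rn M) f0"
    and "(\<integral>v. f0 v \<partial>Rn M) = 1"
    and "0 \<le> t"
    and "is_exp_gen M N lamS lamR mu \<rho> t
           (\<lambda>z. f0 (restrict z {..<M}) * gauss N (\<lambda>j. z (M + j))) G"
  shows "rel_entropy M (\<lambda>v. \<integral>w. G (merge_vw M N v w) \<partial>Rn N)
         \<le> ereal (real M / real (N + M) + real N / real (N + M)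
               * exp (- t * (mu * (LINT \<theta>:{-pi..pi}|lborel. \<rho> \<theta> * (sin \<theta>)\<^sup>2))
                      * real (N + M) / real N))
           * rel_entropy M f0"
proof -
  interpret kac M N lamS lamR mu \<rho>
    by unfold_locales (use assms in auto)
  have CC: "CC t = real M / real (N + M) + real N / real (N + M)
               * exp (- t * (mu * (LINT \<theta>:{-pi..pi}|lborel. \<rho> \<theta> * (sin \<theta>)\<^sup>2))
                      * real (N + M) / real N)"
    by (simp add: CC_def muS_def)
  show ?thesis
  proof (cases "integrable (Rn M) (\<lambda>v. f0 v * ln (f0 v / gauss M v))")
    case True
    interpret kac_evolution M N lamS lamR mu \<rho> t f0 G
      by unfold_locales (use assms True in auto)
    show ?thesis using entropy_decay unfolding CC[symmetric] ft_def[abs_def] .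
  next
    \<comment> \<open>Infinite initial entropy: the right side is a positive number times
      infinity.\<close>
    case False
    then show ?thesis unfolding CC[symmetric] using CC_pos[of t] by (simp add: rel_entropy_def)
  qed
qed

end
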